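(* Let $\mathcal{T}$ be a homogeneous metric tree with branching number $b\ge2$ and edge length $r>0$. Let $u_0\in L^2(\mathcal{T})$ with $0\le u_0\le 1$ a.e. in $\mathcal{T}$. Let $f\in C^1([0,1])\cap C^\infty(0,1)$ satisfy $f(0)=f(1)=0$, $f(u)>0$ for all $u\in(0,1)$, and $\sup_{u\in(0,1]}\frac{f(u)}{u}=f'(0)$. Suppose that $f'(0)<E_0$, where $E_0:=\min\sigma(-\Delta)$. Let $u_0\not\equiv0$ be suitably small, in the sense that there are $\lambda\in(f'(0),E_0)$ and $\alpha\in(0,1)$ with $\alpha^2-2R\cos(\sqrt{\lambda}\,r)\,\alpha+1\le 0$, $R:=\frac{b+1}{2\sqrt b}$, such that $u_0(x)\le g(\rho(x))$ for a.e. $x\in\mathcal{T}$, where $g=g_{\lambda,\alpha}$ is the function defined for $n\in\mathbb{N}$ by $$g(\rho):=\frac{\alpha^{n-1}}{b^{n/2}}\Big\{\sqrt b\,\sin[\sqrt\lambda(nr-\rho)]+\alpha\sin[\sqrt\lambda(\rho-(n-1)r)]\Big\}\qquad(\rho\in[(n-1)r,nr]).$$ Then the solution $u$ of the problem $u_t=\Delta u+f(u)$ in $\mathcal{T}\times(0,\infty)$, $u=u_0$ in $\mathcal{T}\times\{0\}$, satisfies $$\lim_{t\to\infty}u(x,t)=0\quad\text{uniformly in }\mathcal{T}.$$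
   Context: Homogeneous metric trees. A metric tree is a connected metric graph without cycles (countably many vertices; edges $e$ are intervals $I_e=(0,l_e)$ of finite length glued at vertices) with a singled-out boundary vertex $O$ (the root, of degree $1$). The tree is homogeneous with branching number $b\ge 2$ and edge length $r$ if all edges have length $r$, exactly one edge emanates from $O$, and from every other vertex of generation $n\ge 1$ there emanate exactly $b$ edges leading to vertices of generation $n+1$ (the generation of a vertex is its number of edges from $O$); the tree is infinite. Let $d$ be the path metric and $\rho(x):=d(x,O)$. The measure $\mu$ on $\mathcal{T}$ is induced by Lebesgue measure on the edges. A function $f$ on $\mathcal{T}$ is identified with the family $\{f_e\}$ of its restrictions to edges. $H^1(\mathcal{T})$ is the set of $f\in L^2(\mathcal{T})$ which are continuous on $\mathcal{T}$ with weak derivative (edgewise) $f'\in L^2(\mathcal{T})$. Neumann Laplacian. $D(\Delta)$ is the set of $f\in H^1(\mathcal{T})$ such that $f_e\in H^2(I_e)$ for every edge $e$, $\sum_e\int_0^{l_e}|f_e''|^2dx<\infty$, and $\sum_{e\ni v}\frac{df_e}{d\nu}(v)=0$ at every vertex $v$ ($\frac{d}{d\nu}$ is the outer derivative; at $O$ this is the homogeneous Neumann condition, elsewhere the Kirchhoff condition); $(\Delta f)_e:=f_e''$. The operator $-\Delta$ is self-adjoint and nonnegative in $L^2(\mathcal{T})$; $\sigma(-\Delta)$ is its spectrum. Solution. A solution is a function $u\in C([0,\infty);L^2(\mathcal{T}))\cap C^1((0,\infty);L^2(\mathcal{T}))$ with $0\le u(\cdot,t)\le1$ a.e. in $\mathcal{T}$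 for all $t\ge0$, $u(\cdot,t)\in D(\Delta)$ for $t>0$, $\Delta u\in C((0,\infty);L^2(\mathcal{T}))$, $u_t(\cdot,t)=\Delta u(\cdot,t)+f(u(\cdot,t))$ a.e. in $\mathcal{T}$ for all $t>0$, and $u(\cdot,0)=u_0$ a.e. A unique solution exists under the stated assumptions on $u_0$ and $f$. *)

theory Defs
  imports "HOL-Analysis.Analysis"
begin

section \<open>Metric graphs and trees\<close>

text \<open>
  The edge \<open>e\<close> is the interval from \<open>0\<close> (glued to \<open>tail e\<close>) to \<open>elen e\<close> (glued to \<open>head e\<close>).
  The orientation only fixes this parametrisation; walks are undirected.  Loops and multiple
  edges are representable, and excluded for trees by the absence of cycles.
\<close>

record ('v, 'e) metric_graph =
  vertices :: "'v set"
  edges :: "'e set"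
  tail :: "'e \<Rightarrow> 'v"
  head :: "'e \<Rightarrow> 'v"
  elen :: "'e \<Rightarrow> real"
  origin :: "'v"

text \<open>The two ends of the edge \<open>e\<close> are \<open>(e, False)\<close>, at coordinate \<open>0\<close>, and \<open>(e, True)\<close>,
  at coordinate \<open>elen e\<close>.\<close>

definition endpoint :: "('v, 'e) metric_graph \<Rightarrow> 'e \<times> bool \<Rightarrow> 'v" where
  "endpoint G = (\<lambda>(e, d). if d then head G e else tail G e)"

definition end_coord :: "('v, 'e) metric_graph \<Rightarrow> 'e \<times> bool \<Rightarrow> real" where
  "end_coord G = (\<lambda>(e, d). if d then elen G e else 0)"

definition ends_at :: "('v, 'e) metric_graph \<Rightarrow> 'v \<Rightarrow> ('e \<times> bool) set" where
  "ends_at G v = {a. fst a \<in> edges G \<and> endpoint G a = v}"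

text \<open>The step \<open>(e, d)\<close> of a walk traverses \<open>e\<close> towards its end \<open>(e, d)\<close>.\<close>

fun walk :: "('v, 'e) metric_graph \<Rightarrow> 'v \<Rightarrow> ('e \<times> bool) list \<Rightarrow> 'v \<Rightarrow> bool" where
  "walk G u [] v \<longleftrightarrow> u \<in> vertices G \<and> u = v"
| "walk G u ((e, d) # p) v \<longleftrightarrow>
     e \<in> edges G \<and> endpoint G (e, \<not> d) = u \<and> walk G (endpoint G (e, d)) p v"

definition metric_graph :: "('v, 'e) metric_graph \<Rightarrow> bool" where
  "metric_graph G \<longleftrightarrow>
     countable (vertices G) \<and>
     (\<forall>e\<in>edges G. tail G e \<in> vertices G \<and> head G e \<in> vertices G \<and> 0 < elen G e) \<and>
     (\<forall>v\<in>vertices G. finite (ends_at G v))"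

definition metric_tree :: "('v, 'e) metric_graph \<Rightarrow> bool" where
  "metric_tree G \<longleftrightarrow>
     metric_graph G \<and>
     (\<forall>u\<in>vertices G. \<forall>v\<in>vertices G. \<exists>p. walk G u p v) \<and>
     (\<forall>v p. walk G v p v \<longrightarrow> distinct (map fst p) \<longrightarrow> p = []) \<and>
     origin G \<in> vertices G \<and> card (ends_at G (origin G)) = 1"

definition generation :: "('v, 'e) metric_graph \<Rightarrow> 'v \<Rightarrow> nat" where
  "generation G v = (LEAST n. \<exists>p. walk G (origin G) p v \<and> length p = n)"

text \<open>
  Edges are parametrised in the direction in which they emanate from the root: \<open>tail e\<close> is the
  vertex from which \<open>e\<close> emanates.
\<close>

definition homogeneous_tree :: "nat \<Rightarrow> real \<Rightarrow> ('v, 'e) metric_graph \<Rightarrow> bool" where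
  "homogeneous_tree b r G \<longleftrightarrow>
     metric_tree G \<and>
     (\<forall>e\<in>edges G. elen G e = r) \<and>
     (\<forall>e\<in>edges G. generation G (head G e) = generation G (tail G e) + 1) \<and>
     card {e\<in>edges G. tail G e = origin G} = 1 \<and>
     (\<forall>v\<in>vertices G. generation G v \<ge> 1 \<longrightarrow> card {e\<in>edges G. tail G e = v} = b)"

text \<open>
  A pair \<open>(e, x)\<close> with \<open>0 \<le> x \<le> elen e\<close> denotes the point at coordinate \<open>x\<close> of the edge \<open>e\<close>;
  a vertex is thus denoted once for each edge end located at it.  A function on the graph is a
  function of such pairs; its values at other pairs are irrelevant.
\<close>

definition points :: "('v, 'e) metric_graph \<Rightarrow> ('e \<times> real) set" where
  "points G = {(e, x). e \<in> edges G \<and> 0 \<le> x \<and> x \<le> elen G e}"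

definition vertex_dist :: "('v, 'e) metric_graph \<Rightarrow> 'v \<Rightarrow> 'v \<Rightarrow> real" where
  "vertex_dist G u v = (INF p\<in>{p. walk G u p v}. \<Sum>(e, d)\<leftarrow>p. elen G e)"

text \<open>The path distance of a point from the root: a path reaches \<open>(e, x)\<close> through one of the
  two ends of \<open>e\<close>.\<close>

definition rho :: "('v, 'e) metric_graph \<Rightarrow> 'e \<times> real \<Rightarrow> real" where
  "rho G = (\<lambda>(e, x). min (vertex_dist G (origin G) (tail G e) + x)
                         (vertex_dist G (origin G) (head G e) + (elen G e - x)))"


section \<open>Function spaces\<close>

text \<open>
  The elements of \<open>L2 G\<close> are functions, not classes, and equality in \<open>L\<^sup>2\<close> is stated with
  \<open>AE\<close>.  The functions are \<open>\<real>\<close>-valued for the evolution equation and \<open>\<complex>\<close>-valued for the spectrum.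
\<close>

definition graph_measure :: "('v, 'e) metric_graph \<Rightarrow> ('e \<times> real) measure" where
  "graph_measure G =
     restrict_space (count_space (edges G) \<Otimes>\<^sub>M lborel) {(e, x). e \<in> edges G \<and> 0 < x \<and> x < elen G e}"

definition L2 :: "('v, 'e) metric_graph \<Rightarrow> ('e \<times> real \<Rightarrow> 'a::{banach, second_countable_topology}) set" where
  "L2 G = {f. f \<in> borel_measurable (graph_measure G) \<and>
              integrable (graph_measure G) (\<lambda>p. (norm (f p))\<^sup>2)}"

definition L2_norm :: "('v, 'e) metric_graph \<Rightarrow> ('e \<times> real \<Rightarrow> 'a::{banach, second_countable_topology}) \<Rightarrow> real" where
  "L2_norm G f = sqrt (\<integral>p. (norm (f p))\<^sup>2 \<partial>graph_measure G)"

text \<open>\<open>C\<^sup>1\<close> functions with compact support in the open interval from \<open>0\<close> to \<open>l\<close>, with derivative.\<close>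

definition test_function :: "real \<Rightarrow> (real \<Rightarrow> real) \<Rightarrow> (real \<Rightarrow> real) \<Rightarrow> bool" where
  "test_function l \<phi> \<phi>' \<longleftrightarrow>
     (\<forall>x. (\<phi> has_real_derivative \<phi>' x) (at x)) \<and> continuous_on UNIV \<phi>' \<and>
     (\<exists>c d. 0 < c \<and> d < l \<and> (\<forall>x. x \<notin> {c..d} \<longrightarrow> \<phi> x = 0))"

definition locally_integrable :: "real \<Rightarrow> (real \<Rightarrow> 'a::{banach, second_countable_topology}) \<Rightarrow> bool" where
  "locally_integrable l f \<longleftrightarrow> (\<forall>c d. 0 < c \<longrightarrow> d < l \<longrightarrow> set_integrable lborel {c..d} f)"

definition has_weak_derivative ::
    "real \<Rightarrow> (real \<Rightarrow> 'a::{banach, second_countable_topology}) \<Rightarrow> (real \<Rightarrow> 'a) \<Rightarrow> bool" where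
  "has_weak_derivative l f g \<longleftrightarrow>
     locally_integrable l f \<and> locally_integrable l g \<and>
     (\<forall>\<phi> \<phi>'. test_function l \<phi> \<phi>' \<longrightarrow>
        (LINT x:{0<..<l}|lborel. \<phi>' x *\<^sub>R f x) = - (LINT x:{0<..<l}|lborel. \<phi> x *\<^sub>R g x))"

definition has_edge_derivative ::
    "('v, 'e) metric_graph \<Rightarrow> ('e \<times> real \<Rightarrow> 'a::{banach, second_countable_topology}) \<Rightarrow> ('e \<times> real \<Rightarrow> 'a) \<Rightarrow> bool" where
  "has_edge_derivative G f g \<longleftrightarrow>
     (\<forall>e\<in>edges G. has_weak_derivative (elen G e) (\<lambda>x. f (e, x)) (\<lambda>x. g (e, x)))"

definition continuous_on_graph ::
    "('v, 'e) metric_graph \<Rightarrow> ('e \<times> real \<Rightarrow> 'a::{banach, second_countable_topology}) \<Rightarrow> bool" where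
  "continuous_on_graph G f \<longleftrightarrow>
     (\<forall>e\<in>edges G. continuous_on {0..elen G e} (\<lambda>x. f (e, x))) \<and>
     (\<forall>v\<in>vertices G. \<forall>a\<in>ends_at G v. \<forall>a'\<in>ends_at G v.
        f (fst a, end_coord G a) = f (fst a', end_coord G a'))"

definition H1 :: "('v, 'e) metric_graph \<Rightarrow> ('e \<times> real \<Rightarrow> 'a::{banach, second_countable_topology}) set" where
  "H1 G = {f \<in> L2 G. continuous_on_graph G f \<and> (\<exists>g\<in>L2 G. has_edge_derivative G f g)}"


section \<open>The Neumann Laplacian and its spectrum\<close>

text \<open>Membership \<open>h \<in> L2 G\<close> says that every \<open>h\<^sub>e\<close> is square integrable and that the sum over
  all edges of the integrals of \<open>\<bar>h\<^sub>e\<bar>\<^sup>2\<close> is finite.\<close>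

definition has_laplacian ::
    "('v, 'e) metric_graph \<Rightarrow> ('e \<times> real \<Rightarrow> 'a::{banach, second_countable_topology}) \<Rightarrow> ('e \<times> real \<Rightarrow> 'a) \<Rightarrow> bool" where
  "has_laplacian G f h \<longleftrightarrow>
     h \<in> L2 G \<and> (\<exists>g\<in>L2 G. has_edge_derivative G f g \<and> has_edge_derivative G g h)"

text \<open>The derivative at an edge end in the direction pointing out of the edge.  A continuous
  function in \<open>H\<^sup>2\<close> of an edge is \<open>C\<^sup>1\<close> up to both ends, so the one-sided derivative exists.\<close>

definition outer_derivative ::
    "('v, 'e) metric_graph \<Rightarrow> ('e \<times> real \<Rightarrow> 'a::{banach, second_countable_topology}) \<Rightarrow> 'e \<times> bool \<Rightarrow> 'a" where
  "outer_derivative G f = (\<lambda>(e, d). (if d then 1 else - 1) *\<^sub>R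
     vector_derivative (\<lambda>x. f (e, x)) (at (end_coord G (e, d)) within {0..elen G e}))"

definition laplacian_domain ::
    "('v, 'e) metric_graph \<Rightarrow> ('e \<times> real \<Rightarrow> 'a::{banach, second_countable_topology}) set" where
  "laplacian_domain G = {f \<in> H1 G. (\<exists>h. has_laplacian G f h) \<and>
     (\<forall>v\<in>vertices G. (\<Sum>a\<in>ends_at G v. outer_derivative G f a) = 0)}"

definition laplacian ::
    "('v, 'e) metric_graph \<Rightarrow> ('e \<times> real \<Rightarrow> 'a::{banach, second_countable_topology}) \<Rightarrow> 'e \<times> real \<Rightarrow> 'a" where
  "laplacian G f = (SOME h. has_laplacian G f h)"

text \<open>\<open>z\<close> is in the resolvent set iff \<open>-\<Delta> - z\<close> maps the domain onto \<open>L\<^sup>2\<close> and has a bounded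
  inverse; the norm estimate includes injectivity.\<close>

definition resolvent_set :: "('v, 'e) metric_graph \<Rightarrow> complex set" where
  "resolvent_set G = {z.
     (\<forall>h\<in>L2 G. \<exists>f\<in>laplacian_domain G.
        AE p in graph_measure G. - laplacian G f p - z * f p = h p) \<and>
     (\<exists>C. \<forall>f\<in>laplacian_domain G.
        L2_norm G f \<le> C * L2_norm G (\<lambda>p. - laplacian G f p - z * f p))}"

definition spectrum :: "('v, 'e) metric_graph \<Rightarrow> complex set" where
  "spectrum G = - resolvent_set G"

definition is_min_spectrum :: "('v, 'e) metric_graph \<Rightarrow> real \<Rightarrow> bool" where
  "is_min_spectrum G E \<longleftrightarrow>
     complex_of_real E \<in> spectrum G \<and> (\<forall>E'. complex_of_real E' \<in> spectrum G \<longrightarrow> E \<le> E')"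


section \<open>Solutions\<close>

definition L2_continuous_on ::
    "('v, 'e) metric_graph \<Rightarrow> real set \<Rightarrow> (real \<Rightarrow> 'e \<times> real \<Rightarrow> real) \<Rightarrow> bool" where
  "L2_continuous_on G S w \<longleftrightarrow>
     (\<forall>t\<in>S. w t \<in> L2 G \<and>
        ((\<lambda>s. L2_norm G (\<lambda>p. w s p - w t p)) \<longlongrightarrow> 0) (at t within S))"

definition L2_has_derivative ::
    "('v, 'e) metric_graph \<Rightarrow> (real \<Rightarrow> 'e \<times> real \<Rightarrow> real) \<Rightarrow> ('e \<times> real \<Rightarrow> real) \<Rightarrow> real \<Rightarrow> bool" where
  "L2_has_derivative G w w' t \<longleftrightarrow>
     ((\<lambda>s. L2_norm G (\<lambda>p. (w s p - w t p) / (s - t) - w' p)) \<longlongrightarrow> 0) (at t)"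

text \<open>For \<open>t > 0\<close> the function \<open>u t\<close> is the continuous representative of its \<open>L\<^sup>2\<close> class,
  because the elements of \<open>H1 G\<close> are continuous functions.\<close>

definition is_solution ::
    "('v, 'e) metric_graph \<Rightarrow> (real \<Rightarrow> real) \<Rightarrow> ('e \<times> real \<Rightarrow> real) \<Rightarrow> (real \<Rightarrow> 'e \<times> real \<Rightarrow> real) \<Rightarrow> bool" where
  "is_solution G f u0 u \<longleftrightarrow>
     L2_continuous_on G {0..} u \<and>
     (\<forall>t\<ge>0. AE p in graph_measure G. 0 \<le> u t p \<and> u t p \<le> 1) \<and>
     (\<forall>t>0. u t \<in> laplacian_domain G) \<and>
     L2_continuous_on G {0<..} (\<lambda>t. laplacian G (u t)) \<and>
     (\<exists>u'. L2_continuous_on G {0<..} u' \<and>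
        (\<forall>t>0. L2_has_derivative G u (u' t) t) \<and>
        (\<forall>t>0. AE p in graph_measure G. u' t p = laplacian G (u t) p + f (u t p))) \<and>
     (AE p in graph_measure G. u 0 p = u0 p)"


section \<open>The majorant of the initial datum\<close>

text \<open>The \<open>n\<close>-th piece \<open>profile_piece b r lam \<alpha> n\<close> belongs to the interval from \<open>(n - 1) r\<close> to
  \<open>n r\<close>, for \<open>n \<ge> 1\<close>.  Consecutive pieces agree at \<open>n r\<close>, so choosing the right one there is
  immaterial.\<close>

definition profile_piece :: "nat \<Rightarrow> real \<Rightarrow> real \<Rightarrow> real \<Rightarrow> nat \<Rightarrow> real \<Rightarrow> real" where
  "profile_piece b r lam \<alpha> n \<rho> =
     \<alpha> ^ (n - 1) / real b powr (real n / 2) *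
       (sqrt (real b) * sin (sqrt lam * (real n * r - \<rho>)) +
        \<alpha> * sin (sqrt lam * (\<rho> - (real n - 1) * r)))"

definition profile :: "nat \<Rightarrow> real \<Rightarrow> real \<Rightarrow> real \<Rightarrow> real \<Rightarrow> real" where
  "profile b r lam \<alpha> \<rho> = profile_piece b r lam \<alpha> (nat \<lfloor>\<rho> / r\<rfloor> + 1) \<rho>"

lemma profile_piece_agree:
  assumes "b \<ge> 1" and "n \<ge> 1"
  shows "profile_piece b r lam \<alpha> n (real n * r) = profile_piece b r lam \<alpha> (n + 1) (real n * r)"
proof -
  obtain m where n: "n = Suc m"
    using assms(2) by (cases n) auto
  have b: "real b > 0"
    using assms(1) by simp
  have "real b powr (real (n + 1) / 2) = real b powr (real n / 2 + 1 / 2)"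
    by (simp add: add_divide_distrib add.commute)
  also have "\<dots> = real b powr (real n / 2) * sqrt (real b)"
    using b by (simp add: powr_add powr_half_sqrt)
  finally show ?thesis
    using b by (simp add: profile_piece_def n algebra_simps)
qed

lemma profile_eq_piece:
  assumes "b \<ge> 1" and "r > 0" and "n \<ge> 1" and "(real n - 1) * r \<le> \<rho>" and "\<rho> \<le> real n * r"
  shows "profile b r lam \<alpha> \<rho> = profile_piece b r lam \<alpha> n \<rho>"
proof (cases "\<rho> = real n * r")
  case True
  then have "\<lfloor>\<rho> / r\<rfloor> = int n"
    using assms(2) by simp
  then show ?thesis
    using profile_piece_agree[OF assms(1,3)] True by (simp add: profile_def)
next
  case False
  then have "real n - 1 \<le> \<rho> / r" and "\<rho> / r < real n"
    using assms by (simp_all add: field_simps)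
  then have "\<lfloor>\<rho> / r\<rfloor> = int n - 1"
    by (simp add: floor_eq_iff)
  then show ?thesis
    using assms(3) by (simp add: profile_def nat_diff_distrib)
qed

end

theory Submission
  imports Defs
begin

text \<open>
  The proof is an energy argument.  Let \<open>\<Phi>\<close> be the square of the \<open>L\<^sup>2\<close> norm of the solution
  \<open>u\<close> at time \<open>t\<close>, let \<open>E\<close> be the square of the \<open>L\<^sup>2\<close> norm of its edgewise derivative, and
  let \<open>a = f' 0\<close>, so that \<open>0 \<le> f x \<le> a x\<close> on the unit interval.

  The numbers \<open>lam = \<kappa>\<^sup>2\<close> and \<open>\<alpha>\<close> give the Poincare inequality \<open>lam * \<Phi> \<le> E\<close>
  (\<open>poincare\<close>).  Indeed, the majorant \<open>g\<close> solves \<open>- g'' = lam * g\<close> on every edge.  The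
  quadratic condition on \<open>\<alpha>\<close> says that at every vertex except the root the derivative of \<open>g\<close> on
  the incoming edge is at least the sum of its derivatives on the outgoing edges, and it implies
  that the derivative at the root is nonpositive.  Thus \<open>g\<close> is a supersolution of
  \<open>- \<Delta> = lam\<close>.  Where \<open>g > 0\<close>, the function \<open>m = g' / g\<close> satisfies the Riccati equation
  \<open>m' = - lam - m\<^sup>2\<close>, whence the Picone identity
  \<open>(w')\<^sup>2 - lam * w\<^sup>2 = (w' - m * w)\<^sup>2 + (m * w\<^sup>2)'\<close>.  The divergence theorem on the
  graph turns the integral of the last term into a sum over the vertices, and every summand is
  nonnegative.  All pieces of \<open>g\<close> are multiples of translates of one function on the interval from
  \<open>0\<close> to \<open>r\<close>, so that \<open>m\<close> is one function of the coordinate on the edge (\<open>logder\<close>).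

  The function \<open>g\<close> is positive if \<open>\<kappa> * r < \<pi> / 2\<close>.  The condition on \<open>\<alpha>\<close> gives
  \<open>cos (\<kappa> * r) > 0\<close>; to conclude, \<open>\<kappa> * r < \<pi>\<close> must be known.  This is where the bottom
  \<open>E0\<close> of the spectrum enters: the tree has the eigenvalue \<open>(\<pi> / r)\<^sup>2\<close>, with an eigenfunction
  that is a multiple of \<open>sin (\<pi> * x / r)\<close> on every edge (\<open>sine_eigenvalue\<close>), so that
  \<open>lam < E0 \<le> (\<pi> / r)\<^sup>2\<close>.

  Along the evolution, \<open>\<Phi>' \<le> - 2 * E + 2 * a * \<Phi> \<le> - 2 * (lam - a) * \<Phi>\<close>, and therefore \<open>\<Phi>\<close>
  decays exponentially.  Furthermore \<open>E' \<le> a\<^sup>2 / 2 * \<Phi>\<close>, so that \<open>E\<close> plus a suitable multiple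
  of \<open>\<Phi>\<close> is nonincreasing and \<open>E\<close> remains bounded.  On an edge of length \<open>r\<close> the one-dimensional
  inequality \<open>(u x)\<^sup>2 \<le> (1 / r + 1 / c) * \<Phi> + c * E\<close> holds for every \<open>c > 0\<close>
  (\<open>trace_bound\<close>); choosing first \<open>c\<close> small and then \<open>t\<close> large yields uniform convergence
  (\<open>uniform_decay\<close>).

  All of this presupposes that the weak derivatives in the definition of the Laplacian can be
  treated classically.  Hence the functions in its domain are first shown to be \<open>C\<^sup>1\<close> on closed
  edges, with absolutely continuous derivative (\<open>laplacian_regular\<close>).
\<close>

section \<open>Test functions and weak derivatives on an interval\<close>

lemma has_real_derivative_max0_square:
  "((\<lambda>y::real. (max 0 y)\<^sup>2) has_real_derivative 2 * max 0 y) (at y)"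
proof (cases y "0::real" rule: linorder_cases)
  case less
  have "((\<lambda>y::real. 0) has_real_derivative 0) (at y)" by simp
  then have "((\<lambda>y::real. (max 0 y)\<^sup>2) has_real_derivative 0) (at y)"
    by (rule has_field_derivative_transform_within_open[where S = "{..<0}"]) (use less in auto)
  then show ?thesis using less by simp
next
  case equal
  have "((\<lambda>h::real. ((max 0 (0+h))\<^sup>2 - (max 0 0)\<^sup>2) / h) \<longlongrightarrow> 0) (at 0)"
  proof (rule Lim_transform_eventually)
    have "((\<lambda>h::real. max 0 h) \<longlongrightarrow> max 0 0) (at 0)" by (intro tendsto_intros)
    then show "((\<lambda>h::real. max 0 h) \<longlongrightarrow> 0) (at 0)" by simp
    show "\<forall>\<^sub>F h in at 0. max 0 h = ((max 0 (0 + h))\<^sup>2 - (max 0 0)\<^sup>2) / (h::real)"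
      by (auto simp: eventually_at_filter max_def power2_eq_square)
  qed
  then show ?thesis using equal by (simp add: DERIV_def)
next
  case greater
  have "((\<lambda>y::real. y\<^sup>2) has_real_derivative 2 * y) (at y)"
    by (auto intro!: derivative_eq_intros)
  then have "((\<lambda>y::real. (max 0 y)\<^sup>2) has_real_derivative 2 * y) (at y)"
    by (rule has_field_derivative_transform_within_open[where S = "{0<..}"]) (use greater in auto)
  then show ?thesis using greater by simp
qed

text \<open>With \<open>q\<close> the square of the positive part of \<open>(x - a) * (b - x)\<close>, which is \<open>C\<^sup>1\<close>, the
  functions \<open>n * q / (1 + n * q)\<close> are \<open>C\<^sup>1\<close>, take values in the unit interval and increase to the
  indicator of the open interval from \<open>a\<close> to \<open>b\<close>.  They replace mollified indicators.\<close>

definition bump :: "real \<Rightarrow> real \<Rightarrow> nat \<Rightarrow> real \<Rightarrow> real" where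
  "bump a b n x = real n * (max 0 ((x - a) * (b - x)))\<^sup>2 / (1 + real n * (max 0 ((x - a) * (b - x)))\<^sup>2)"

lemma bump_zero: "x \<notin> {a<..<b} \<Longrightarrow> a \<le> b \<Longrightarrow> bump a b n x = 0"
  by (auto simp: bump_def max_def not_less zero_le_mult_iff)

lemma bump_bounds: "0 \<le> bump a b n x" "bump a b n x \<le> 1"
proof -
  have *: "0 \<le> real n * (max 0 ((x - a) * (b - x)))\<^sup>2" by simp
  then show "0 \<le> bump a b n x"
    unfolding bump_def by (intro divide_nonneg_nonneg) linarith+
  have "t / (1 + t) \<le> 1" if "0 \<le> t" for t :: real using that by simp
  then show "bump a b n x \<le> 1" unfolding bump_def using * by blast
qed

lemma bump_pos: "x \<in> {a<..<b} \<Longrightarrow> 0 < n \<Longrightarrow> 0 < bump a b n x"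
  unfolding bump_def by (intro divide_pos_pos add_pos_nonneg mult_pos_pos zero_less_power) auto

lemma bump_tendsto: "a \<le> b \<Longrightarrow> (\<lambda>n. bump a b n x) \<longlonglongrightarrow> indicator {a<..<b} x"
proof (cases "x \<in> {a<..<b}")
  case True
  define q where "q = (max 0 ((x - a) * (b - x)))\<^sup>2"
  have q: "q > 0" using True by (auto simp: q_def)
  have "(\<lambda>n. 1 / real n) \<longlonglongrightarrow> 0" by (rule lim_const_over_n)
  then have "(\<lambda>n. q / (1 / real n + q)) \<longlonglongrightarrow> q / (0 + q)"
    using q by (intro tendsto_intros) auto
  then have "(\<lambda>n. q / (1 / real n + q)) \<longlonglongrightarrow> 1" using q by simp
  moreover have "\<forall>\<^sub>F n in sequentially. q / (1 / real n + q) = bump a b n x"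
    using eventually_gt_at_top[of 0]
  proof eventually_elim
    case (elim n)
    then show ?case using q by (simp add: bump_def flip: q_def) (simp add: field_simps)
  qed
  ultimately show ?thesis using True by (auto intro: Lim_transform_eventually)
next
  case False
  assume "a \<le> b"
  with False show ?thesis by (simp add: bump_zero)
qed

lemma continuous_on_bump: "continuous_on S (bump a b n)"
  unfolding bump_def
  by (intro continuous_intros) (smt (verit) mult_nonneg_nonneg of_nat_0_le_iff zero_le_power2)

lemma test_function_bump:
  assumes "0 < a" "a \<le> b" "b < l"
  obtains \<psi> where "test_function l (bump a b n) \<psi>"
proof -
  define p where "p = (\<lambda>x. (x - a) * (b - x))"
  define \<psi> where "\<psi> x = real n * (2 * max 0 (p x) * (a + b - 2 * x)) / (1 + real n * (max 0 (p x))\<^sup>2)\<^sup>2" for x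
  have pos: "1 + real n * (max 0 (p x))\<^sup>2 \<noteq> 0" for x
    by (smt (verit) mult_nonneg_nonneg of_nat_0_le_iff zero_le_power2)
  have D: "(bump a b n has_real_derivative \<psi> x) (at x)" for x
  proof -
    have p: "(p has_real_derivative (a + b - 2 * x)) (at x)"
      unfolding p_def by (auto intro!: derivative_eq_intros)
    have q: "((\<lambda>x. (max 0 (p x))\<^sup>2) has_real_derivative 2 * max 0 (p x) * (a + b - 2 * x)) (at x)"
      using DERIV_chain2[OF has_real_derivative_max0_square p] by simp
    define Q where "Q = (\<lambda>x. (max 0 (p x))\<^sup>2)"
    define Q' where "Q' = 2 * max 0 (p x) * (a + b - 2 * x)"
    have Q: "(Q has_real_derivative Q') (at x)" using q by (simp add: Q_def Q'_def)
    have posQ: "1 + real n * Q x \<noteq> 0" using pos[of x] by (simp add: Q_def)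
    have "((\<lambda>x. real n * Q x) has_real_derivative real n * Q') (at x)"
      by (rule DERIV_cmult[OF Q])
    moreover have "((\<lambda>x. 1 + real n * Q x) has_real_derivative real n * Q') (at x)"
      using DERIV_add[OF DERIV_const[of 1] DERIV_cmult[OF Q, of "real n"]] by simp
    ultimately have "((\<lambda>x. real n * Q x / (1 + real n * Q x)) has_real_derivative
       (real n * Q' * (1 + real n * Q x) - real n * Q x * (real n * Q')) / ((1 + real n * Q x) * (1 + real n * Q x))) (at x)"
      using posQ by (intro DERIV_divide)
    moreover have "(real n * Q' * (1 + real n * Q x) - real n * Q x * (real n * Q')) / ((1 + real n * Q x) * (1 + real n * Q x))
       = \<psi> x"
      by (simp add: \<psi>_def Q_def Q'_def power2_eq_square algebra_simps)
    ultimately have "((\<lambda>x. real n * (max 0 (p x))\<^sup>2 / (1 + real n * (max 0 (p x))\<^sup>2)) has_real_derivative \<psi> x) (at x)"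
      by (simp add: Q_def)
    then show ?thesis by (simp add: bump_def[abs_def] p_def)
  qed
  moreover have "continuous_on UNIV \<psi>"
    unfolding \<psi>_def p_def using pos[unfolded p_def] by (intro continuous_intros) auto
  moreover have "\<forall>x. x \<notin> {a..b} \<longrightarrow> bump a b n x = 0" using assms by (auto intro: bump_zero)
  ultimately have "test_function l (bump a b n) \<psi>"
    unfolding test_function_def using assms by blast
  then show ?thesis by (rule that)
qed

lemma set_integrable_mult_continuous:
  fixes f :: "real \<Rightarrow> 'a::{banach, second_countable_topology}" and g :: "real \<Rightarrow> real"
  assumes "set_integrable lborel {a<..<b} f" "continuous_on {a..b} g"
  shows "set_integrable lborel {a<..<b} (\<lambda>x. g x *\<^sub>R f x)"
proof -
  obtain B where B: "\<And>x. x \<in> {a..b} \<Longrightarrow> \<bar>g x\<bar> \<le> B"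
    using compact_imp_bounded[OF compact_continuous_image[OF assms(2) compact_Icc]]
    unfolding bounded_iff by fastforce
  have g: "(\<lambda>x. indicator {a<..<b} x *\<^sub>R g x) \<in> borel_measurable lborel"
    using borel_measurable_continuous_on_indicator[OF _ continuous_on_subset[OF assms(2)], of "{a<..<b}"] by (simp add: subset_eq)
  have f: "integrable lborel (\<lambda>x. indicator {a<..<b} x *\<^sub>R f x)"
    using assms(1) by (simp add: set_integrable_def)
  have "integrable lborel (\<lambda>x. (indicator {a<..<b} x *\<^sub>R g x) *\<^sub>R (indicator {a<..<b} x *\<^sub>R f x))"
  proof (rule Bochner_Integration.integrable_bound)
    show "integrable lborel (\<lambda>x. B *\<^sub>R (indicator {a<..<b} x *\<^sub>R f x))" using f by (rule integrable_scaleR_right)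
    show "(\<lambda>x. (indicator {a<..<b} x *\<^sub>R g x) *\<^sub>R (indicator {a<..<b} x *\<^sub>R f x)) \<in> borel_measurable lborel"
      by (rule borel_measurable_scaleR[OF g borel_measurable_integrable[OF f]])
    show "AE x in lborel. norm ((indicator {a<..<b} x *\<^sub>R g x) *\<^sub>R (indicator {a<..<b} x *\<^sub>R f x)) \<le> norm (B *\<^sub>R (indicator {a<..<b} x *\<^sub>R f x))"
    proof (intro AE_I2)
      fix x
      show "norm ((indicator {a<..<b} x *\<^sub>R g x) *\<^sub>R (indicator {a<..<b} x *\<^sub>R f x)) \<le> norm (B *\<^sub>R (indicator {a<..<b} x *\<^sub>R f x))"
        using B[of x] by (auto simp: indicator_def intro!: mult_right_mono)
    qed
  qed
  moreover have "(\<lambda>x. (indicator {a<..<b} x *\<^sub>R g x) *\<^sub>R (indicator {a<..<b} x *\<^sub>R f x)) = (\<lambda>x. indicator {a<..<b} x *\<^sub>R g x *\<^sub>R f x)"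
    by (auto simp: indicator_def)
  ultimately show ?thesis by (simp add: set_integrable_def)
qed

lemma set_integrable_times_continuous:
  fixes f g :: "real \<Rightarrow> real"
  assumes "set_integrable lborel {a<..<b} f" "continuous_on {a..b} g"
  shows "set_integrable lborel {a<..<b} (\<lambda>x. f x * g x)"
  using set_integrable_mult_continuous[OF assms] by (simp add: mult.commute)

text \<open>The open intervals form a generator of the Borel sets that is stable under intersection, so
  vanishing of the integrals extends from intervals to all Borel sets by a Dynkin argument.\<close>

lemma AE_zero_if_interval_integrals_zero:
  fixes k :: "real \<Rightarrow> 'a::{banach, second_countable_topology}"
  assumes int: "integrable lborel k"
    and zero: "\<And>a b. a < b \<Longrightarrow> (LINT x:{a<..<b}|lborel. k x) = 0"
    and tot: "(LINT x|lborel. k x) = 0"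
  shows "AE x in lborel. k x = 0"
proof (rule sigma_finite_measure.density_zero[OF lborel.sigma_finite_measure_axioms int])
  fix A :: "real set" assume "A \<in> sets lborel"
  have eq: "sigma_sets UNIV (range (\<lambda>(a, b). {a <..< b})) = sets (borel :: real measure)"
  proof -
    have "(\<lambda>(a, b). {a<..<b}) = (\<lambda>(a, b). box a b :: real set)" by (auto simp: fun_eq_iff box_def)
    then show ?thesis by (simp add: borel_eq_box)
  qed
  with \<open>A \<in> sets lborel\<close> have A: "A \<in> sigma_sets UNIV (range (\<lambda>(a, b). {a <..< b}))"
    by simp
  have si: "set_integrable lborel B k" if "B \<in> sets borel" for B
    using int that by (auto simp: set_integrable_def intro: integrable_mult_indicator)
  have stable: "Int_stable (range (\<lambda>(a::real, b). {a <..< b}))"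
  proof (rule Int_stableI)
    fix X Y :: "real set" assume "X \<in> range (\<lambda>(a, b). {a <..< b})" "Y \<in> range (\<lambda>(a, b). {a <..< b})"
    then obtain a b c d where "X = {a<..<b}" "Y = {c<..<d}" by auto
    then have "X \<inter> Y = {max a c<..<min b d}" by auto
    then show "X \<inter> Y \<in> range (\<lambda>(a, b). {a <..< b})"
      by (metis (mono_tags, lifting) case_prod_conv rangeI)
  qed
  show "(LINT x:A|lborel. k x) = 0"
    using stable subset_UNIV[of "range (\<lambda>(a::real, b). {a <..< b})", folded Pow_UNIV] A
  proof (induction rule: sigma_sets_induct_disjoint)
    case (basic B)
    then obtain a b where B: "B = {a<..<b}" by auto
    show ?case using zero[of a b] by (cases "a < b") (auto simp: B set_lebesgue_integral_def)
  next
    case empty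
    then show ?case by (simp add: set_lebesgue_integral_def)
  next
    case (compl B)
    have m: "B \<in> sets borel" using compl(1) by (simp add: eq)
    have "(LINT x:(B \<union> (UNIV - B))|lborel. k x) = (LINT x:B|lborel. k x) + (LINT x:(UNIV - B)|lborel. k x)"
      using m by (intro set_integral_Un si) auto
    then show ?case using compl(2) tot by (simp add: set_lebesgue_integral_def)
  next
    case (union B)
    have m: "\<And>i. B i \<in> sets borel" using union(2) by (auto simp: eq[symmetric])
    have "(LINT x:(\<Union>i. B i)|lborel. k x) = (\<Sum>i. LINT x:B i|lborel. k x)"
    proof (rule lebesgue_integral_countable_add)
      show "\<And>i j. i \<noteq> j \<Longrightarrow> B i \<inter> B j = {}" using union(1) by (auto simp: disjoint_family_on_def)
      show "set_integrable lborel (\<Union> (range B)) k" using m by (intro si) auto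
    qed (use m in auto)
    then show ?case using union(3) by simp
  qed
qed

lemma AE_interval_exhaust:
  fixes P :: "real \<Rightarrow> bool"
  assumes "\<And>c d. 0 < c \<Longrightarrow> c < d \<Longrightarrow> d < l \<Longrightarrow> AE x in lborel. c < x \<and> x < d \<longrightarrow> P x"
  shows "AE x in lborel. 0 < x \<and> x < l \<longrightarrow> P x"
proof -
  have "AE x in lborel. \<forall>n::nat. 1 / real (Suc n) < x \<and> x < l - 1 / real (Suc n) \<longrightarrow> P x"
    unfolding AE_all_countable
  proof
    fix n
    show "AE x in lborel. 1 / real (Suc n) < x \<and> x < l - 1 / real (Suc n) \<longrightarrow> P x"
      using assms[of "1 / real (Suc n)" "l - 1 / real (Suc n)"]
      by (cases "1 / real (Suc n) < l - 1 / real (Suc n)") auto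
  qed
  then show ?thesis
  proof (rule AE_mp, intro AE_I2 impI)
    fix x assume *: "\<forall>n::nat. 1 / real (Suc n) < x \<and> x < l - 1 / real (Suc n) \<longrightarrow> P x" "0 < x \<and> x < l"
    obtain n where "1 / real (Suc n) < min x (l - x)"
      using nat_approx_posE[of "min x (l - x)"] *(2) by auto
    then show "P x" using *(1)[rule_format, of n] by auto
  qed
qed

lemma locally_integrable_subinterval:
  assumes "locally_integrable l k" "0 < a" "b < l"
  shows "set_integrable lborel {a<..<b} k"
proof -
  have "set_integrable lborel {a..b} k" using assms by (auto simp: locally_integrable_def)
  then show ?thesis by (rule set_integrable_subset) auto
qed

text \<open>The fundamental lemma of the calculus of variations.  By dominated convergence along
  \<open>bump\<close> functions, the integral of \<open>k\<close> over every interval compactly contained in the domain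
  vanishes.\<close>

lemma fundamental_lemma:
  fixes k :: "real \<Rightarrow> 'a::{banach, second_countable_topology}"
  assumes loc: "locally_integrable l k"
    and zero: "\<And>\<phi> \<phi>'. test_function l \<phi> \<phi>' \<Longrightarrow> (LINT x:{0<..<l}|lborel. \<phi> x *\<^sub>R k x) = 0"
  shows "AE x in lborel. 0 < x \<and> x < l \<longrightarrow> k x = 0"
proof (rule AE_interval_exhaust)
  have int0: "(LINT x:{a<..<b}|lborel. k x) = 0" if ab: "0 < a" "a < b" "b < l" for a b
  proof -
    have si: "integrable lborel (\<lambda>x. indicator {a<..<b} x *\<^sub>R k x)"
      using locally_integrable_subinterval[OF loc ab(1,3)] by (simp add: set_integrable_def)
    have "(\<lambda>n. LINT x|lborel. bump a b n x *\<^sub>R (indicator {a<..<b} x *\<^sub>R k x))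
          \<longlonglongrightarrow> (LINT x|lborel. indicator {a<..<b} x *\<^sub>R (indicator {a<..<b} x *\<^sub>R k x))"
    proof (rule integral_dominated_convergence)
      show "integrable lborel (\<lambda>x. norm (indicator {a<..<b} x *\<^sub>R k x))" using si by (rule integrable_norm)
      show "(\<lambda>x. indicator {a<..<b} x *\<^sub>R indicator {a<..<b} x *\<^sub>R k x) \<in> borel_measurable lborel"
        by (rule borel_measurable_scaleR[OF _ borel_measurable_integrable[OF si]]) simp
      have "bump a b n \<in> borel_measurable lborel" for n
        by (simp add: borel_measurable_continuous_onI continuous_on_bump)
      then show "(\<lambda>x. bump a b n x *\<^sub>R (indicator {a<..<b} x *\<^sub>R k x)) \<in> borel_measurable lborel" for n
        by (rule borel_measurable_scaleR[OF _ borel_measurable_integrable[OF si]])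
      show "AE x in lborel. (\<lambda>n. bump a b n x *\<^sub>R (indicator {a<..<b} x *\<^sub>R k x)) \<longlonglongrightarrow> indicator {a<..<b} x *\<^sub>R (indicator {a<..<b} x *\<^sub>R k x)"
        using ab by (intro AE_I2 tendsto_scaleR bump_tendsto tendsto_const) auto
      show "AE x in lborel. norm (bump a b n x *\<^sub>R (indicator {a<..<b} x *\<^sub>R k x)) \<le> norm (indicator {a<..<b} x *\<^sub>R k x)" for n
        using bump_bounds[of a b n] by (intro AE_I2) (auto intro!: mult_left_le_one_le simp: mult.assoc)
    qed
    moreover have "(LINT x|lborel. bump a b n x *\<^sub>R (indicator {a<..<b} x *\<^sub>R k x)) = 0" for n
    proof -
      obtain \<psi> where "test_function l (bump a b n) \<psi>" using test_function_bump[of a b l n] ab by auto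
      then have "0 = (LINT x:{0<..<l}|lborel. bump a b n x *\<^sub>R k x)" using zero by simp
      also have "\<dots> = (LINT x|lborel. bump a b n x *\<^sub>R (indicator {a<..<b} x *\<^sub>R k x))"
        unfolding set_lebesgue_integral_def
      proof (intro Bochner_Integration.integral_cong refl)
        fix x
        show "indicator {0<..<l} x *\<^sub>R bump a b n x *\<^sub>R k x = bump a b n x *\<^sub>R indicator {a<..<b} x *\<^sub>R k x"
          using ab bump_zero[of x a b n] by (cases "x \<in> {a<..<b}") (auto simp: indicator_def)
      qed
      finally show ?thesis by simp
    qed
    ultimately have "(LINT x|lborel. indicator {a<..<b} x *\<^sub>R (indicator {a<..<b} x *\<^sub>R k x)) = 0"
      by (simp add: LIMSEQ_const_iff)
    moreover have "(\<lambda>x. indicator {a<..<b} x *\<^sub>R (indicator {a<..<b} x *\<^sub>R k x)) = (\<lambda>x. indicator {a<..<b} x *\<^sub>R k x)"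
      by (auto simp: indicator_def)
    ultimately show ?thesis by (simp add: set_lebesgue_integral_def)
  qed
  fix c d :: real assume cd: "0 < c" "c < d" "d < l"
  have "AE x in lborel. indicator {c<..<d} x *\<^sub>R k x = 0"
  proof (rule AE_zero_if_interval_integrals_zero)
    show "integrable lborel (\<lambda>x. indicator {c<..<d} x *\<^sub>R k x)"
      using locally_integrable_subinterval[OF loc cd(1,3)] by (simp add: set_integrable_def)
    show "(LINT x|lborel. indicator {c<..<d} x *\<^sub>R k x) = 0"
      using int0[OF cd] by (simp add: set_lebesgue_integral_def)
    fix a b :: real assume "a < b"
    have "(LINT x:{a<..<b}|lborel. indicator {c<..<d} x *\<^sub>R k x) = (LINT x:{max a c<..<min b d}|lborel. k x)"
      unfolding set_lebesgue_integral_def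
      by (intro Bochner_Integration.integral_cong refl) (auto simp: indicator_def)
    also have "\<dots> = 0"
    proof (cases "max a c < min b d")
      case True
      then show ?thesis using cd by (intro int0) auto
    next
      case False
      then have "{max a c<..<min b d} = {}" by auto
      then show ?thesis by (simp add: set_lebesgue_integral_def)
    qed
    finally show "(LINT x:{a<..<b}|lborel. indicator {c<..<d} x *\<^sub>R k x) = 0" .
  qed
  then show "AE x in lborel. c < x \<and> x < d \<longrightarrow> k x = 0"
    by eventually_elim (auto simp: indicator_def)
qed

lemma test_function_continuous:
  assumes "test_function l \<phi> \<phi>'"
  shows "continuous_on S \<phi>" "continuous_on S \<phi>'"
proof -
  have "\<And>x. isCont \<phi> x" using assms unfolding test_function_def by (auto intro: DERIV_isCont)
  then show "continuous_on S \<phi>" by (simp add: continuous_at_imp_continuous_on)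
  show "continuous_on S \<phi>'" using assms unfolding test_function_def by (auto intro: continuous_on_subset)
qed

lemma test_function_derivative_zero:
  assumes "test_function l \<phi> \<phi>'" "\<forall>x. x \<notin> {c..d} \<longrightarrow> \<phi> x = 0" "x \<notin> {c..d}"
  shows "\<phi>' x = 0"
proof -
  have "(\<phi> has_real_derivative \<phi>' x) (at x)" using assms(1) by (simp add: test_function_def)
  moreover have "(\<phi> has_real_derivative 0) (at x)"
  proof (rule has_field_derivative_transform_within_open[where f = "\<lambda>_. 0" and S = "- {c..d}"])
    show "open (- {c..d})" by (intro open_Compl closed_atLeastAtMost)
  qed (use assms(2,3) in auto)
  ultimately show ?thesis by (rule DERIV_unique)
qed

text \<open>The closed support interval in the definition of test functions may be empty or a single
  point; it is enlarged here to a proper open interval, outside of which the derivative vanishes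
  as well.\<close>

lemma test_function_localize:
  assumes "test_function l \<phi> \<phi>'" "0 < l"
  obtains c d where "0 < c" "c < d" "d < l"
    "\<And>x. x \<notin> {c<..<d} \<Longrightarrow> \<phi> x = 0" "\<And>x. x \<notin> {c<..<d} \<Longrightarrow> \<phi>' x = 0"
proof -
  obtain c d where cd: "0 < c" "d < l" "\<forall>x. x \<notin> {c..d} \<longrightarrow> \<phi> x = 0"
    using assms by (auto simp: test_function_def)
  have l: "0 < l" by fact
  assume *: "\<And>c d. 0 < c \<Longrightarrow> c < d \<Longrightarrow> d < l \<Longrightarrow>
    (\<And>x. x \<notin> {c<..<d} \<Longrightarrow> \<phi> x = 0) \<Longrightarrow> (\<And>x. x \<notin> {c<..<d} \<Longrightarrow> \<phi>' x = 0) \<Longrightarrow> thesis"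
  \<comment> \<open>The terms with \<open>l\<close> guarantee \<open>c' < d'\<close>.\<close>
  define c' d' where "c' = min (c/2) (l/3)" and "d' = max ((d+l)/2) (2*l/3)"
  show thesis
  proof (rule *[of c' d'])
    show "0 < c'" "c' < d'" "d' < l" using l cd by (auto simp: c'_def d'_def)
    have "x \<notin> {c..d}" if "x \<notin> {c'<..<d'}" for x
      using that cd(1,2) l unfolding c'_def d'_def by (auto simp: min_def max_def split: if_splits)
    then show "x \<notin> {c'<..<d'} \<Longrightarrow> \<phi> x = 0" "x \<notin> {c'<..<d'} \<Longrightarrow> \<phi>' x = 0" for x
      using cd(3) test_function_derivative_zero[OF assms(1) cd(3)] by auto
  qed
qed

lemma test_function_integrable:
  fixes f :: "real \<Rightarrow> 'a::{banach, second_countable_topology}"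
  assumes t: "test_function l \<phi> \<phi>'" and loc: "locally_integrable l f" and l: "0 < l"
  shows "set_integrable lborel {0<..<l} (\<lambda>x. \<phi> x *\<^sub>R f x)"
    and "set_integrable lborel {0<..<l} (\<lambda>x. \<phi>' x *\<^sub>R f x)"
proof -
  obtain c d where cd: "0 < c" "c < d" "d < l"
    "\<And>x. x \<notin> {c<..<d} \<Longrightarrow> \<phi> x = 0" "\<And>x. x \<notin> {c<..<d} \<Longrightarrow> \<phi>' x = 0"
    using test_function_localize[OF t l] by blast
  have f: "set_integrable lborel {c<..<d} f" by (rule locally_integrable_subinterval[OF loc cd(1,3)])
  have *: "set_integrable lborel {0<..<l} (\<lambda>x. g x *\<^sub>R f x)"
    if "continuous_on {c..d} g" "\<And>x. x \<notin> {c<..<d} \<Longrightarrow> g x = 0" for g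
  proof -
    have "(\<lambda>x. indicator {0<..<l} x *\<^sub>R g x *\<^sub>R f x) = (\<lambda>x. indicator {c<..<d} x *\<^sub>R g x *\<^sub>R f x)"
    proof
      fix x show "indicator {0<..<l} x *\<^sub>R g x *\<^sub>R f x = indicator {c<..<d} x *\<^sub>R g x *\<^sub>R f x"
        using that(2)[of x] cd by (cases "x \<in> {c<..<d}") (auto simp: indicator_def)
    qed
    then show ?thesis
      using set_integrable_mult_continuous[OF f that(1)] by (simp add: set_integrable_def)
  qed
  show "set_integrable lborel {0<..<l} (\<lambda>x. \<phi> x *\<^sub>R f x)"
    using test_function_continuous[OF t] cd by (intro *) auto
  show "set_integrable lborel {0<..<l} (\<lambda>x. \<phi>' x *\<^sub>R f x)"
    using test_function_continuous[OF t] cd by (intro *) auto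
qed

lemma weak_derivative_unique:
  fixes f f' g g' :: "real \<Rightarrow> 'a::{banach, second_countable_topology}"
  assumes 1: "has_weak_derivative l f g" and 2: "has_weak_derivative l f' g'" and l: "0 < l"
    and eq: "AE x in lborel. 0 < x \<and> x < l \<longrightarrow> f x = f' x"
  shows "AE x in lborel. 0 < x \<and> x < l \<longrightarrow> g x = g' x"
proof -
  have lg: "locally_integrable l g" "locally_integrable l g'" using 1 2 by (auto simp: has_weak_derivative_def)
  have lf: "locally_integrable l f" "locally_integrable l f'" using 1 2 by (auto simp: has_weak_derivative_def)
  have "AE x in lborel. 0 < x \<and> x < l \<longrightarrow> g x - g' x = 0"
  proof (rule fundamental_lemma)
    show "locally_integrable l (\<lambda>x. g x - g' x)"
      using lg by (auto simp: locally_integrable_def intro!: set_integral_diff)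
    fix \<phi> \<phi>' assume t: "test_function l \<phi> \<phi>'"
    have e: "(LINT x:{0<..<l}|lborel. \<phi>' x *\<^sub>R f x) = (LINT x:{0<..<l}|lborel. \<phi>' x *\<^sub>R f' x)"
    proof (unfold set_lebesgue_integral_def, rule integral_cong_AE)
      show "(\<lambda>x. indicator {0<..<l} x *\<^sub>R \<phi>' x *\<^sub>R f x) \<in> borel_measurable lborel"
        using test_function_integrable(2)[OF t lf(1) l] by (auto simp: set_integrable_def)
      show "(\<lambda>x. indicator {0<..<l} x *\<^sub>R \<phi>' x *\<^sub>R f' x) \<in> borel_measurable lborel"
        using test_function_integrable(2)[OF t lf(2) l] by (auto simp: set_integrable_def)
      show "AE x in lborel. indicator {0<..<l} x *\<^sub>R \<phi>' x *\<^sub>R f x = indicator {0<..<l} x *\<^sub>R \<phi>' x *\<^sub>R f' x"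
        using eq by eventually_elim (auto simp: indicator_def)
    qed
    have "(LINT x:{0<..<l}|lborel. \<phi> x *\<^sub>R (g x - g' x)) =
       (LINT x:{0<..<l}|lborel. \<phi> x *\<^sub>R g x) - (LINT x:{0<..<l}|lborel. \<phi> x *\<^sub>R g' x)"
      using set_integral_diff(2)[OF test_function_integrable(1)[OF t lg(1) l] test_function_integrable(1)[OF t lg(2) l]]
      by (simp add: scaleR_diff_right)
    also have "\<dots> = 0"
    proof -
      have "(LINT x:{0<..<l}|lborel. \<phi>' x *\<^sub>R f x) = - (LINT x:{0<..<l}|lborel. \<phi> x *\<^sub>R g x)"
        using 1 t by (simp add: has_weak_derivative_def)
      moreover have "(LINT x:{0<..<l}|lborel. \<phi>' x *\<^sub>R f' x) = - (LINT x:{0<..<l}|lborel. \<phi> x *\<^sub>R g' x)"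
        using 2 t by (simp add: has_weak_derivative_def)
      ultimately show ?thesis using e by simp
    qed
    finally show "(LINT x:{0<..<l}|lborel. \<phi> x *\<^sub>R (g x - g' x)) = 0" .
  qed
  then show ?thesis by eventually_elim auto
qed

section \<open>Absolutely continuous functions on an interval\<close>

lemma lborel_product_integrable:
  fixes p q :: "real \<Rightarrow> real"
  assumes p: "integrable lborel p" and q: "integrable lborel q"
  shows "integrable (lborel \<Otimes>\<^sub>M lborel) (\<lambda>(x, y). p x * q y)"
proof (rule lborel_pair.Fubini_integrable)
  have [measurable]: "p \<in> borel_measurable lborel" "q \<in> borel_measurable lborel" using p q by auto
  show "(\<lambda>(x, y). p x * q y) \<in> borel_measurable (lborel \<Otimes>\<^sub>M lborel)" by measurable
  have "(\<lambda>x. LINT y|lborel. norm (case (x, y) of (x, y) \<Rightarrow> p x * q y)) = (\<lambda>x. \<bar>p x\<bar> * (LINT y|lborel. \<bar>q y\<bar>))"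
    by (auto simp: abs_mult)
  then show "integrable lborel (\<lambda>x. LINT y|lborel. norm (case (x, y) of (x, y) \<Rightarrow> p x * q y))"
    using p by auto
  show "AE x in lborel. integrable lborel (\<lambda>y. case (x, y) of (x, y) \<Rightarrow> p x * q y)"
    using q by auto
qed

text \<open>The Fubini theorem on the two triangles into which the diagonal divides the plane.  It is
  integration by parts for functions that are merely integrals of integrable functions.\<close>

lemma integral_triangle_swap:
  fixes p q :: "real \<Rightarrow> real"
  assumes p: "integrable lborel p" and q: "integrable lborel q"
  shows "(LINT s|lborel. p s * (LINT y:{..<s}|lborel. q y)) + (LINT s|lborel. q s * (LINT y:{..<s}|lborel. p y))
    = (LINT s|lborel. p s) * (LINT s|lborel. q s)"
    and "integrable lborel (\<lambda>s. p s * (LINT y:{..<s}|lborel. q y))"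
proof -
  have [measurable]: "p \<in> borel_measurable lborel" "q \<in> borel_measurable lborel" using p q by auto
  define A where "A = (\<lambda>s y. if y < s then p s * q y else 0)"
  define B where "B = (\<lambda>s y. if s < y then p s * q y else 0)"
  have mA: "case_prod A \<in> borel_measurable (lborel \<Otimes>\<^sub>M lborel)" unfolding A_def by measurable
  have mB: "case_prod B \<in> borel_measurable (lborel \<Otimes>\<^sub>M lborel)" unfolding B_def by measurable
  have iA: "integrable (lborel \<Otimes>\<^sub>M lborel) (case_prod A)"
    by (rule Bochner_Integration.integrable_bound[OF lborel_product_integrable[OF p q] mA]) (auto simp: A_def)
  have iB: "integrable (lborel \<Otimes>\<^sub>M lborel) (case_prod B)"
    by (rule Bochner_Integration.integrable_bound[OF lborel_product_integrable[OF p q] mB]) (auto simp: B_def)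
  have A: "p s * (LINT y:{..<s}|lborel. q y) = (LINT y|lborel. A s y)" for s
  proof -
    have "p s * (LINT y:{..<s}|lborel. q y) = (LINT y|lborel. p s * (indicator {..<s} y *\<^sub>R q y))"
      by (simp add: set_lebesgue_integral_def)
    also have "\<dots> = (LINT y|lborel. A s y)"
      by (intro Bochner_Integration.integral_cong refl) (auto simp: A_def indicator_def)
    finally show ?thesis .
  qed
  have B: "q y * (LINT s:{..<y}|lborel. p s) = (LINT s|lborel. B s y)" for y
  proof -
    have "q y * (LINT s:{..<y}|lborel. p s) = (LINT s|lborel. q y * (indicator {..<y} s *\<^sub>R p s))"
      by (simp add: set_lebesgue_integral_def)
    also have "\<dots> = (LINT s|lborel. B s y)"
      by (intro Bochner_Integration.integral_cong refl) (auto simp: B_def indicator_def)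
    finally show ?thesis .
  qed
  have swap: "(LINT y|lborel. (LINT s|lborel. B s y)) = (LINT s|lborel. (LINT y|lborel. B s y))"
    by (rule lborel_pair.Fubini_integral[OF iB])
  have "(LINT s|lborel. (LINT y|lborel. A s y)) + (LINT s|lborel. (LINT y|lborel. B s y))
      = (LINT s|lborel. (LINT y|lborel. A s y) + (LINT y|lborel. B s y))"
    using lborel_pair.integrable_fst[OF iA] lborel_pair.integrable_fst[OF iB] by simp
  also have "\<dots> = (LINT s|lborel. p s * (LINT y|lborel. q y))"
  proof (intro Bochner_Integration.integral_cong refl)
    fix s
    have pq: "integrable lborel (\<lambda>y. p s * q y)" using q by simp
    have "integrable lborel (A s)"
      by (rule Bochner_Integration.integrable_bound[OF pq]) (auto simp: A_def)
    moreover have "integrable lborel (B s)"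
      by (rule Bochner_Integration.integrable_bound[OF pq]) (auto simp: B_def)
    ultimately have "(LINT y|lborel. A s y) + (LINT y|lborel. B s y) = (LINT y|lborel. A s y + B s y)" by simp
    also have "\<dots> = (LINT y|lborel. p s * q y)"
    proof (rule integral_cong_AE)
      show "AE y in lborel. A s y + B s y = p s * q y"
        using AE_lborel_singleton[of s] by eventually_elim (auto simp: A_def B_def)
    qed (auto simp: A_def B_def)
    finally show "(LINT y|lborel. A s y) + (LINT y|lborel. B s y) = p s * (LINT y|lborel. q y)" by simp
  qed
  finally show "(LINT s|lborel. p s * (LINT y:{..<s}|lborel. q y)) + (LINT s|lborel. q s * (LINT y:{..<s}|lborel. p y))
    = (LINT s|lborel. p s) * (LINT s|lborel. q s)"
    unfolding A B swap by simp
  show "integrable lborel (\<lambda>s. p s * (LINT y:{..<s}|lborel. q y))"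
    unfolding A by (rule lborel_pair.integrable_fst[OF iA])
qed

text \<open>\<open>w\<close> is absolutely continuous on the closed interval with derivative \<open>h\<close>, expressed by the
  fundamental theorem of calculus; this is the form in which all later arguments use it.\<close>

definition ac_on :: "real \<Rightarrow> real \<Rightarrow> (real \<Rightarrow> real) \<Rightarrow> (real \<Rightarrow> real) \<Rightarrow> bool" where
  "ac_on a b w h \<longleftrightarrow> a \<le> b \<and> set_integrable lborel {a<..<b} h \<and>
     (\<forall>x\<in>{a..b}. w x = w a + (LINT y:{a<..<x}|lborel. h y))"

lemma set_integral_interval_split:
  fixes h :: "real \<Rightarrow> real"
  assumes "set_integrable lborel {a<..<b} h" "a \<le> c" "c \<le> x" "x \<le> b"
  shows "(LINT y:{a<..<x}|lborel. h y) = (LINT y:{a<..<c}|lborel. h y) + (LINT y:{c<..<x}|lborel. h y)"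
proof -
  have i: "set_integrable lborel {u<..<v} h" if "a \<le> u" "v \<le> b" for u v
    by (rule set_integrable_subset[OF assms(1)]) (use that in auto)
  have ii: "integrable lborel (\<lambda>y. indicator {u<..<v} y *\<^sub>R h y)" if "a \<le> u" "v \<le> b" for u v
    using i[OF that] by (simp add: set_integrable_def)
  have "(LINT y:{a<..<c}|lborel. h y) + (LINT y:{c<..<x}|lborel. h y)
     = (LINT y|lborel. indicator {a<..<c} y *\<^sub>R h y + indicator {c<..<x} y *\<^sub>R h y)"
    unfolding set_lebesgue_integral_def using assms
    by (intro Bochner_Integration.integral_add[symmetric] ii) auto
  also have "\<dots> = (LINT y:{a<..<x}|lborel. h y)"
    unfolding set_lebesgue_integral_def
  proof (rule integral_cong_AE)
    show "AE y in lborel. indicat_real {a<..<c} y *\<^sub>R h y + indicat_real {c<..<x} y *\<^sub>R h y = indicat_real {a<..<x} y *\<^sub>R h y"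
      using AE_lborel_singleton[of c] by eventually_elim (use assms in \<open>auto simp: indicator_def\<close>)
    show "(\<lambda>y. indicat_real {a<..<c} y *\<^sub>R h y + indicat_real {c<..<x} y *\<^sub>R h y) \<in> borel_measurable lborel"
      using ii[of a c] ii[of c x] assms by (intro borel_measurable_add borel_measurable_integrable) auto
    show "(\<lambda>y. indicat_real {a<..<x} y *\<^sub>R h y) \<in> borel_measurable lborel"
      using ii[of a x] assms by (intro borel_measurable_integrable) auto
  qed
  finally show ?thesis by simp
qed

lemma ac_on_le: "ac_on a b w h \<Longrightarrow> a \<le> b"
  and ac_on_integrable: "ac_on a b w h \<Longrightarrow> set_integrable lborel {a<..<b} h"
  and ac_on_eq: "ac_on a b w h \<Longrightarrow> x \<in> {a..b} \<Longrightarrow> w x = w a + (LINT y:{a<..<x}|lborel. h y)"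
  unfolding ac_on_def by blast+

lemma ac_on_increment:
  assumes "ac_on a b w h" "a \<le> c" "c \<le> x" "x \<le> b"
  shows "w x = w c + (LINT y:{c<..<x}|lborel. h y)"
proof -
  have "w x = w a + (LINT y:{a<..<x}|lborel. h y)" "w c = w a + (LINT y:{a<..<c}|lborel. h y)"
    using assms by (auto intro!: ac_on_eq[OF assms(1)])
  then show ?thesis using set_integral_interval_split[OF ac_on_integrable[OF assms(1)] assms(2-4)] by linarith
qed

lemma ac_on_subinterval:
  assumes "ac_on a b w h" "a \<le> c" "c \<le> d" "d \<le> b"
  shows "ac_on c d w h"
  unfolding ac_on_def
proof (intro conjI ballI)
  show "set_integrable lborel {c<..<d} h"
    by (rule set_integrable_subset[of _ "{a<..<b}"]) (use assms ac_on_integrable in auto)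
  show "c \<le> d" by fact
  fix x assume "x \<in> {c..d}"
  then show "w x = w c + (LINT y:{c<..<x}|lborel. h y)"
    using assms by (intro ac_on_increment) auto
qed

lemma interval_integral_closed_open:
  fixes h :: "real \<Rightarrow> 'a::{banach, second_countable_topology}"
  assumes that: "set_integrable lborel {a..x} h"
  shows "(LINT y:{a..x}|lborel. h y) = (LINT y:{a<..<x}|lborel. h y)"
proof -
  have "set_integrable lborel {a<..<x} h" by (rule set_integrable_subset[OF that]) auto
  then show ?thesis unfolding set_lebesgue_integral_def
  proof (intro integral_cong_AE)
    show "AE y in lborel. indicat_real {a..x} y *\<^sub>R h y = indicat_real {a<..<x} y *\<^sub>R h y"
      using AE_lborel_singleton[of a] AE_lborel_singleton[of x]
      by eventually_elim (auto simp: indicator_def)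
  qed (use that in \<open>auto simp: set_integrable_def\<close>)
qed

lemma set_integrable_open_closed:
  fixes h :: "real \<Rightarrow> 'a::{banach, second_countable_topology}"
  assumes "set_integrable lborel {a<..<b} h"
  shows "set_integrable lborel {a..b} h"
proof (cases "a \<le> b")
  case True
  have "set_integrable lborel {a} h" "set_integrable lborel {b} h"
  proof -
    have *: "integrable lborel (\<lambda>x. indicat_real {c} x *\<^sub>R h x)" for c
    proof -
      have "(\<lambda>x. indicat_real {c} x *\<^sub>R h x) = (\<lambda>x. indicat_real {c} x *\<^sub>R h c)"
        by (auto simp: indicator_def)
      moreover have "integrable lborel (\<lambda>x. indicat_real {c} x *\<^sub>R h c)"
        by (intro integrable_scaleR_left integrable_real_indicator) auto
      ultimately show ?thesis by simp
    qed
    show "set_integrable lborel {a} h" "set_integrable lborel {b} h" using * by (simp_all add: set_integrable_def)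
  qed
  then have "set_integrable lborel ({a<..<b} \<union> ({a} \<union> {b})) h"
    using assms by (intro set_integrable_Un) auto
  moreover have "{a<..<b} \<union> ({a} \<union> {b}) = {a..b}" using True by auto
  ultimately show ?thesis by simp
qed (simp add: set_integrable_def)

lemma ac_on_continuous:
  assumes "ac_on a b w h"
  shows "continuous_on {a..b} w"
proof -
  have i: "set_integrable lborel {a..b} h" by (rule set_integrable_open_closed[OF ac_on_integrable[OF assms]])
  have "continuous_on {a..b} (\<lambda>x. w a + integral {a..x} h)"
    by (intro continuous_intros indefinite_integral_continuous_1 set_borel_integral_eq_integral(1)[OF i])
  moreover have "w a + integral {a..x} h = w x" if "x \<in> {a..b}" for x
  proof -
    have ix: "set_integrable lborel {a..x} h" by (rule set_integrable_subset[OF i]) (use that in auto)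
    show ?thesis
      using set_borel_integral_eq_integral(2)[OF ix] interval_integral_closed_open[OF ix] ac_on_eq[OF assms that]
      by linarith
  qed
  ultimately show ?thesis by (rule continuous_on_eq)
qed

lemma C1_imp_ac_on:
  assumes "a \<le> b" "\<And>x. x \<in> {a..b} \<Longrightarrow> (w has_vector_derivative w' x) (at x within {a..b})"
    "continuous_on {a..b} w'"
  shows "ac_on a b w w'"
  unfolding ac_on_def
proof (intro conjI ballI)
  have i: "set_integrable lborel {a..b} w'" by (rule borel_integrable_atLeastAtMost'[OF assms(3)])
  show "set_integrable lborel {a<..<b} w'" by (rule set_integrable_subset[OF i]) auto
  show "a \<le> b" by fact
  fix x assume x: "x \<in> {a..b}"
  have ix: "set_integrable lborel {a..x} w'" by (rule set_integrable_subset[OF i]) (use x in auto)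
  have "(LINT y:{a<..<x}|lborel. w' y) = (LINT y:{a..x}|lborel. w' y)"
    using interval_integral_closed_open[OF ix] by simp
  also have "\<dots> = integral {a..x} w'" by (rule set_borel_integral_eq_integral(2)[OF ix])
  also have "\<dots> = w x - w a"
  proof (rule integral_unique, rule fundamental_theorem_of_calculus)
    show "a \<le> x" using x by simp
    fix y assume "y \<in> {a..x}"
    then show "(w has_vector_derivative w' y) (at y within {a..x})"
      using assms(2)[of y] x by (auto intro: has_vector_derivative_within_subset)
  qed
  finally show "w x = w a + (LINT y:{a<..<x}|lborel. w' y)" by simp
qed

lemma ac_on_has_derivative:
  assumes ac: "ac_on a b w h" and cont: "continuous_on {a..b} h" and x: "x \<in> {a..b}"
  shows "(w has_vector_derivative h x) (at x within {a..b})"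
proof -
  have i: "set_integrable lborel {a..b} h" by (rule set_integrable_open_closed[OF ac_on_integrable[OF ac]])
  have eq: "w a + integral {a..x} h = w x" if "x \<in> {a..b}" for x
  proof -
    have ix: "set_integrable lborel {a..x} h" by (rule set_integrable_subset[OF i]) (use that in auto)
    show ?thesis
      using set_borel_integral_eq_integral(2)[OF ix] interval_integral_closed_open[OF ix] ac_on_eq[OF ac that]
      by linarith
  qed
  have "((\<lambda>u. w a + integral {a..u} h) has_vector_derivative 0 + h x) (at x within {a..b})"
    by (intro has_vector_derivative_add has_vector_derivative_const integral_has_vector_derivative cont x)
  then show ?thesis
    using has_vector_derivative_transform[OF x eq[symmetric]] by simp
qed

lemma ac_on_mult_increment:
  assumes 1: "ac_on a b w1 h1" and 2: "ac_on a b w2 h2"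
  shows "w1 b * w2 b = w1 a * w2 a + (LINT y:{a<..<b}|lborel. h1 y * w2 y + w1 y * h2 y)"
proof -
  define p where "p y = indicator {a<..<b} y *\<^sub>R h1 y" for y
  define q where "q y = indicator {a<..<b} y *\<^sub>R h2 y" for y
  have p: "integrable lborel p" using ac_on_integrable[OF 1] by (simp add: set_integrable_def p_def[abs_def])
  have q: "integrable lborel q" using ac_on_integrable[OF 2] by (simp add: set_integrable_def q_def[abs_def])
  have e1: "w1 s = w1 a + (LINT y:{..<s}|lborel. p y)" if "s \<in> {a..b}" for s
  proof -
    have "(LINT y:{..<s}|lborel. p y) = (LINT y:{a<..<s}|lborel. h1 y)"
      unfolding set_lebesgue_integral_def p_def using that
      by (intro Bochner_Integration.integral_cong refl) (auto simp: indicator_def)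
    then show ?thesis using ac_on_eq[OF 1 that] by linarith
  qed
  have e2: "w2 s = w2 a + (LINT y:{..<s}|lborel. q y)" if "s \<in> {a..b}" for s
  proof -
    have "(LINT y:{..<s}|lborel. q y) = (LINT y:{a<..<s}|lborel. h2 y)"
      unfolding set_lebesgue_integral_def q_def using that
      by (intro Bochner_Integration.integral_cong refl) (auto simp: indicator_def)
    then show ?thesis using ac_on_eq[OF 2 that] by linarith
  qed
  have ab: "a \<le> b" by (rule ac_on_le[OF 1])
  have P: "(LINT y|lborel. p y) = w1 b - w1 a"
    using ac_on_eq[OF 1, of b] ab by (simp add: set_lebesgue_integral_def p_def)
  have Q: "(LINT y|lborel. q y) = w2 b - w2 a"
    using ac_on_eq[OF 2, of b] ab by (simp add: set_lebesgue_integral_def q_def)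
  have "(LINT y:{a<..<b}|lborel. h1 y * w2 y + w1 y * h2 y)
     = (LINT s|lborel. (p s * (LINT y:{..<s}|lborel. q y) + p s * w2 a) + (q s * (LINT y:{..<s}|lborel. p y) + q s * w1 a))"
    unfolding set_lebesgue_integral_def[of lborel "{a<..<b}"]
  proof (intro Bochner_Integration.integral_cong refl)
    fix s
    show "indicator {a<..<b} s *\<^sub>R (h1 s * w2 s + w1 s * h2 s)
       = (p s * (LINT y:{..<s}|lborel. q y) + p s * w2 a) + (q s * (LINT y:{..<s}|lborel. p y) + q s * w1 a)"
      using e1[of s] e2[of s] by (cases "s \<in> {a<..<b}") (auto simp: p_def q_def algebra_simps)
  qed
  also have "\<dots> = ((LINT s|lborel. p s * (LINT y:{..<s}|lborel. q y)) + (LINT s|lborel. p s * w2 a))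
       + ((LINT s|lborel. q s * (LINT y:{..<s}|lborel. p y)) + (LINT s|lborel. q s * w1 a))"
    using integral_triangle_swap(2)[OF p q] integral_triangle_swap(2)[OF q p] p q by simp
  also have "\<dots> = (w1 b - w1 a) * (w2 b - w2 a) + (w1 b - w1 a) * w2 a + (w2 b - w2 a) * w1 a"
    using integral_triangle_swap(1)[OF p q] P Q by simp
  finally show ?thesis by (simp add: algebra_simps)
qed

lemma ac_on_mult:
  assumes 1: "ac_on a b w1 h1" and 2: "ac_on a b w2 h2"
  shows "ac_on a b (\<lambda>y. w1 y * w2 y) (\<lambda>y. h1 y * w2 y + w1 y * h2 y)"
  unfolding ac_on_def
proof (intro conjI ballI)
  show "a \<le> b" by (rule ac_on_le[OF 1])
  have "set_integrable lborel {a<..<b} (\<lambda>y. h1 y * w2 y)"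
    by (intro set_integrable_times_continuous ac_on_integrable[OF 1] ac_on_continuous[OF 2])
  moreover have "set_integrable lborel {a<..<b} (\<lambda>y. h2 y * w1 y)"
    by (intro set_integrable_times_continuous ac_on_integrable[OF 2] ac_on_continuous[OF 1])
  ultimately show "set_integrable lborel {a<..<b} (\<lambda>y. h1 y * w2 y + w1 y * h2 y)"
    by (simp add: mult.commute set_integral_add)
  fix x assume x: "x \<in> {a..b}"
  show "w1 x * w2 x = w1 a * w2 a + (LINT y:{a<..<x}|lborel. h1 y * w2 y + w1 y * h2 y)"
    using x by (intro ac_on_mult_increment ac_on_subinterval[OF 1] ac_on_subinterval[OF 2]) auto
qed

lemma test_function_ac_on:
  assumes "test_function l \<phi> \<phi>'" "0 \<le> l"
  shows "ac_on 0 l \<phi> \<phi>'"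
proof (rule C1_imp_ac_on)
  show "(\<phi> has_vector_derivative \<phi>' x) (at x within {0..l})" for x
    using assms(1) unfolding test_function_def
    by (auto simp: has_real_derivative_iff_has_vector_derivative intro: has_vector_derivative_at_within)
qed (use assms test_function_continuous in auto)

text \<open>A continuous function with compact support and vanishing integral is the derivative of a test
  function: its antiderivative is constant on both sides of the support, and both constants
  agree.\<close>

lemma test_function_antiderivative:
  assumes cont: "continuous_on UNIV \<psi>" and cd: "0 < c" "c < d" "d < l"
    and zero: "\<And>x. x \<notin> {c<..<d} \<Longrightarrow> \<psi> x = 0" and int: "(LINT x:{0<..<l}|lborel. \<psi> x) = 0"
  obtains \<Psi> where "test_function l \<Psi> \<psi>"
proof -
  have "\<exists>F. \<forall>x. (-\<infinity>::ereal) < ereal x \<longrightarrow> ereal x < (\<infinity>::ereal) \<longrightarrow> (F has_vector_derivative \<psi> x) (at x)"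
    using cont by (intro einterval_antiderivative) (auto simp: continuous_on_eq_continuous_at)
  then obtain F where F: "\<And>x. (F has_real_derivative \<psi> x) (at x)"
    by (auto simp: has_real_derivative_iff_has_vector_derivative)
  define \<Psi> where "\<Psi> x = F x - F c" for x
  have D: "(\<Psi> has_real_derivative \<psi> x) (at x)" for x
    unfolding \<Psi>_def using F[of x] by (auto intro!: derivative_eq_intros)
  have left: "\<Psi> x = 0" if "x \<le> c" for x
  proof -
    have "\<exists>k. \<forall>y\<in>{..c}. \<Psi> y = k"
    proof (rule has_field_derivative_zero_constant)
      show "(\<Psi> has_field_derivative 0) (at y within {..c})" if "y \<in> {..c}" for y
        using D[of y] zero[of y] that by (auto intro: DERIV_subset)
    qed simp
    then have "\<Psi> x = \<Psi> c" using that by auto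
    then show ?thesis by (simp add: \<Psi>_def)
  qed
  have right: "\<Psi> x = 0" if "x \<ge> d" for x
  proof -
    have "\<exists>k. \<forall>y\<in>{d..}. \<Psi> y = k"
    proof (rule has_field_derivative_zero_constant)
      show "(\<Psi> has_field_derivative 0) (at y within {d..})" if "y \<in> {d..}" for y
        using D[of y] zero[of y] that by (auto intro: DERIV_subset)
    qed simp
    then have "\<Psi> x = \<Psi> l" using that cd by auto
    moreover have "ac_on 0 l \<Psi> \<psi>"
      using cd D cont
      by (intro C1_imp_ac_on)
         (auto simp: has_real_derivative_iff_has_vector_derivative intro: has_vector_derivative_at_within continuous_on_subset)
    then have "\<Psi> l = \<Psi> 0 + 0" using ac_on_eq[of 0 l \<Psi> \<psi> l] cd int by simp
    ultimately show ?thesis using left[of 0] cd by simp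
  qed
  have "test_function l \<Psi> \<psi>"
    unfolding test_function_def using D cont cd left right
    by (intro conjI allI exI[of _ c] exI[of _ d]) (auto simp: not_le)
  then show ?thesis by (rule that)
qed

text \<open>The lemma of du Bois-Reymond.  Let \<open>F\<close> be the difference of \<open>f\<close> and the indefinite integral
  of \<open>g\<close>.  Integration by parts shows that \<open>F\<close> is orthogonal to derivatives of test functions,
  that is, to all \<open>\<phi> - k * \<psi>\<close> where \<open>\<psi>\<close> is a fixed bump and \<open>k\<close> is chosen such that the integral
  vanishes.  Hence \<open>F\<close> minus a constant is orthogonal to all test functions \<open>\<phi>\<close>.\<close>

lemma weak_derivative_imp_ac_on:
  fixes f g :: "real \<Rightarrow> real"
  assumes weak: "has_weak_derivative l f g" and l: "0 < l" and g: "set_integrable lborel {0<..<l} g"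
  obtains w where "ac_on 0 l w g" "AE x in lborel. 0 < x \<and> x < l \<longrightarrow> f x = w x"
proof -
  define G where "G x = (LINT y:{0<..<x}|lborel. g y)" for x
  have acG: "ac_on 0 l G g" using g l by (simp add: ac_on_def G_def set_lebesgue_integral_def)
  have contG: "continuous_on {0..l} G" by (rule ac_on_continuous[OF acG])
  define F where "F x = f x - G x" for x
  have lf: "locally_integrable l f" and lg: "locally_integrable l g" using weak by (auto simp: has_weak_derivative_def)
  have lG: "locally_integrable l G"
    unfolding locally_integrable_def
    by (auto intro!: borel_integrable_atLeastAtMost' continuous_on_subset[OF contG])
  have lF: "locally_integrable l F"
    using lf lG unfolding F_def by (auto simp: locally_integrable_def intro!: set_integral_diff)
  have F0: "(LINT x:{0<..<l}|lborel. \<phi>' x * F x) = 0" if t: "test_function l \<phi> \<phi>'" for \<phi> \<phi>'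
  proof -
    have z: "\<phi> 0 = 0" "\<phi> l = 0" using t l unfolding test_function_def by auto
    have i1: "set_integrable lborel {0<..<l} (\<lambda>y. \<phi>' y * G y)"
      using test_function_integrable(2)[OF t lG l] by simp
    have i2: "set_integrable lborel {0<..<l} (\<lambda>y. \<phi> y * g y)"
      using test_function_integrable(1)[OF t lg l] by simp
    have i3: "set_integrable lborel {0<..<l} (\<lambda>y. \<phi>' y * f y)"
      using test_function_integrable(2)[OF t lf l] by simp
    have "0 = (LINT y:{0<..<l}|lborel. \<phi>' y * G y + \<phi> y * g y)"
      using ac_on_mult_increment[OF test_function_ac_on[OF t] acG] z l by simp
    also have "\<dots> = (LINT y:{0<..<l}|lborel. \<phi>' y * G y) + (LINT y:{0<..<l}|lborel. \<phi> y * g y)"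
      by (rule set_integral_add(2)[OF i1 i2])
    also have "(LINT y:{0<..<l}|lborel. \<phi> y * g y) = - (LINT y:{0<..<l}|lborel. \<phi>' y * f y)"
      using weak t by (auto simp: has_weak_derivative_def)
    finally have "(LINT y:{0<..<l}|lborel. \<phi>' y * f y) - (LINT y:{0<..<l}|lborel. \<phi>' y * G y) = 0" by simp
    then show ?thesis
      using set_integral_diff(2)[OF i3 i1] by (simp add: F_def algebra_simps)
  qed
  define \<psi> where "\<psi> = bump (l/4) (3*l/4) 1"
  obtain \<psi>' where \<psi>: "test_function l \<psi> \<psi>'"
    unfolding \<psi>_def using test_function_bump[of "l/4" "3*l/4" l 1] l by auto
  have int_test: "set_integrable lborel {0<..<l} \<phi>" if "test_function l \<phi> \<phi>'" for \<phi> \<phi>'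
    using borel_integrable_atLeastAtMost'[OF test_function_continuous(1)[OF that], of 0 l]
    by (rule set_integrable_subset) auto
  define \<kappa> where "\<kappa> = (LINT x:{0<..<l}|lborel. \<psi> x)"
  have \<kappa>: "\<kappa> \<noteq> 0"
  proof
    assume "\<kappa> = 0"
    then have "AE x in lborel. indicator {0<..<l} x *\<^sub>R \<psi> x = 0"
      using int_test[OF \<psi>] bump_bounds(1)
      by (subst (asm) \<kappa>_def, unfold set_lebesgue_integral_def set_integrable_def)
         (subst (asm) integral_nonneg_eq_0_iff_AE, auto simp: \<psi>_def indicator_def)
    then have "AE x in lborel. x \<notin> {l/4<..<3*l/4}"
      by eventually_elim (use bump_pos[of _ "l/4" "3*l/4" 1] l in \<open>force simp: \<psi>_def indicator_def\<close>)
    then have "{l/4<..<3*l/4} \<in> null_sets lborel"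
      by (intro AE_iff_null_sets[THEN iffD2]) auto
    then show False using l by (auto simp: null_sets_def)
  qed
  \<comment> \<open>The constant that \<open>F\<close> must equal, read off by testing with \<open>\<psi>\<close>.\<close>
  define C where "C = (LINT x:{0<..<l}|lborel. \<psi> x * F x) / \<kappa>"
  have "AE x in lborel. 0 < x \<and> x < l \<longrightarrow> F x - C = 0"
  proof (rule fundamental_lemma)
    have lC: "locally_integrable l (\<lambda>_. C)"
      by (auto simp: locally_integrable_def intro!: borel_integrable_atLeastAtMost' continuous_intros)
    show "locally_integrable l (\<lambda>x. F x - C)"
      using lF lC by (auto simp: locally_integrable_def intro!: set_integral_diff)
    fix \<phi> \<phi>' assume t: "test_function l \<phi> \<phi>'"
    define k where "k = (LINT x:{0<..<l}|lborel. \<phi> x) / \<kappa>"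
    define \<eta> where "\<eta> x = \<phi> x - k * \<psi> x" for x
    obtain c d where cd: "0 < c" "c < d" "d < l" "\<And>x. x \<notin> {c<..<d} \<Longrightarrow> \<phi> x = 0"
      using test_function_localize[OF t l] by metis
    have "\<exists>\<Psi>. test_function l \<Psi> \<eta>"
    proof -
      have "(LINT x:{0<..<l}|lborel. \<eta> x) = (LINT x:{0<..<l}|lborel. \<phi> x) - k * \<kappa>"
        unfolding \<eta>_def \<kappa>_def using int_test[OF t] int_test[OF \<psi>] by (subst set_integral_diff) auto
      then have 0: "(LINT x:{0<..<l}|lborel. \<eta> x) = 0" using \<kappa> by (simp add: k_def)
      have cont: "continuous_on UNIV \<eta>"
        unfolding \<eta>_def by (intro continuous_intros test_function_continuous(1)[OF t] test_function_continuous(1)[OF \<psi>])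
      have zero: "\<eta> x = 0" if "x \<notin> {min c (l/4)<..<max d (3*l/4)}" for x
      proof -
        have "x \<notin> {c<..<d}" "x \<notin> {l/4<..<3*l/4}" using that by auto
        then show ?thesis using cd(4)[of x] bump_zero[of x "l/4" "3*l/4" 1] l by (simp add: \<eta>_def \<psi>_def)
      qed
      show ?thesis
        by (rule test_function_antiderivative[OF cont _ _ _ zero 0]) (use cd l in auto)
    qed
    then obtain \<Psi> where "test_function l \<Psi> \<eta>" by blast
    then have "(LINT x:{0<..<l}|lborel. \<eta> x * F x) = 0" by (rule F0)
    moreover have iF: "set_integrable lborel {0<..<l} (\<lambda>x. \<phi> x * F x)" "set_integrable lborel {0<..<l} (\<lambda>x. \<psi> x * F x)"
      using test_function_integrable(1)[OF t lF l] test_function_integrable(1)[OF \<psi> lF l] by auto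
    have "(LINT x:{0<..<l}|lborel. \<phi> x * F x - k * (\<psi> x * F x)) = (LINT x:{0<..<l}|lborel. \<phi> x * F x) - k * (LINT x:{0<..<l}|lborel. \<psi> x * F x)"
      using iF by (subst set_integral_diff) auto
    moreover have "(\<lambda>x. \<eta> x * F x) = (\<lambda>x. \<phi> x * F x - k * (\<psi> x * F x))"
      by (auto simp: \<eta>_def algebra_simps)
    ultimately have "(LINT x:{0<..<l}|lborel. \<phi> x * F x) = k * (\<kappa> * C)"
      using \<kappa> by (simp add: C_def)
    also have "\<dots> = (LINT x:{0<..<l}|lborel. \<phi> x) * C" using \<kappa> by (simp add: k_def)
    finally have "(LINT x:{0<..<l}|lborel. \<phi> x * F x) - (LINT x:{0<..<l}|lborel. \<phi> x * C) = 0"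
      by simp
    moreover have "(LINT x:{0<..<l}|lborel. \<phi> x * F x - \<phi> x * C) = (LINT x:{0<..<l}|lborel. \<phi> x * F x) - (LINT x:{0<..<l}|lborel. \<phi> x * C)"
      using iF int_test[OF t] by (subst set_integral_diff) auto
    ultimately show "(LINT x:{0<..<l}|lborel. \<phi> x *\<^sub>R (F x - C)) = 0"
      by (simp add: right_diff_distrib)
  qed
  then have "AE x in lborel. 0 < x \<and> x < l \<longrightarrow> f x = C + G x"
    by eventually_elim (auto simp: F_def)
  moreover have "ac_on 0 l (\<lambda>x. C + G x) g" using acG unfolding ac_on_def by (metis add.assoc)
  ultimately show ?thesis using that by blast
qed

lemma continuous_AE_eq_imp_eq:
  fixes f g :: "real \<Rightarrow> real"
  assumes f: "continuous_on {0..l} f" and g: "continuous_on {0..l} g" and l: "0 < l"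
    and ae: "AE x in lborel. 0 < x \<and> x < l \<longrightarrow> f x = g x" and x: "x \<in> {0..l}"
  shows "f x = g x"
proof -
  define d where "d x = f x - g x" for x
  have d: "continuous_on {0..l} d" unfolding d_def by (intro continuous_intros f g)
  define S where "S = {0<..<l} \<inter> d -` (- {0})"
  have "continuous_on {0<..<l} d" by (rule continuous_on_subset[OF d]) auto
  then have "open S"
    unfolding S_def by (intro continuous_open_preimage) auto
  moreover have "S \<in> null_sets lborel"
  proof -
    have "AE x in lborel. x \<notin> S" using ae by eventually_elim (auto simp: S_def d_def)
    then show ?thesis using \<open>open S\<close> by (intro AE_iff_null_sets[THEN iffD2]) auto
  qed
  ultimately have "S = {}"
    using open_not_negligible[of S] by (auto simp: negligible_iff_null_sets null_sets_completionI)
  then have 0: "d y = 0" if "y \<in> {0<..<l}" for y using that by (auto simp: S_def)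
  have "d x = 0"
    by (rule continuous_constant_on_closure[where S = "{0<..<l}" and f = d])
      (use l d x 0 in auto)
  then show ?thesis by (simp add: d_def)
qed

text \<open>Pointwise values are controlled by integrals: \<open>w\<^sup>2\<close> varies by at most the integral of
  \<open>2 * \<bar>h * w\<bar> \<le> w\<^sup>2 / c + c * h\<^sup>2\<close>, and at some point \<open>w\<^sup>2\<close> does not exceed its mean.
  The free parameter \<open>c\<close> permits a small factor in front of the derivative.\<close>

lemma ac_on_trace:
  assumes ac: "ac_on 0 l w h" and l: "0 < l" and c: "0 < c" and x: "x \<in> {0..l}"
    and h: "set_integrable lborel {0<..<l} (\<lambda>y. (h y)\<^sup>2)"
  shows "(w x)\<^sup>2 \<le> (1 / l + 1 / c) * (LINT y:{0<..<l}|lborel. (w y)\<^sup>2) + c * (LINT y:{0<..<l}|lborel. (h y)\<^sup>2)"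
proof -
  have w2: "set_integrable lborel {0<..<l} (\<lambda>y. (w y)\<^sup>2)"
    by (rule set_integrable_subset[OF borel_integrable_atLeastAtMost'[of 0 l]])
      (auto intro!: continuous_intros ac_on_continuous[OF ac])
  define W where "W = (LINT y:{0<..<l}|lborel. (w y)\<^sup>2)"
  define H where "H = (LINT y:{0<..<l}|lborel. (h y)\<^sup>2)"
  have hw: "set_integrable lborel {0<..<l} (\<lambda>y. h y * w y)"
    by (intro set_integrable_times_continuous ac_on_integrable[OF ac] ac_on_continuous[OF ac])
  have ihw: "set_integrable lborel {0<..<l} (\<lambda>y. \<bar>2 * (h y * w y)\<bar>)"
    by (intro set_integrable_abs set_integrable_mult_right hw)
  have iw: "set_integrable lborel {0<..<l} (\<lambda>y. (1/c) * (w y)\<^sup>2)"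
    by (intro set_integrable_mult_right w2)
  have ih: "set_integrable lborel {0<..<l} (\<lambda>y. c * (h y)\<^sup>2)"
    by (intro set_integrable_mult_right h)
  have "(LINT y:{0<..<l}|lborel. \<bar>2 * (h y * w y)\<bar>) \<le> (LINT y:{0<..<l}|lborel. (1/c) * (w y)\<^sup>2 + c * (h y)\<^sup>2)"
  proof (rule set_integral_mono)
    show "set_integrable lborel {0<..<l} (\<lambda>y. \<bar>2 * (h y * w y)\<bar>)" by (rule ihw)
    show "set_integrable lborel {0<..<l} (\<lambda>y. (1/c) * (w y)\<^sup>2 + c * (h y)\<^sup>2)" by (rule set_integral_add(1)[OF iw ih])
    fix y
    have "0 \<le> (\<bar>w y\<bar> - c * \<bar>h y\<bar>)\<^sup>2" by simp
    also have "\<dots> = \<bar>w y\<bar>\<^sup>2 + c\<^sup>2 * \<bar>h y\<bar>\<^sup>2 - 2 * c * (\<bar>h y\<bar> * \<bar>w y\<bar>)"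
      by (simp only: power2_diff power_mult_distrib) simp
    finally have "2 * (\<bar>h y\<bar> * \<bar>w y\<bar>) * c \<le> (w y)\<^sup>2 + c\<^sup>2 * (h y)\<^sup>2" by (simp add: mult_ac)
    then have "2 * (\<bar>h y\<bar> * \<bar>w y\<bar>) \<le> ((w y)\<^sup>2 + c\<^sup>2 * (h y)\<^sup>2) / c"
      using pos_le_divide_eq[OF c, THEN iffD2] by simp
    also have "\<dots> = (1/c) * (w y)\<^sup>2 + c * (h y)\<^sup>2"
      using c by (simp add: add_divide_distrib power2_eq_square)
    finally show "\<bar>2 * (h y * w y)\<bar> \<le> (1/c) * (w y)\<^sup>2 + c * (h y)\<^sup>2" by (simp add: abs_mult)
  qed
  also have "\<dots> = W / c + c * H" unfolding W_def H_def using set_integral_add(2)[OF iw ih] by simp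
  finally have D: "(LINT y:{0<..<l}|lborel. \<bar>2 * (h y * w y)\<bar>) \<le> W / c + c * H" .
  have ac2: "ac_on 0 l (\<lambda>y. w y * w y) (\<lambda>y. h y * w y + w y * h y)" by (rule ac_on_mult[OF ac ac])
  have bound: "\<bar>LINT y:{u<..<v}|lborel. h y * w y + w y * h y\<bar> \<le> W / c + c * H" if "0 \<le> u" "v \<le> l" for u v
  proof -
    have "\<bar>LINT y:{u<..<v}|lborel. h y * w y + w y * h y\<bar> \<le> (LINT y:{u<..<v}|lborel. \<bar>2 * (h y * w y)\<bar>)"
    proof -
      have "\<bar>indicat_real {u<..<v} y *\<^sub>R (h y * w y + w y * h y)\<bar> = indicat_real {u<..<v} y *\<^sub>R \<bar>2 * (h y * w y)\<bar>" for y
        by (cases "y \<in> {u<..<v}") (simp_all add: mult.commute[of "w y"])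
      then have "(\<lambda>y. \<bar>indicat_real {u<..<v} y *\<^sub>R (h y * w y + w y * h y)\<bar>)
          = (\<lambda>y. indicat_real {u<..<v} y *\<^sub>R \<bar>2 * (h y * w y)\<bar>)" by (rule ext)
      then show ?thesis
        using integral_abs_bound[of lborel "\<lambda>y. indicat_real {u<..<v} y *\<^sub>R (h y * w y + w y * h y)"]
        unfolding set_lebesgue_integral_def by (simp only:)
    qed
    also have "\<dots> \<le> (LINT y:{0<..<l}|lborel. \<bar>2 * (h y * w y)\<bar>)"
      unfolding set_lebesgue_integral_def
    proof (rule integral_mono)
      have "set_integrable lborel {u<..<v} (\<lambda>y. \<bar>2 * (h y * w y)\<bar>)"
        by (rule set_integrable_subset[OF ihw]) (use that in auto)
      then show "integrable lborel (\<lambda>x. indicat_real {u<..<v} x *\<^sub>R \<bar>2 * (h x * w x)\<bar>)" by (simp add: set_integrable_def)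
      show "integrable lborel (\<lambda>x. indicat_real {0<..<l} x *\<^sub>R \<bar>2 * (h x * w x)\<bar>)" using ihw by (simp add: set_integrable_def)
      show "indicat_real {u<..<v} y *\<^sub>R \<bar>2 * (h y * w y)\<bar> \<le> indicat_real {0<..<l} y *\<^sub>R \<bar>2 * (h y * w y)\<bar>" for y
        using that by (auto simp: indicator_def)
    qed
    also note D
    finally show ?thesis .
  qed
  have le: "(w x)\<^sup>2 \<le> (w y)\<^sup>2 + (W / c + c * H)" if "y \<in> {0<..<l}" for y
  proof (cases "x \<le> y")
    case True
    then show ?thesis
      using ac_on_increment[OF ac2, of x y] bound[of x y] that x unfolding power2_eq_square by auto
  next
    case False
    then show ?thesis
      using ac_on_increment[OF ac2, of y x] bound[of y x] that x unfolding power2_eq_square by auto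
  qed
  have cst: "(LINT y:{0<..<l}|lborel. k) = l * k" for k :: real
    using l by (simp add: set_lebesgue_integral_def)
  have icst: "set_integrable lborel {0<..<l} (\<lambda>y. k)" for k :: real
    using l by (simp add: set_integrable_def)
  have "l * (w x)\<^sup>2 = (LINT y:{0<..<l}|lborel. (w x)\<^sup>2)" by (simp add: cst)
  also have "\<dots> \<le> (LINT y:{0<..<l}|lborel. (w y)\<^sup>2 + (W / c + c * H))"
    by (intro set_integral_mono icst set_integral_add(1)[OF w2 icst] le)
  also have "\<dots> = W + l * (W / c + c * H)"
    using set_integral_add(2)[OF w2 icst[of "W / c + c * H"]] by (simp only: cst W_def)
  finally have "(w x)\<^sup>2 * l \<le> W + l * (W / c + c * H)" by (simp only: mult.commute)
  then have "(w x)\<^sup>2 \<le> (W + l * (W / c + c * H)) / l" using pos_le_divide_eq[OF l, THEN iffD2] by simp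
  also have "\<dots> = (1 / l + 1 / c) * W + c * H" using l by (simp add: add_divide_distrib distrib_right)
  finally show ?thesis by (simp add: W_def H_def)
qed

section \<open>Integration over a metric graph\<close>

no_notation Infinite_Sum.abs_summable_on (infixr \<open>abs'_summable'_on\<close> 46)

definition graph_region :: "('v, 'e) metric_graph \<Rightarrow> ('e \<times> real) set" where
  "graph_region G = {(e, x). e \<in> edges G \<and> 0 < x \<and> x < elen G e}"

lemma metric_graph_countable_edges:
  assumes "metric_graph G"
  shows "countable (edges G)"
proof -
  have "edges G \<subseteq> fst ` (\<Union>v\<in>vertices G. ends_at G v)"
  proof
    fix e assume e: "e \<in> edges G"
    then have "(e, False) \<in> ends_at G (tail G e)" "tail G e \<in> vertices G"
      using assms by (auto simp: ends_at_def endpoint_def metric_graph_def)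
    then show "e \<in> fst ` (\<Union>v\<in>vertices G. ends_at G v)" by force
  qed
  moreover have "countable (\<Union>v\<in>vertices G. ends_at G v)"
    using assms by (intro countable_UN) (auto simp: metric_graph_def countable_finite)
  ultimately show ?thesis by (meson countable_image countable_subset)
qed

text \<open>With countably many edges, the measure of the graph is a product of sigma-finite measures
  restricted to a measurable set, and measurability, null sets and integrals are determined edge by
  edge.\<close>

locale countable_graph =
  fixes G :: "('v, 'e) metric_graph"
  assumes countable_edges: "countable (edges G)"
begin

sublocale N: pair_sigma_finite "count_space (edges G)" "lborel :: real measure"
  by (intro pair_sigma_finite.intro sigma_finite_measure_count_space_countable countable_edges
      lborel.sigma_finite_measure_axioms)

abbreviation "N \<equiv> count_space (edges G) \<Otimes>\<^sub>M (lborel :: real measure)"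

lemma space_graph_measure: "space (graph_measure G) = graph_region G"
  by (auto simp: graph_measure_def graph_region_def space_restrict_space space_pair_measure)

lemma region_sets: "graph_region G \<inter> space N \<in> sets N"
proof -
  have "graph_region G \<inter> space N = (\<Union>e\<in>edges G. {e} \<times> {0<..<elen G e})"
    by (auto simp: graph_region_def space_pair_measure)
  moreover have "(\<Union>e\<in>edges G. {e} \<times> {0<..<elen G e}) \<in> sets N"
    by (intro sets.countable_UN'' countable_edges pair_measureI) auto
  ultimately show ?thesis by simp
qed

lemma graph_measure_eq: "graph_measure G = restrict_space N (graph_region G)"
  by (simp add: graph_measure_def graph_region_def)

lemma indicator_region: "e \<in> edges G \<Longrightarrow> indicator (graph_region G) (e, x) = indicator {0<..<elen G e} x"
  by (auto simp: graph_region_def indicator_def)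

lemma graph_measurable_iff:
  fixes F :: "'e \<times> real \<Rightarrow> 'a::{banach, second_countable_topology}"
  shows "F \<in> borel_measurable (graph_measure G) \<longleftrightarrow>
    (\<forall>e\<in>edges G. (\<lambda>x. indicator {0<..<elen G e} x *\<^sub>R F (e, x)) \<in> borel_measurable lborel)"
    (is "?L \<longleftrightarrow> ?R")
proof -
  have "?L \<longleftrightarrow> (\<lambda>p. indicator (graph_region G) p *\<^sub>R F p) \<in> borel_measurable N" (is "_ \<longleftrightarrow> ?M")
    unfolding graph_measure_eq by (rule borel_measurable_restrict_space_iff[OF region_sets])
  also have "?M \<longleftrightarrow> ?R"
  proof
    assume M: ?M
    show ?R
    proof
      fix e assume e: "e \<in> edges G"
      have "(\<lambda>x. indicator (graph_region G) (e, x) *\<^sub>R F (e, x)) \<in> borel_measurable lborel"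
        using measurable_compose[OF measurable_Pair1'[of e "count_space (edges G)" lborel] M] e by simp
      then show "(\<lambda>x. indicator {0<..<elen G e} x *\<^sub>R F (e, x)) \<in> borel_measurable lborel"
        by (simp only: indicator_region[OF e])
    qed
  next
    assume R: ?R
    show ?M
    proof (rule measurable_pair_measure_countable1[OF countable_edges])
      fix e assume e: "e \<in> edges G"
      show "(\<lambda>x. indicator (graph_region G) (e, x) *\<^sub>R F (e, x)) \<in> borel_measurable lborel"
        using R e by (simp only: indicator_region[OF e])
    qed
  qed
  finally show ?thesis .
qed

text \<open>For the direction from right to left the set where \<open>P\<close> fails need not be measurable; a null
  set containing it is assembled from null sets on the countably many edges.\<close>

lemma AE_graph_iff:
  "(AE p in graph_measure G. P p) \<longleftrightarrow>
   (\<forall>e\<in>edges G. AE x in lborel. 0 < x \<and> x < elen G e \<longrightarrow> P (e, x))" (is "?L \<longleftrightarrow> ?R")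
proof -
  have "?L \<longleftrightarrow> (AE p in N. p \<in> graph_region G \<longrightarrow> P p)" (is "_ \<longleftrightarrow> ?M")
    unfolding graph_measure_eq by (rule AE_restrict_space_iff[OF region_sets])
  also have "?M \<longleftrightarrow> ?R"
  proof
    assume ?M
    then have "AE e in count_space (edges G). AE x in lborel. (e, x) \<in> graph_region G \<longrightarrow> P (e, x)"
      by (rule N.AE_pair)
    then have "\<forall>e\<in>edges G. AE x in lborel. (e, x) \<in> graph_region G \<longrightarrow> P (e, x)"
      by (simp add: AE_count_space)
    then show ?R by (auto simp: graph_region_def)
  next
    assume R: ?R
    have "\<forall>e\<in>edges G. \<exists>Z\<in>null_sets lborel. {x. \<not> (0 < x \<and> x < elen G e \<longrightarrow> P (e, x))} \<subseteq> Z"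
    proof
      fix e assume "e \<in> edges G"
      with R have "AE x in lborel. 0 < x \<and> x < elen G e \<longrightarrow> P (e, x)" by blast
      then obtain Z where "{x \<in> space lborel. \<not> (0 < x \<and> x < elen G e \<longrightarrow> P (e, x))} \<subseteq> Z" "Z \<in> null_sets lborel"
        unfolding eventually_ae_filter by blast
      then show "\<exists>Z\<in>null_sets lborel. {x. \<not> (0 < x \<and> x < elen G e \<longrightarrow> P (e, x))} \<subseteq> Z"
        by (intro bexI[of _ Z]) auto
    qed
    then obtain Z where Z: "\<And>e. e \<in> edges G \<Longrightarrow> Z e \<in> null_sets lborel"
      "\<And>e. e \<in> edges G \<Longrightarrow> {x. \<not> (0 < x \<and> x < elen G e \<longrightarrow> P (e, x))} \<subseteq> Z e"
      by metis
    have "(\<Union>e\<in>edges G. {e} \<times> Z e) \<in> null_sets N"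
    proof (intro null_sets_UN' countable_edges)
      fix e assume e: "e \<in> edges G"
      show "{e} \<times> Z e \<in> null_sets N"
        using Z(1)[OF e] e by (intro lborel.times_in_null_sets2) auto
    qed
    moreover have "{p \<in> space N. \<not> (p \<in> graph_region G \<longrightarrow> P p)} \<subseteq> (\<Union>e\<in>edges G. {e} \<times> Z e)"
      using Z(2) by (fastforce simp: graph_region_def)
    ultimately show ?M by (rule AE_I')
  qed
  finally show ?thesis .
qed

lemma graph_integral:
  fixes F :: "'e \<times> real \<Rightarrow> 'a::{banach, second_countable_topology}"
  assumes F: "integrable (graph_measure G) F"
  shows "\<And>e. e \<in> edges G \<Longrightarrow> set_integrable lborel {0<..<elen G e} (\<lambda>x. F (e, x))"
    and "(\<lambda>e. LINT x:{0<..<elen G e}|lborel. F (e, x)) abs_summable_on edges G"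
    and "(LINT p|graph_measure G. F p) = infsetsum (\<lambda>e. LINT x:{0<..<elen G e}|lborel. F (e, x)) (edges G)"
proof -
  define F' where "F' p = indicator (graph_region G) p *\<^sub>R F p" for p
  have i: "integrable N F'"
    using F unfolding graph_measure_eq F'_def[abs_def] by (simp only: integrable_restrict_space[OF region_sets])
  have eq: "F' (e, x) = indicator {0<..<elen G e} x *\<^sub>R F (e, x)" if "e \<in> edges G" for e x
    by (simp only: F'_def indicator_region[OF that])
  have int: "(LINT x|lborel. F' (e, x)) = (LINT x:{0<..<elen G e}|lborel. F (e, x))" if "e \<in> edges G" for e
    by (simp only: eq[OF that] set_lebesgue_integral_def)
  have "AE e in count_space (edges G). integrable lborel (\<lambda>x. F' (e, x))"
    by (rule N.AE_integrable_fst'[OF i])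
  then have *: "\<forall>e\<in>edges G. integrable lborel (\<lambda>x. F' (e, x))" by (simp add: AE_count_space)
  show "set_integrable lborel {0<..<elen G e} (\<lambda>x. F (e, x))" if "e \<in> edges G" for e
    using *[rule_format, OF that] by (simp only: eq[OF that] set_integrable_def)
  have "integrable (count_space (edges G)) (\<lambda>e. LINT x|lborel. F' (e, x))"
    by (rule N.integrable_fst'[OF i])
  then show "(\<lambda>e. LINT x:{0<..<elen G e}|lborel. F (e, x)) abs_summable_on edges G"
    unfolding abs_summable_on_def
    by (rule Bochner_Integration.integrable_cong[THEN iffD1, rotated -1]) (auto simp: int)
  have "(LINT p|graph_measure G. F p) = (LINT p|N. F' p)"
    unfolding graph_measure_eq F'_def[abs_def] by (rule integral_restrict_space[OF region_sets])
  also have "\<dots> = (LINT e|count_space (edges G). LINT x|lborel. F' (e, x))"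
    by (rule N.integral_fst'[OF i, symmetric])
  also have "\<dots> = infsetsum (\<lambda>e. LINT x:{0<..<elen G e}|lborel. F (e, x)) (edges G)"
    unfolding infsetsum_def by (intro Bochner_Integration.integral_cong refl) (auto simp: int)
  finally show "(LINT p|graph_measure G. F p) = infsetsum (\<lambda>e. LINT x:{0<..<elen G e}|lborel. F (e, x)) (edges G)" .
qed

lemma graph_integrableI:
  fixes F :: "'e \<times> real \<Rightarrow> 'a::{banach, second_countable_topology}"
  assumes edge: "\<And>e. e \<in> edges G \<Longrightarrow> set_integrable lborel {0<..<elen G e} (\<lambda>x. F (e, x))"
    and sum: "(\<lambda>e. LINT x:{0<..<elen G e}|lborel. norm (F (e, x))) abs_summable_on edges G"
  shows "integrable (graph_measure G) F"
proof -
  define F' where "F' p = indicator (graph_region G) p *\<^sub>R F p" for p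
  have eq: "F' (e, x) = indicator {0<..<elen G e} x *\<^sub>R F (e, x)" if "e \<in> edges G" for e x
    by (simp only: F'_def indicator_region[OF that])
  have eqn: "norm (F' (e, x)) = indicator {0<..<elen G e} x *\<^sub>R norm (F (e, x))" if "e \<in> edges G" for e x
    by (simp add: eq[OF that])
  have m: "F \<in> borel_measurable (graph_measure G)"
    unfolding graph_measurable_iff using edge by (auto simp: set_integrable_def intro: borel_measurable_integrable)
  have "integrable N F'"
  proof (rule N.Fubini_integrable)
    show "F' \<in> borel_measurable N"
      using m unfolding graph_measure_eq F'_def[abs_def] by (simp only: borel_measurable_restrict_space_iff[OF region_sets])
    show "integrable (count_space (edges G)) (\<lambda>e. LINT x|lborel. norm (F' (e, x)))"
      using sum unfolding abs_summable_on_def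
      by (rule Bochner_Integration.integrable_cong[THEN iffD1, rotated -1]) (auto simp: eqn set_lebesgue_integral_def)
    show "AE e in count_space (edges G). integrable lborel (\<lambda>x. F' (e, x))"
      using edge by (simp add: AE_count_space eq set_integrable_def)
  qed
  then show ?thesis
    unfolding graph_measure_eq F'_def[abs_def] by (simp only: integrable_restrict_space[OF region_sets])
qed

lemma L2_edge:
  fixes f :: "'e \<times> real \<Rightarrow> 'a::{banach, second_countable_topology}"
  assumes f: "f \<in> L2 G" and e: "e \<in> edges G"
  shows "set_integrable lborel {0<..<elen G e} (\<lambda>x. f (e, x))"
    and "set_integrable lborel {0<..<elen G e} (\<lambda>x. (norm (f (e, x)))\<^sup>2)"
proof -
  have m: "(\<lambda>x. indicator {0<..<elen G e} x *\<^sub>R f (e, x)) \<in> borel_measurable lborel"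
    using f e graph_measurable_iff[of f] by (auto simp: L2_def)
  show sq: "set_integrable lborel {0<..<elen G e} (\<lambda>x. (norm (f (e, x)))\<^sup>2)"
    using f e graph_integral(1)[of "\<lambda>p. (norm (f p))\<^sup>2" e] by (auto simp: L2_def)
  have one: "integrable lborel (\<lambda>x. indicat_real {0<..<elen G e} x)"
    by (cases "0 \<le> elen G e") (auto intro!: integrable_real_indicator)
  show "set_integrable lborel {0<..<elen G e} (\<lambda>x. f (e, x))"
    unfolding set_integrable_def
  proof (rule Bochner_Integration.integrable_bound)
    show "integrable lborel (\<lambda>x. indicat_real {0<..<elen G e} x + indicat_real {0<..<elen G e} x *\<^sub>R (norm (f (e, x)))\<^sup>2)"
      using one sq[unfolded set_integrable_def] by (rule Bochner_Integration.integrable_add)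
    have "t \<le> 1 + t\<^sup>2" for t :: real
    proof -
      have "0 \<le> (t - 1)\<^sup>2 + t\<^sup>2 + 1" by simp
      then show ?thesis by (simp add: power2_diff)
    qed
    then show "AE x in lborel. norm (indicat_real {0<..<elen G e} x *\<^sub>R f (e, x))
      \<le> norm (indicat_real {0<..<elen G e} x + indicat_real {0<..<elen G e} x *\<^sub>R (norm (f (e, x)))\<^sup>2)"
      by (intro AE_I2) (auto simp: indicator_def)
  qed (rule m)
qed

lemma L2_real:
  fixes f :: "'e \<times> real \<Rightarrow> real"
  shows "f \<in> L2 G \<Longrightarrow> f \<in> borel_measurable (graph_measure G)"
    and "f \<in> L2 G \<Longrightarrow> integrable (graph_measure G) (\<lambda>p. (f p)\<^sup>2)"
  by (auto simp: L2_def)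

lemma L2_prod_integrable:
  fixes f g :: "'e \<times> real \<Rightarrow> real"
  assumes "f \<in> L2 G" "g \<in> L2 G"
  shows "integrable (graph_measure G) (\<lambda>p. f p * g p)"
proof (rule Bochner_Integration.integrable_bound)
  show "integrable (graph_measure G) (\<lambda>p. (f p)\<^sup>2 + (g p)\<^sup>2)"
    using assms by (intro Bochner_Integration.integrable_add L2_real)
  show "(\<lambda>p. f p * g p) \<in> borel_measurable (graph_measure G)"
    using assms by (intro borel_measurable_times L2_real)
  have "\<bar>s * t\<bar> \<le> \<bar>s\<^sup>2 + t\<^sup>2\<bar>" for s t :: real
  proof -
    have "0 \<le> (\<bar>s\<bar> - \<bar>t\<bar>)\<^sup>2" "0 \<le> s\<^sup>2 + t\<^sup>2" by simp_all
    then have "2 * (\<bar>s\<bar> * \<bar>t\<bar>) \<le> s\<^sup>2 + t\<^sup>2" by (simp add: power2_diff)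
    moreover have "0 \<le> \<bar>s\<bar> * \<bar>t\<bar>" by simp
    ultimately show ?thesis unfolding abs_mult by linarith
  qed
  then show "AE p in graph_measure G. norm (f p * g p) \<le> norm ((f p)\<^sup>2 + (g p)\<^sup>2)" by simp
qed

lemma L2_lincomb:
  fixes f g :: "'e \<times> real \<Rightarrow> real"
  assumes "f \<in> L2 G" "g \<in> L2 G"
  shows "(\<lambda>p. a * f p + c * g p) \<in> L2 G"
proof -
  have "(\<lambda>p. a * f p + c * g p) \<in> borel_measurable (graph_measure G)"
    using assms by (intro borel_measurable_add borel_measurable_times borel_measurable_const L2_real)
  moreover have "integrable (graph_measure G) (\<lambda>p. a\<^sup>2 * (f p)\<^sup>2 + (2 * a * c) * (f p * g p) + c\<^sup>2 * (g p)\<^sup>2)"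
    using assms by (intro Bochner_Integration.integrable_add integrable_mult_right L2_real L2_prod_integrable)
  moreover have "(\<lambda>p. a\<^sup>2 * (f p)\<^sup>2 + (2 * a * c) * (f p * g p) + c\<^sup>2 * (g p)\<^sup>2) = (\<lambda>p. (a * f p + c * g p)\<^sup>2)"
    by (auto simp: power2_eq_square algebra_simps)
  ultimately show ?thesis by (simp add: L2_def)
qed

definition L2_inner :: "('e \<times> real \<Rightarrow> real) \<Rightarrow> ('e \<times> real \<Rightarrow> real) \<Rightarrow> real" where
  "L2_inner f g = (LINT p|graph_measure G. f p * g p)"

lemma L2_inner_commute: "L2_inner f g = L2_inner g f"
  unfolding L2_inner_def by (simp add: mult.commute)

lemma L2_inner_lincomb_left:
  assumes "f \<in> L2 G" "g \<in> L2 G" "h \<in> L2 G"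
  shows "L2_inner (\<lambda>p. a * f p + c * g p) h = a * L2_inner f h + c * L2_inner g h"
proof -
  have "L2_inner (\<lambda>p. a * f p + c * g p) h = (LINT p|graph_measure G. a * (f p * h p) + c * (g p * h p))"
    unfolding L2_inner_def by (simp add: algebra_simps)
  also have "\<dots> = a * L2_inner f h + c * L2_inner g h"
    unfolding L2_inner_def using L2_prod_integrable[OF assms(1,3)] L2_prod_integrable[OF assms(2,3)] by simp
  finally show ?thesis .
qed

lemma L2_inner_nonneg: "0 \<le> L2_inner f f" unfolding L2_inner_def by simp

lemma L2_norm_eq: "L2_norm G f = sqrt (L2_inner f f)" for f :: "'e \<times> real \<Rightarrow> real"
  by (simp add: L2_norm_def L2_inner_def power2_eq_square)

text \<open>The quadratic polynomial \<open>t \<mapsto> L2_inner (f + t g) (f + t g)\<close> is nonnegative.\<close>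

lemma Cauchy_Schwarz_L2:
  assumes f: "f \<in> L2 G" and g: "g \<in> L2 G"
  shows "\<bar>L2_inner f g\<bar> \<le> L2_norm G f * L2_norm G g"
proof -
  have q: "0 \<le> L2_inner f f + 2 * t * L2_inner f g + t\<^sup>2 * L2_inner g g" for t
  proof -
    have fg: "(\<lambda>p. 1 * f p + t * g p) \<in> L2 G" by (rule L2_lincomb[OF f g])
    have "0 \<le> L2_inner (\<lambda>p. 1 * f p + t * g p) (\<lambda>p. 1 * f p + t * g p)" by (rule L2_inner_nonneg)
    also have "\<dots> = 1 * L2_inner f (\<lambda>p. 1 * f p + t * g p) + t * L2_inner g (\<lambda>p. 1 * f p + t * g p)"
      by (rule L2_inner_lincomb_left[OF f g fg])
    also have "L2_inner f (\<lambda>p. 1 * f p + t * g p) = 1 * L2_inner f f + t * L2_inner g f"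
      by (subst L2_inner_commute, rule L2_inner_lincomb_left[OF f g f])
    also have "L2_inner g (\<lambda>p. 1 * f p + t * g p) = 1 * L2_inner f g + t * L2_inner g g"
      by (subst L2_inner_commute, rule L2_inner_lincomb_left[OF f g g])
    finally show ?thesis by (simp add: L2_inner_commute[of g f] algebra_simps power2_eq_square)
  qed
  have "(L2_inner f g)\<^sup>2 \<le> L2_inner f f * L2_inner g g"
  proof (cases "L2_inner g g = 0")
    case True
    have "L2_inner f g = 0"
    proof (rule ccontr)
      assume n: "L2_inner f g \<noteq> 0"
      have "0 \<le> L2_inner f f + 2 * (- (L2_inner f f + 1) / (2 * L2_inner f g)) * L2_inner f g"
        \<comment> \<open>The polynomial is affine in this case, and takes the value \<open>- 1\<close> at this point.\<close>
        using q[of "- (L2_inner f f + 1) / (2 * L2_inner f g)"] True by simp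
      also have "\<dots> = -1" using n by (simp add: field_simps)
      finally show False by simp
    qed
    then show ?thesis using True by simp
  next
    case False
    then have pos: "0 < L2_inner g g" using L2_inner_nonneg[of g] by simp
    have "0 \<le> L2_inner f f - (L2_inner f g)\<^sup>2 / L2_inner g g"
      using q[of "- L2_inner f g / L2_inner g g"] False by (simp add: power2_eq_square divide_simps)
    then have "(L2_inner f g)\<^sup>2 / L2_inner g g \<le> L2_inner f f" by simp
    then show ?thesis by (simp only: pos_divide_le_eq[OF pos])
  qed
  then have "sqrt ((L2_inner f g)\<^sup>2) \<le> sqrt (L2_inner f f * L2_inner g g)" by (rule real_sqrt_le_mono)
  then show ?thesis by (simp add: L2_norm_eq real_sqrt_mult)
qed

lemma tendsto_L2_inner:
  assumes a: "eventually (\<lambda>s. f s \<in> L2 G) F" and b: "eventually (\<lambda>s. g s \<in> L2 G) F"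
    and f0: "f0 \<in> L2 G" and g0: "g0 \<in> L2 G"
    and lf: "((\<lambda>s. L2_norm G (\<lambda>p. f s p - f0 p)) \<longlongrightarrow> 0) F"
    and lg: "((\<lambda>s. L2_norm G (\<lambda>p. g s p - g0 p)) \<longlongrightarrow> 0) F"
  shows "((\<lambda>s. L2_inner (f s) (g s)) \<longlongrightarrow> L2_inner f0 g0) F"
proof -
  let ?a = "\<lambda>s. L2_norm G (\<lambda>p. f s p - f0 p)" and ?b = "\<lambda>s. L2_norm G (\<lambda>p. g s p - g0 p)"
  have "((\<lambda>s. ?a s * ?b s + (?a s * L2_norm G g0 + L2_norm G f0 * ?b s)) \<longlongrightarrow> 0 * 0 + (0 * L2_norm G g0 + L2_norm G f0 * 0)) F"
    by (intro tendsto_intros lf lg)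
  then have "((\<lambda>s. ?a s * ?b s + (?a s * L2_norm G g0 + L2_norm G f0 * ?b s)) \<longlongrightarrow> 0) F" by simp
  moreover have "eventually (\<lambda>s. norm (L2_inner (f s) (g s) - L2_inner f0 g0) \<le> ?a s * ?b s + (?a s * L2_norm G g0 + L2_norm G f0 * ?b s)) F"
    using a b
  proof eventually_elim
    case (elim s)
    let ?df = "\<lambda>p. f s p - f0 p" and ?dg = "\<lambda>p. g s p - g0 p"
    have df: "?df \<in> L2 G" using L2_lincomb[OF elim(1) f0, of 1 "-1"] by simp
    have dg: "?dg \<in> L2 G" using L2_lincomb[OF elim(2) g0, of 1 "-1"] by simp
    have *: "L2_inner (f s) (g s) - L2_inner f0 g0 = L2_inner ?df ?dg + (L2_inner ?df g0 + L2_inner f0 ?dg)"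
    proof -
      have e1: "L2_inner ?df h = L2_inner (f s) h - L2_inner f0 h" if "h \<in> L2 G" for h
        using L2_inner_lincomb_left[OF elim(1) f0 that, of 1 "-1"] by simp
      have e2: "L2_inner h ?dg = L2_inner h (g s) - L2_inner h g0" if "h \<in> L2 G" for h
        using L2_inner_lincomb_left[OF elim(2) g0 that, of 1 "-1"]
        unfolding L2_inner_commute[of h ?dg] L2_inner_commute[of h "g s"] L2_inner_commute[of h g0] by simp
      show ?thesis using e1[OF dg] e1[OF g0] e2[OF f0] e2[OF elim(1)] by linarith
    qed
    show ?case
      unfolding * real_norm_def
      using Cauchy_Schwarz_L2[OF df dg] Cauchy_Schwarz_L2[OF df g0] Cauchy_Schwarz_L2[OF f0 dg] by linarith
  qed
  ultimately have "((\<lambda>s. L2_inner (f s) (g s) - L2_inner f0 g0) \<longlongrightarrow> 0) F"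
    using Lim_null_comparison[of "\<lambda>s. L2_inner (f s) (g s) - L2_inner f0 g0"] by simp
  then show ?thesis by (rule LIM_zero_cancel)
qed

end

section \<open>The divergence theorem and the Green formula\<close>

lemma ac_on_cong_AE:
  assumes ac: "ac_on a b w h" and h': "set_integrable lborel {a<..<b} h'"
    and ae: "AE x in lborel. a < x \<and> x < b \<longrightarrow> h x = h' x"
  shows "ac_on a b w h'"
  unfolding ac_on_def
proof (intro conjI ballI)
  show "a \<le> b" by (rule ac_on_le[OF ac])
  show "set_integrable lborel {a<..<b} h'" by (rule h')
  fix x assume x: "x \<in> {a..b}"
  have "(LINT y:{a<..<x}|lborel. h y) = (LINT y:{a<..<x}|lborel. h' y)"
    unfolding set_lebesgue_integral_def
  proof (rule integral_cong_AE)
    have "set_integrable lborel {a<..<x} h" by (rule set_integrable_subset[OF ac_on_integrable[OF ac]]) (use x in auto)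
    then show "(\<lambda>y. indicat_real {a<..<x} y *\<^sub>R h y) \<in> borel_measurable lborel"
      unfolding set_integrable_def by (rule borel_measurable_integrable)
    have "set_integrable lborel {a<..<x} h'" by (rule set_integrable_subset[OF h']) (use x in auto)
    then show "(\<lambda>y. indicat_real {a<..<x} y *\<^sub>R h' y) \<in> borel_measurable lborel"
      unfolding set_integrable_def by (rule borel_measurable_integrable)
    show "AE y in lborel. indicat_real {a<..<x} y *\<^sub>R h y = indicat_real {a<..<x} y *\<^sub>R h' y"
      using ae by eventually_elim (use x in \<open>auto simp: indicator_def\<close>)
  qed
  then show "w x = w a + (LINT y:{a<..<x}|lborel. h' y)" using ac_on_eq[OF ac x] by linarith
qed

lemma ac_on_cong:
  assumes ac: "ac_on a b w h" and eq: "\<And>x. x \<in> {a..b} \<Longrightarrow> w' x = w x"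
  shows "ac_on a b w' h"
  unfolding ac_on_def
proof (intro conjI ballI)
  fix x assume x: "x \<in> {a..b}"
  then have "a \<in> {a..b}" by auto
  then show "w' x = w' a + (LINT y:{a<..<x}|lborel. h y)"
    using ac_on_eq[OF ac x] eq[OF x] eq[of a] by linarith
qed (rule ac_on_le[OF ac] ac_on_integrable[OF ac])+

abbreviation end_value :: "('v, 'e) metric_graph \<Rightarrow> ('e \<times> real \<Rightarrow> real) \<Rightarrow> 'e \<times> bool \<Rightarrow> real" where
  "end_value G w a \<equiv> w (fst a, end_coord G a)"

abbreviation end_sign :: "'e \<times> bool \<Rightarrow> real" where
  "end_sign a \<equiv> if snd a then 1 else - 1"

locale metric_graph_space = fixes G :: "('v, 'e) metric_graph"
  assumes metric: "metric_graph G"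
begin

sublocale countable_graph G
  by (intro countable_graph.intro metric_graph_countable_edges metric)

lemma elen_pos: "e \<in> edges G \<Longrightarrow> 0 < elen G e"
  using metric by (simp add: metric_graph_def)

lemma countable_vertices: "countable (vertices G)"
  using metric by (simp add: metric_graph_def)

lemma finite_ends_at: "v \<in> vertices G \<Longrightarrow> finite (ends_at G v)"
  using metric by (simp add: metric_graph_def)

lemma countable_ends: "countable (ends_at G v)"
proof (rule countable_subset)
  show "ends_at G v \<subseteq> edges G \<times> UNIV" by (auto simp: ends_at_def)
  show "countable (edges G \<times> (UNIV :: bool set))" by (intro countable_SIGMA countable_edges) auto
qed

lemma ends_bij: "bij_betw snd (Sigma (vertices G) (ends_at G)) (edges G \<times> UNIV)"
proof (rule bij_betwI')
  fix p q assume "p \<in> Sigma (vertices G) (ends_at G)" "q \<in> Sigma (vertices G) (ends_at G)"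
  then show "(snd p = snd q) = (p = q)" by (auto simp: ends_at_def)
next
  fix p assume "p \<in> Sigma (vertices G) (ends_at G)"
  then show "snd p \<in> edges G \<times> UNIV" by (auto simp: ends_at_def)
next
  fix a :: "'e \<times> bool" assume a: "a \<in> edges G \<times> UNIV"
  then have "endpoint G a \<in> vertices G" using metric by (auto simp: metric_graph_def endpoint_def)
  then have "(endpoint G a, a) \<in> Sigma (vertices G) (ends_at G)" using a by (auto simp: ends_at_def)
  then show "\<exists>p\<in>Sigma (vertices G) (ends_at G). a = snd p" by force
qed

text \<open>On each edge the integral of a derivative is the difference of the two end values.  Summing
  over all edges and regrouping the absolutely summable family of end values by vertices gives the
  net flux at every vertex.\<close>

lemma divergence_theorem:
  assumes ac: "\<And>e. e \<in> edges G \<Longrightarrow> ac_on 0 (elen G e) (\<lambda>x. P (e, x)) (\<lambda>x. p (e, x))"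
    and p: "integrable (graph_measure G) p"
    and sum: "end_value G P abs_summable_on (edges G \<times> UNIV)"
  shows "(LINT x|graph_measure G. p x) =
    infsetsum (\<lambda>v. \<Sum>a\<in>ends_at G v. end_sign a * end_value G P a) (vertices G)"
proof -
  define s where "s a = end_sign a * end_value G P a" for a
  have s: "s abs_summable_on (edges G \<times> UNIV)"
    by (rule abs_summable_on_comparison_test[OF sum]) (simp add: s_def)
  have edge: "(LINT x:{0<..<elen G e}|lborel. p (e, x)) = infsetsum (\<lambda>d. s (e, d)) UNIV" if e: "e \<in> edges G" for e
  proof -
    have "P (e, elen G e) = P (e, 0) + (LINT x:{0<..<elen G e}|lborel. p (e, x))"
      using ac_on_eq[OF ac[OF e], of "elen G e"] elen_pos[OF e] by simp
    moreover have "infsetsum (\<lambda>d. s (e, d)) UNIV = s (e, True) + s (e, False)"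
      by (simp add: UNIV_bool)
    ultimately show ?thesis by (simp add: s_def end_coord_def)
  qed
  have "(LINT x|graph_measure G. p x) = infsetsum (\<lambda>e. LINT x:{0<..<elen G e}|lborel. p (e, x)) (edges G)"
    by (rule graph_integral(3)[OF p])
  also have "\<dots> = infsetsum (\<lambda>e. infsetsum (\<lambda>d. s (e, d)) UNIV) (edges G)"
    by (intro infsetsum_cong edge refl)
  also have "\<dots> = infsetsum s (edges G \<times> UNIV)"
    by (rule infsetsum_Sigma[OF countable_edges _ s, symmetric]) auto
  also have "\<dots> = infsetsum (\<lambda>x. s (snd x)) (Sigma (vertices G) (ends_at G))"
    by (rule infsetsum_reindex_bij_betw[OF ends_bij, symmetric])
  also have "\<dots> = infsetsum (\<lambda>v. infsetsum (\<lambda>a. s (snd (v, a))) (ends_at G v)) (vertices G)"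
    by (rule infsetsum_Sigma[OF countable_vertices countable_ends])
       (simp add: abs_summable_on_reindex_bij_betw[OF ends_bij] s)
  also have "\<dots> = infsetsum (\<lambda>v. \<Sum>a\<in>ends_at G v. end_sign a * end_value G P a) (vertices G)"
    by (intro infsetsum_cong refl) (simp add: finite_ends_at s_def)
  finally show ?thesis .
qed

text \<open>The classical form of membership of \<open>f\<close> in the domain of the Laplacian, with first derivative
  \<open>g\<close> and second derivative \<open>h\<close>.\<close>

definition regular :: "('e \<times> real \<Rightarrow> real) \<Rightarrow> ('e \<times> real \<Rightarrow> real) \<Rightarrow> ('e \<times> real \<Rightarrow> real) \<Rightarrow> bool" where
  "regular f g h \<longleftrightarrow> f \<in> L2 G \<and> g \<in> L2 G \<and> h \<in> L2 G \<and>
     (\<forall>e\<in>edges G. ac_on 0 (elen G e) (\<lambda>x. f (e, x)) (\<lambda>x. g (e, x))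
                \<and> ac_on 0 (elen G e) (\<lambda>x. g (e, x)) (\<lambda>x. h (e, x))) \<and>
     (\<forall>v\<in>vertices G. (\<Sum>a\<in>ends_at G v. end_sign a * end_value G g a) = 0) \<and>
     (\<forall>v\<in>vertices G. \<forall>a\<in>ends_at G v. \<forall>a'\<in>ends_at G v. end_value G f a = end_value G f a')"

lemma regular_L2: "regular f g h \<Longrightarrow> f \<in> L2 G" "regular f g h \<Longrightarrow> g \<in> L2 G" "regular f g h \<Longrightarrow> h \<in> L2 G"
  unfolding regular_def by simp_all

lemma regular_ac_on:
  assumes "regular f g h" "e \<in> edges G"
  shows "ac_on 0 (elen G e) (\<lambda>x. f (e, x)) (\<lambda>x. g (e, x))"
    and "ac_on 0 (elen G e) (\<lambda>x. g (e, x)) (\<lambda>x. h (e, x))"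
  using assms unfolding regular_def by simp_all

lemma regular_kirchhoff:
  "regular f g h \<Longrightarrow> v \<in> vertices G \<Longrightarrow> (\<Sum>a\<in>ends_at G v. end_sign a * end_value G g a) = 0"
  unfolding regular_def by simp

lemma regular_continuous:
  assumes "regular f g h" "v \<in> vertices G" "a \<in> ends_at G v" "a' \<in> ends_at G v"
  shows "end_value G f a = end_value G f a'"
proof -
  have "\<forall>v\<in>vertices G. \<forall>a\<in>ends_at G v. \<forall>a'\<in>ends_at G v. end_value G f a = end_value G f a'"
    using assms(1) unfolding regular_def by (elim conjE)
  from this[THEN bspec, OF assms(2), THEN bspec, OF assms(3), THEN bspec, OF assms(4)] show ?thesis .
qed

lemma continuous_edge_measurable:
  fixes w :: "real \<Rightarrow> real"
  assumes "continuous_on {0..l} w"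
  shows "(\<lambda>x. indicator {0<..<l} x *\<^sub>R w x) \<in> borel_measurable lborel"
  using borel_measurable_continuous_on_indicator[OF _ continuous_on_subset[OF assms], of "{0<..<l}"]
  by (simp add: subset_eq)

text \<open>The du Bois-Reymond lemma is applied twice.  The weak second derivative provides an
  absolutely continuous representative \<open>k\<close> of the first derivative; then \<open>f\<close>, being continuous, is
  the integral of \<open>k\<close> everywhere on closed edges and not only almost everywhere.  Since \<open>k\<close> is continuous up to
  the ends, it is the one-sided derivative there, and the Kirchhoff condition passes to \<open>k\<close>.\<close>

lemma laplacian_regular:
  assumes f: "(f :: 'e \<times> real \<Rightarrow> real) \<in> laplacian_domain G"
  obtains g where "regular f g (laplacian G f)"
proof -
  define h where "h = laplacian G f"
  have "\<exists>h. has_laplacian G f h" using f by (auto simp: laplacian_domain_def)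
  then have "has_laplacian G f h" unfolding h_def laplacian_def by (rule someI_ex)
  then obtain g where g: "g \<in> L2 G" "has_edge_derivative G f g" "has_edge_derivative G g h" and h: "h \<in> L2 G"
    by (auto simp: has_laplacian_def)
  have fL: "f \<in> L2 G" and fc: "continuous_on_graph G f" using f by (auto simp: laplacian_domain_def H1_def)
  have "\<forall>e\<in>edges G. \<exists>w. ac_on 0 (elen G e) w (\<lambda>x. h (e, x)) \<and> (AE x in lborel. 0 < x \<and> x < elen G e \<longrightarrow> g (e, x) = w x)"
  proof
    fix e assume e: "e \<in> edges G"
    have "has_weak_derivative (elen G e) (\<lambda>x. g (e, x)) (\<lambda>x. h (e, x))"
      using g(3) e by (simp add: has_edge_derivative_def)
    then obtain w where "ac_on 0 (elen G e) w (\<lambda>x. h (e, x))" "AE x in lborel. 0 < x \<and> x < elen G e \<longrightarrow> g (e, x) = w x"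
      by (rule weak_derivative_imp_ac_on[OF _ elen_pos[OF e] L2_edge(1)[OF h e]])
    then show "\<exists>w. ac_on 0 (elen G e) w (\<lambda>x. h (e, x)) \<and> (AE x in lborel. 0 < x \<and> x < elen G e \<longrightarrow> g (e, x) = w x)"
      by (intro exI[of _ w] conjI)
  qed
  from bchoice[OF this] obtain w where w: "\<And>e. e \<in> edges G \<Longrightarrow> ac_on 0 (elen G e) (w e) (\<lambda>x. h (e, x))"
    "\<And>e. e \<in> edges G \<Longrightarrow> AE x in lborel. 0 < x \<and> x < elen G e \<longrightarrow> g (e, x) = w e x"
    by auto
  define k where "k p = w (fst p) (snd p)" for p
  have kc: "continuous_on {0..elen G e} (\<lambda>x. k (e, x))" if "e \<in> edges G" for e
    using ac_on_continuous[OF w(1)[OF that]] by (simp add: k_def)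
  have km: "k \<in> borel_measurable (graph_measure G)"
    unfolding graph_measurable_iff using continuous_edge_measurable[OF kc] by blast
  have gk: "AE p in graph_measure G. g p = k p"
    unfolding AE_graph_iff using w(2) by (simp add: k_def)
  have "integrable (graph_measure G) (\<lambda>p. (k p)\<^sup>2)"
  proof (rule integrable_cong_AE_imp[OF L2_real(2)[OF g(1)]])
    show "(\<lambda>p. (k p)\<^sup>2) \<in> borel_measurable (graph_measure G)" using km by simp
    show "AE p in graph_measure G. (g p)\<^sup>2 = (k p)\<^sup>2" using gk by eventually_elim simp
  qed
  then have kL: "k \<in> L2 G" using km by (simp add: L2_def)
  have acf: "ac_on 0 (elen G e) (\<lambda>x. f (e, x)) (\<lambda>x. k (e, x))" if e: "e \<in> edges G" for e
  proof -
    have "has_weak_derivative (elen G e) (\<lambda>x. f (e, x)) (\<lambda>x. g (e, x))"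
      using g(2) e by (simp add: has_edge_derivative_def)
    then obtain z where z: "ac_on 0 (elen G e) z (\<lambda>x. g (e, x))"
      "AE x in lborel. 0 < x \<and> x < elen G e \<longrightarrow> f (e, x) = z x"
      by (rule weak_derivative_imp_ac_on[OF _ elen_pos[OF e] L2_edge(1)[OF g(1) e]])
    have fz: "f (e, x) = z x" if "x \<in> {0..elen G e}" for x
      by (rule continuous_AE_eq_imp_eq[OF _ ac_on_continuous[OF z(1)] elen_pos[OF e] z(2) that])
        (use fc e in \<open>simp add: continuous_on_graph_def\<close>)
    have "ac_on 0 (elen G e) z (\<lambda>x. k (e, x))"
      by (rule ac_on_cong_AE[OF z(1) L2_edge(1)[OF kL e]]) (use w(2)[OF e] in \<open>simp add: k_def\<close>)
    then show ?thesis by (rule ac_on_cong) (rule fz)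
  qed
  have ack: "ac_on 0 (elen G e) (\<lambda>x. k (e, x)) (\<lambda>x. h (e, x))" if "e \<in> edges G" for e
    using w(1)[OF that] by (simp add: k_def)
  have od: "outer_derivative G f a = end_sign a * end_value G k a" if "fst a \<in> edges G" for a
  proof -
    obtain e d where a: "a = (e, d)" by (cases a)
    have e: "e \<in> edges G" using that a by simp
    have x: "end_coord G (e, d) \<in> {0..elen G e}" using elen_pos[OF e] by (simp add: end_coord_def)
    have "((\<lambda>x. f (e, x)) has_vector_derivative k (e, end_coord G (e, d))) (at (end_coord G (e, d)) within {0..elen G e})"
      by (rule ac_on_has_derivative[OF acf[OF e] kc[OF e] x])
    then have "vector_derivative (\<lambda>x. f (e, x)) (at (end_coord G (e, d)) within {0..elen G e}) = k (e, end_coord G (e, d))"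
      using x elen_pos[OF e] by (intro vector_derivative_within_closed_interval)
    then show ?thesis by (simp add: outer_derivative_def a)
  qed
  have kirchhoff: "(\<Sum>a\<in>ends_at G v. end_sign a * end_value G k a) = 0" if v: "v \<in> vertices G" for v
  proof -
    have "(\<Sum>a\<in>ends_at G v. end_sign a * end_value G k a) = (\<Sum>a\<in>ends_at G v. outer_derivative G f a)"
      by (intro sum.cong refl) (simp add: od ends_at_def)
    also have "\<dots> = 0" using f v by (simp add: laplacian_domain_def)
    finally show ?thesis .
  qed
  have cont: "end_value G f a = end_value G f a'" if "v \<in> vertices G" "a \<in> ends_at G v" "a' \<in> ends_at G v" for v a a'
    using fc that unfolding continuous_on_graph_def by blast
  have "regular f k h"
    unfolding regular_def by (intro conjI ballI) (rule fL kL h | erule acf | erule ack | erule kirchhoff | (rule cont, assumption+))+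
  then show ?thesis using that by (simp add: h_def)
qed

end

text \<open>A positive lower bound on the edge lengths is what makes the trace inequality uniform over
  the edges.\<close>

locale equilateral_graph = metric_graph_space G for G :: "('v, 'e) metric_graph" +
  fixes r :: real
  assumes r_pos: "0 < r" and elen_eq: "e \<in> edges G \<Longrightarrow> elen G e = r"
begin

lemma trace_bound:
  assumes w: "w \<in> L2 G" and h: "h \<in> L2 G" and e: "e \<in> edges G" and c: "0 < c" and x: "x \<in> {0..r}"
    and ac: "ac_on 0 (elen G e) (\<lambda>x. w (e, x)) (\<lambda>x. h (e, x))"
  shows "(w (e, x))\<^sup>2 \<le> (1 / r + 1 / c) * (LINT y:{0<..<elen G e}|lborel. (w (e, y))\<^sup>2) + c * (LINT y:{0<..<elen G e}|lborel. (h (e, y))\<^sup>2)"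
  using ac_on_trace[OF ac _ c, of x] L2_edge(2)[OF h e] x r_pos elen_eq[OF e] by simp

lemma trace_summable:
  assumes w: "w \<in> L2 G" and h: "h \<in> L2 G"
    and ac: "\<And>e. e \<in> edges G \<Longrightarrow> ac_on 0 (elen G e) (\<lambda>x. w (e, x)) (\<lambda>x. h (e, x))"
  shows "(\<lambda>a. (end_value G w a)\<^sup>2) abs_summable_on (edges G \<times> UNIV)"
proof -
  define W where "W e = (LINT y:{0<..<elen G e}|lborel. (w (e, y))\<^sup>2)" for e
  define H where "H e = (LINT y:{0<..<elen G e}|lborel. (h (e, y))\<^sup>2)" for e
  define K where "K e = (1 / r + 1 / 1) * W e + 1 * H e" for e
  have "W abs_summable_on edges G" "H abs_summable_on edges G"
    unfolding W_def[abs_def] H_def[abs_def] by (intro graph_integral(2) L2_real w h)+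
  then have K: "K abs_summable_on edges G"
    unfolding K_def[abs_def] by (intro abs_summable_on_add abs_summable_on_cmult_right)
  have "(\<lambda>a. K (fst a)) abs_summable_on (edges G \<times> (UNIV :: bool set))"
  proof (subst abs_summable_on_Sigma_iff)
    show "(\<forall>x\<in>edges G. (\<lambda>y. K (fst (x, y))) abs_summable_on (UNIV :: bool set)) \<and>
      (\<lambda>x. infsetsum (\<lambda>y. norm (K (fst (x, y)))) (UNIV :: bool set)) abs_summable_on edges G"
      using abs_summable_on_cmult_right[OF abs_summable_on_normI[OF K], of 2]
      by simp
  qed (auto simp: countable_edges)
  then show ?thesis
  proof (rule abs_summable_on_comparison_test')
    fix a :: "'e \<times> bool" assume a: "a \<in> edges G \<times> UNIV"
    then have e: "fst a \<in> edges G" by auto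
    have x: "end_coord G a \<in> {0..r}"
      using r_pos elen_eq[OF e] by (cases a) (auto simp: end_coord_def)
    have "(w (fst a, end_coord G a))\<^sup>2 \<le> (1 / r + 1 / 1) * W (fst a) + 1 * H (fst a)"
      unfolding W_def H_def by (rule trace_bound[OF w h e zero_less_one x ac[OF e]])
    then show "norm ((end_value G w a)\<^sup>2) \<le> K (fst a)" by (simp add: K_def)
  qed
qed

lemma end_product_summable:
  assumes "(\<lambda>a. (end_value G w a)\<^sup>2) abs_summable_on (edges G \<times> UNIV)"
    and "(\<lambda>a. (end_value G z a)\<^sup>2) abs_summable_on (edges G \<times> UNIV)"
  shows "end_value G (\<lambda>p. w p * z p) abs_summable_on (edges G \<times> UNIV)"
proof (rule abs_summable_on_comparison_test'[OF abs_summable_on_add[OF assms]])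
  have *: "\<bar>s * t\<bar> \<le> s\<^sup>2 + t\<^sup>2" for s t :: real
  proof -
    have "0 \<le> (\<bar>s\<bar> - \<bar>t\<bar>)\<^sup>2" by simp
    then have "2 * (\<bar>s\<bar> * \<bar>t\<bar>) \<le> s\<^sup>2 + t\<^sup>2" by (simp add: power2_diff)
    moreover have "0 \<le> \<bar>s\<bar> * \<bar>t\<bar>" by simp
    ultimately show ?thesis unfolding abs_mult by linarith
  qed
  fix a :: "'e \<times> bool"
  show "norm (end_value G (\<lambda>p. w p * z p) a) \<le> (end_value G w a)\<^sup>2 + (end_value G z a)\<^sup>2"
    unfolding real_norm_def by (rule *)
qed

text \<open>The flux of \<open>g1 * f2\<close> vanishes at every vertex: \<open>f2\<close> has one value there, and the outer
  derivatives of \<open>f1\<close> add up to zero.\<close>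

lemma green:
  assumes 1: "regular f1 g1 h1" and 2: "regular f2 g2 h2"
  shows "L2_inner h1 f2 = - L2_inner g1 g2"
proof -
  have L: "f1 \<in> L2 G" "g1 \<in> L2 G" "h1 \<in> L2 G" "f2 \<in> L2 G" "g2 \<in> L2 G" "h2 \<in> L2 G"
    using regular_L2[OF 1] regular_L2[OF 2] by simp_all
  have ac1: "ac_on 0 (elen G e) (\<lambda>x. g1 (e, x)) (\<lambda>x. h1 (e, x))" if "e \<in> edges G" for e
    by (rule regular_ac_on(2)[OF 1 that])
  have ac2: "ac_on 0 (elen G e) (\<lambda>x. f2 (e, x)) (\<lambda>x. g2 (e, x))" if "e \<in> edges G" for e
    by (rule regular_ac_on(1)[OF 2 that])
  have int: "integrable (graph_measure G) (\<lambda>p. h1 p * f2 p)" "integrable (graph_measure G) (\<lambda>p. g1 p * g2 p)"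
    by (intro L2_prod_integrable L)+
  have "(LINT p|graph_measure G. h1 p * f2 p + g1 p * g2 p)
     = infsetsum (\<lambda>v. \<Sum>a\<in>ends_at G v. end_sign a * end_value G (\<lambda>p. g1 p * f2 p) a) (vertices G)"
  proof (rule divergence_theorem)
    show "ac_on 0 (elen G e) (\<lambda>x. g1 (e, x) * f2 (e, x)) (\<lambda>x. h1 (e, x) * f2 (e, x) + g1 (e, x) * g2 (e, x))"
      if "e \<in> edges G" for e by (rule ac_on_mult[OF ac1[OF that] ac2[OF that]])
    show "integrable (graph_measure G) (\<lambda>p. h1 p * f2 p + g1 p * g2 p)"
      using int by (rule Bochner_Integration.integrable_add)
    show "end_value G (\<lambda>p. g1 p * f2 p) abs_summable_on (edges G \<times> UNIV)"
      by (intro end_product_summable trace_summable[OF L(2,3) ac1] trace_summable[OF L(4,5) ac2])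
  qed
  also have "\<dots> = 0"
  proof (rule infsetsum_all_0)
    fix v assume v: "v \<in> vertices G"
    show "(\<Sum>a\<in>ends_at G v. end_sign a * end_value G (\<lambda>p. g1 p * f2 p) a) = 0"
    proof (cases "ends_at G v = {}")
      case False
      then obtain a0 where a0: "a0 \<in> ends_at G v" by blast
      have c: "end_value G f2 a = end_value G f2 a0" if "a \<in> ends_at G v" for a
        by (rule regular_continuous[OF 2 v that a0])
      have "(\<Sum>a\<in>ends_at G v. end_sign a * end_value G (\<lambda>p. g1 p * f2 p) a)
          = (\<Sum>a\<in>ends_at G v. (end_sign a * end_value G g1 a) * end_value G f2 a0)"
        by (intro sum.cong refl) (simp add: c)
      also have "\<dots> = (\<Sum>a\<in>ends_at G v. end_sign a * end_value G g1 a) * end_value G f2 a0"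
        by (rule sum_distrib_right[symmetric])
      also have "(\<Sum>a\<in>ends_at G v. end_sign a * end_value G g1 a) = 0"
        by (rule regular_kirchhoff[OF 1 v])
      finally show ?thesis by simp
    qed simp
  qed
  finally have "L2_inner h1 f2 + L2_inner g1 g2 = 0"
    unfolding L2_inner_def using int by simp
  then show ?thesis by linarith
qed

end

section \<open>Combinatorics of the homogeneous tree\<close>

lemma walk_append:
  "walk G u (p @ q) v \<longleftrightarrow> (\<exists>w. walk G u p w \<and> walk G w q v)" if "metric_graph G"
proof (induction p arbitrary: u)
  case Nil
  have "walk G u q v \<Longrightarrow> u \<in> vertices G"
  proof (cases q)
    case (Cons a q')
    assume "walk G u q v"
    then show ?thesis using that Cons by (cases a) (auto simp: metric_graph_def endpoint_def split: if_splits)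
  qed auto
  then show ?case by auto
next
  case (Cons a p)
  then show ?case by (cases a) auto
qed

locale homogeneous =
  fixes G :: "('v, 'e) metric_graph" and b :: nat and r :: real
  assumes b2: "2 \<le> b" and r0: "0 < r" and hom: "homogeneous_tree b r G"
begin

lemma tree: "metric_tree G" using hom by (simp add: homogeneous_tree_def)
lemma mgraph: "metric_graph G" using tree by (simp add: metric_tree_def)

sublocale equilateral_graph G r
  by unfold_locales (use mgraph r0 hom in \<open>auto simp: homogeneous_tree_def\<close>)

lemma tail_head_vertices: "e \<in> edges G \<Longrightarrow> tail G e \<in> vertices G" "e \<in> edges G \<Longrightarrow> head G e \<in> vertices G"
  using mgraph by (auto simp: metric_graph_def)

lemma origin_vertex: "origin G \<in> vertices G" using tree by (simp add: metric_tree_def)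

lemma generation_head: "e \<in> edges G \<Longrightarrow> generation G (head G e) = Suc (generation G (tail G e))"
  using hom by (simp add: homogeneous_tree_def)

lemma generation_le: "walk G (origin G) p v \<Longrightarrow> generation G v \<le> length p"
  unfolding generation_def by (rule Least_le) blast

lemma generation_walk:
  assumes "v \<in> vertices G"
  obtains p where "walk G (origin G) p v" "length p = generation G v"
proof -
  have "\<forall>u\<in>vertices G. \<forall>v\<in>vertices G. \<exists>p. walk G u p v"
    using tree unfolding metric_tree_def by (elim conjE)
  from this[THEN bspec, OF origin_vertex, THEN bspec, OF assms] have "\<exists>p. walk G (origin G) p v" .
  then have "\<exists>n p. walk G (origin G) p v \<and> length p = n" by blast
  then have "\<exists>p. walk G (origin G) p v \<and> length p = generation G v"
    unfolding generation_def by (rule LeastI_ex)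
  then show ?thesis using that by blast
qed

lemma generation_origin [simp]: "generation G (origin G) = 0"
  using generation_le[of "[]" "origin G"] origin_vertex by simp

lemma generation_eq_0: "v \<in> vertices G \<Longrightarrow> generation G v = 0 \<longleftrightarrow> v = origin G"
proof
  assume v: "v \<in> vertices G" and "generation G v = 0"
  then obtain p where "walk G (origin G) p v" "length p = 0" using generation_walk[OF v] by metis
  then show "v = origin G" by simp
qed simp

lemma no_cycle:
  assumes "walk G v p v" "distinct (map fst p)"
  shows "p = []"
proof -
  have "\<forall>v p. walk G v p v \<longrightarrow> distinct (map fst p) \<longrightarrow> p = []"
    using tree unfolding metric_tree_def by (elim conjE)
  from this[THEN spec, THEN spec, THEN mp, OF assms(1), THEN mp, OF assms(2)] show ?thesis .
qed

text \<open>The last step of a shortest walk from the root enters \<open>v\<close>; as the generation increases by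
  one along every edge, this step cannot traverse its edge backwards.\<close>

lemma parent_exists:
  assumes v: "v \<in> vertices G" and n: "generation G v = Suc n"
  obtains e where "e \<in> edges G" "head G e = v" "generation G (tail G e) = n"
proof -
  obtain p where p: "walk G (origin G) p v" "length p = Suc n" using generation_walk[OF v] n by metis
  then obtain q a where q: "p = q @ [a]" "length q = n" by (metis length_Suc_conv_rev)
  obtain e d where a: "a = (e, d)" by (cases a)
  obtain w where w: "walk G (origin G) q w" "walk G w [(e, d)] v"
    using p(1) unfolding q a walk_append[OF mgraph] by blast
  have e: "e \<in> edges G" "endpoint G (e, \<not> d) = w" "endpoint G (e, d) = v" using w(2) by auto
  have gw: "generation G w \<le> n" using generation_le[OF w(1)] q(2) by simp
  show ?thesis
  proof (cases d)
    case True
    then have "head G e = v" "tail G e = w" using e by (auto simp: endpoint_def)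
    then show ?thesis using that[OF e(1)] generation_head[OF e(1)] n by simp
  next
    case False
    then have "tail G e = v" "head G e = w" using e by (auto simp: endpoint_def)
    then have False using generation_head[OF e(1)] n gw by simp
    then show ?thesis ..
  qed
qed

text \<open>Going back from both vertices through parents until the two lines of ancestors meet yields a
  walk that stays below generation \<open>n\<close>.  The bound on the generations ensures that the edges added
  in the induction step are new.\<close>

lemma same_generation_path:
  assumes "u \<in> vertices G" "u' \<in> vertices G" "generation G u = n" "generation G u' = n" "u \<noteq> u'"
  shows "\<exists>p. walk G u p u' \<and> p \<noteq> [] \<and> distinct (map fst p) \<and> (\<forall>e\<in>fst ` set p. generation G (tail G e) < n)"
  using assms
proof (induction n arbitrary: u u')
  case 0
  then show ?case by (simp add: generation_eq_0)
next
  case (Suc n)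
  obtain e where e: "e \<in> edges G" "head G e = u" "generation G (tail G e) = n"
    using parent_exists[OF Suc.prems(1,3)] .
  obtain e' where e': "e' \<in> edges G" "head G e' = u'" "generation G (tail G e') = n"
    using parent_exists[OF Suc.prems(2,4)] .
  have ne: "e \<noteq> e'" using e e' Suc.prems(5) by auto
  show ?case
  proof (cases "tail G e = tail G e'")
    case True
    have "walk G u [(e, False), (e', True)] u'"
      using e e' True tail_head_vertices by (auto simp: endpoint_def)
    moreover have "\<forall>k\<in>fst ` set [(e, False), (e', True)]. generation G (tail G k) < Suc n" "distinct (map fst [(e, False), (e', True)])"
      using ne e(3) e'(3) by simp_all
    ultimately show ?thesis by blast
  next
    case False
    then obtain p where p: "walk G (tail G e) p (tail G e')" "distinct (map fst p)"
      "\<forall>e\<in>fst ` set p. generation G (tail G e) < n"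
      using Suc.IH[OF tail_head_vertices(1)[OF e(1)] tail_head_vertices(1)[OF e'(1)] e(3) e'(3)] by blast
    have "walk G (tail G e') [(e', True)] u'"
      using e' tail_head_vertices by (auto simp: endpoint_def)
    then have "walk G (tail G e) (p @ [(e', True)]) u'"
      unfolding walk_append[OF mgraph] using p(1) by blast
    then have "walk G u ((e, False) # p @ [(e', True)]) u'" using e by (simp add: endpoint_def)
    moreover have "e \<notin> fst ` set p" "e' \<notin> fst ` set p" using p(3) e(3) e'(3) by auto
    then have "distinct (map fst ((e, False) # p @ [(e', True)]))"
      using p(2) ne by (auto simp: image_iff)
    moreover have "\<forall>k\<in>fst ` set ((e, False) # p @ [(e', True)]). generation G (tail G k) < Suc n"
      using p(3) e(3) e'(3) by (auto intro: less_SucI)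
    ultimately show ?thesis by blast
  qed
qed

text \<open>Two edges into the same vertex could be joined at their tails to a closed walk with distinct
  edges.\<close>

lemma head_inj:
  assumes e: "e \<in> edges G" "e' \<in> edges G" "head G e = head G e'"
  shows "e = e'"
proof (rule ccontr)
  assume ne: "e \<noteq> e'"
  have gen: "generation G (tail G e) = generation G (tail G e')"
    using generation_head[OF e(1)] generation_head[OF e(2)] e(3) by simp
  show False
  proof (cases "tail G e = tail G e'")
    case True
    have "walk G (tail G e) [(e, True), (e', False)] (tail G e)"
      using e True tail_head_vertices by (auto simp: endpoint_def)
    moreover have "distinct (map fst [(e, True), (e', False)])" using ne by simp
    ultimately have "[(e, True), (e', False)] = []" by (rule no_cycle)
    then show False by simp
  next
    case False
    then obtain p where p: "walk G (tail G e) p (tail G e')" "distinct (map fst p)"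
      "\<forall>k\<in>fst ` set p. generation G (tail G k) < generation G (tail G e)"
      using same_generation_path[of "tail G e" "tail G e'"] tail_head_vertices e gen by metis
    have "walk G (tail G e') [(e', True), (e, False)] (tail G e)"
      using e tail_head_vertices by (auto simp: endpoint_def)
    then have "walk G (tail G e) (p @ [(e', True), (e, False)]) (tail G e)"
      unfolding walk_append[OF mgraph] using p(1) by blast
    moreover have "e \<notin> fst ` set p" "e' \<notin> fst ` set p" using p(3) gen by auto
    then have "distinct (map fst (p @ [(e', True), (e, False)]))"
      using p(2) ne by (auto simp: image_iff)
    ultimately show False using no_cycle by blast
  qed
qed

definition children :: "'v \<Rightarrow> 'e set" where
  "children v = {e \<in> edges G. tail G e = v}"

lemma card_children_origin: "card (children (origin G)) = 1"
  using hom by (simp add: homogeneous_tree_def children_def)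

lemma card_children: "v \<in> vertices G \<Longrightarrow> v \<noteq> origin G \<Longrightarrow> card (children v) = b"
  using hom generation_eq_0[of v] by (auto simp: homogeneous_tree_def children_def)

lemma finite_children: "v \<in> vertices G \<Longrightarrow> finite (children v)"
  using card_children_origin card_children[of v] b2 by (metis card.infinite not_numeral_le_zero zero_neq_one)

lemma ends_at_eq:
  "ends_at G v = (\<lambda>e. (e, False)) ` children v \<union> (\<lambda>e. (e, True)) ` {e \<in> edges G. head G e = v}"
  by (force simp: ends_at_def children_def endpoint_def split: if_splits)

lemma sum_ends_origin:
  fixes F :: "'e \<times> bool \<Rightarrow> 'a::comm_monoid_add"
  shows "(\<Sum>a\<in>ends_at G (origin G). F a) = (\<Sum>e\<in>children (origin G). F (e, False))"
proof -
  have "{e \<in> edges G. head G e = origin G} = {}"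
    using generation_head generation_origin by force
  then have "ends_at G (origin G) = (\<lambda>e. (e, False)) ` children (origin G)" unfolding ends_at_eq by (simp only: image_empty Un_empty_right)
  then show ?thesis by (simp add: sum.reindex inj_on_def)
qed

lemma parent_unique:
  assumes "v \<in> vertices G" "v \<noteq> origin G"
  obtains e where "e \<in> edges G" "head G e = v" "{e \<in> edges G. head G e = v} = {e}"
proof -
  obtain n where "generation G v = Suc n" using generation_eq_0[OF assms(1)] assms(2) by (cases "generation G v") auto
  then obtain e where e: "e \<in> edges G" "head G e = v" using parent_exists[OF assms(1)] by metis
  then have "{e \<in> edges G. head G e = v} = {e}" using head_inj by auto
  then show ?thesis using that e by blast
qed

lemma sum_ends:
  fixes F :: "'e \<times> bool \<Rightarrow> 'a::comm_monoid_add"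
  assumes e: "e \<in> edges G"
  shows "(\<Sum>a\<in>ends_at G (head G e). F a) = F (e, True) + (\<Sum>e'\<in>children (head G e). F (e', False))"
proof -
  have "{e' \<in> edges G. head G e' = head G e} = {e}" using head_inj e by auto
  then have *: "ends_at G (head G e) = insert (e, True) ((\<lambda>e. (e, False)) ` children (head G e))"
    unfolding ends_at_eq by simp
  have "finite ((\<lambda>e. (e, False)) ` children (head G e))" "(e, True) \<notin> (\<lambda>e. (e, False)) ` children (head G e)"
    using finite_children[OF tail_head_vertices(2)[OF e]] by auto
  then have "(\<Sum>a\<in>ends_at G (head G e). F a) = F (e, True) + (\<Sum>a\<in>(\<lambda>e. (e, False)) ` children (head G e). F a)"
    unfolding * by (rule sum.insert)
  then show ?thesis by (simp add: sum.reindex inj_on_def)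
qed

lemma head_not_origin: "e \<in> edges G \<Longrightarrow> head G e \<noteq> origin G"
  using generation_head generation_origin by (metis nat.distinct(1))

end

section \<open>A Poincare inequality from a positive supersolution\<close>

text \<open>The parameters of the majorant, with the angle restricted such that it is positive.\<close>

locale supersolution =
  fixes b :: nat and r \<kappa> \<alpha> :: real
  assumes b2: "2 \<le> b" and r_pos: "0 < r" and \<kappa>_pos: "0 < \<kappa>" and small: "\<kappa> * r < pi / 2"
    and \<alpha>: "0 < \<alpha>" "\<alpha> < 1"
    and cond: "\<alpha>\<^sup>2 - 2 * ((real b + 1) / (2 * sqrt (real b))) * cos (\<kappa> * r) * \<alpha> + 1 \<le> 0"
begin

text \<open>On an edge whose head has generation \<open>n\<close>, and whose tail thus has generation \<open>n - 1\<close>, the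
  majorant is the constant \<open>\<alpha> ^ (n - 1) / b powr (n / 2)\<close> times this function of the coordinate.\<close>

definition ground :: "real \<Rightarrow> real" where
  "ground x = sqrt b * sin (\<kappa> * (r - x)) + \<alpha> * sin (\<kappa> * x)"

definition ground' :: "real \<Rightarrow> real" where
  "ground' x = \<kappa> * (\<alpha> * cos (\<kappa> * x) - sqrt b * cos (\<kappa> * (r - x)))"

definition logder :: "real \<Rightarrow> real" where
  "logder x = ground' x / ground x"

lemma sin_pos: "0 < sin (\<kappa> * r)" and cos_pos: "0 < cos (\<kappa> * r)"
proof -
  have p: "0 < \<kappa> * r" using \<kappa>_pos r_pos by simp
  show "0 < sin (\<kappa> * r)" by (rule sin_gt_zero[OF p]) (use small pi_gt_zero in linarith)
  show "0 < cos (\<kappa> * r)" by (rule cos_gt_zero[OF p small])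
qed

lemma ground_pos:
  assumes "x \<in> {0..r}"
  shows "0 < ground x"
proof -
  have k: "\<kappa> * y < pi" if "y \<le> r" for y
  proof -
    have "\<kappa> * y \<le> \<kappa> * r" using that \<kappa>_pos by simp
    then show ?thesis using small pi_gt_zero by linarith
  qed
  have s: "0 \<le> sin (\<kappa> * y)" if "0 \<le> y" "y \<le> r" for y
    by (rule sin_ge_zero) (use that k[of y] \<kappa>_pos in auto)
  have sp: "0 < sin (\<kappa> * y)" if "0 < y" "y \<le> r" for y
    by (rule sin_gt_zero) (use that k[of y] \<kappa>_pos in auto)
  have B: "0 < sqrt b" using b2 by simp
  show ?thesis
  proof (cases "x < r")
    case True
    have "0 < sqrt b * sin (\<kappa> * (r - x))" using B sp[of "r - x"] True assms by simp
    moreover have "0 \<le> \<alpha> * sin (\<kappa> * x)" using \<alpha> s[of x] assms by simp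
    ultimately show ?thesis by (simp add: ground_def)
  next
    case False
    then have "x = r" using assms by simp
    then show ?thesis using \<alpha> sp[of r] r_pos by (simp add: ground_def)
  qed
qed

lemma ground_deriv: "(ground has_real_derivative ground' x) (at x)"
  unfolding ground_def ground'_def
  by (rule derivative_eq_intros refl | simp add: algebra_simps)+

lemma ground'_deriv: "(ground' has_real_derivative - (\<kappa>\<^sup>2 * ground x)) (at x)"
  unfolding ground_def ground'_def
  by (rule derivative_eq_intros refl | simp add: algebra_simps power2_eq_square)+

lemma logder_deriv:
  assumes "x \<in> {0..r}"
  shows "(logder has_real_derivative (- \<kappa>\<^sup>2 - (logder x)\<^sup>2)) (at x)"
proof -
  have n: "ground x \<noteq> 0" using ground_pos[OF assms] by simp
  have "((\<lambda>x. ground' x / ground x) has_real_derivative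
     ((- (\<kappa>\<^sup>2 * ground x)) * ground x - ground' x * ground' x) / (ground x * ground x)) (at x)"
    by (rule DERIV_divide[OF ground'_deriv ground_deriv n])
  moreover have "((- (\<kappa>\<^sup>2 * ground x)) * ground x - ground' x * ground' x) / (ground x * ground x) = - \<kappa>\<^sup>2 - (logder x)\<^sup>2"
    using n by (simp add: logder_def diff_divide_distrib power2_eq_square)
  ultimately show ?thesis by (simp add: logder_def[abs_def])
qed

lemma logder_continuous: "continuous_on {0..r} logder"
  by (intro continuous_at_imp_continuous_on ballI DERIV_isCont[OF logder_deriv])

lemma logder_ac_on: "ac_on 0 r logder (\<lambda>x. - \<kappa>\<^sup>2 - (logder x)\<^sup>2)"
proof (rule C1_imp_ac_on)
  show "(logder has_vector_derivative (- \<kappa>\<^sup>2 - (logder x)\<^sup>2)) (at x within {0..r})" if "x \<in> {0..r}" for x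
    using logder_deriv[OF that]
    by (simp add: has_real_derivative_iff_has_vector_derivative has_vector_derivative_at_within)
  show "continuous_on {0..r} (\<lambda>x. - \<kappa>\<^sup>2 - (logder x)\<^sup>2)" by (intro continuous_intros logder_continuous)
qed (use r_pos in simp)

lemma vertex_inequality: "sqrt b * (\<alpha>\<^sup>2 + 1) \<le> (real b + 1) * cos (\<kappa> * r) * \<alpha>"
proof -
  have B: "0 < sqrt b" using b2 by simp
  have "2 * ((real b + 1) / (2 * sqrt (real b))) * cos (\<kappa> * r) * \<alpha> = ((real b + 1) * cos (\<kappa> * r) * \<alpha>) / sqrt b"
    using B by (simp add: field_simps)
  then have "\<alpha>\<^sup>2 + 1 \<le> ((real b + 1) * cos (\<kappa> * r) * \<alpha>) / sqrt b" using cond by linarith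
  then have "(\<alpha>\<^sup>2 + 1) * sqrt b \<le> (real b + 1) * cos (\<kappa> * r) * \<alpha>" using pos_le_divide_eq[OF B] by simp
  then show ?thesis by (simp only: mult.commute[of "sqrt b"])
qed

text \<open>The sign condition at the root.  If \<open>\<alpha> > sqrt b * cos (\<kappa> * r)\<close>, then the quadratic condition
  would give \<open>b * (\<alpha>\<^sup>2 + 1) \<le> (b + 1) * \<alpha>\<^sup>2\<close>, that is, \<open>b \<le> \<alpha>\<^sup>2 < 1\<close>.\<close>

lemma logder_0: "logder 0 \<le> 0"
proof -
  define B c where "B = sqrt (real b)" and "c = cos (\<kappa> * r)"
  have B: "0 < B" "real b = B * B" using b2 by (simp_all add: B_def)
  have "\<alpha> \<le> B * c"
  proof (rule ccontr)
    assume "\<not> \<alpha> \<le> B * c"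
    then have lt: "B * c < \<alpha>" by simp
    have "B * (B * (\<alpha>\<^sup>2 + 1)) \<le> B * ((real b + 1) * c * \<alpha>)"
      using vertex_inequality B(1) by (simp add: B_def c_def)
    also have "\<dots> = (B * c) * ((real b + 1) * \<alpha>)" by (simp add: algebra_simps)
    also have "\<dots> \<le> \<alpha> * ((real b + 1) * \<alpha>)"
      using lt \<alpha> by (intro mult_right_mono) auto
    finally have "real b * (\<alpha>\<^sup>2 + 1) \<le> (real b + 1) * \<alpha>\<^sup>2" using B(2) by (simp add: algebra_simps power2_eq_square)
    then have "real b \<le> \<alpha>\<^sup>2" by (simp add: algebra_simps)
    moreover have "\<alpha>\<^sup>2 < 1" using \<alpha> by (simp add: power_less_one_iff)
    ultimately show False using b2 by simp
  qed
  then have "ground' 0 \<le> 0" using \<kappa>_pos by (simp add: ground'_def B_def c_def mult_le_0_iff)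
  then show ?thesis using ground_pos[of 0] r_pos by (simp add: logder_def divide_nonpos_pos)
qed

text \<open>The supersolution condition at all other vertices, where one edge ends and \<open>b\<close> edges start.
  After clearing denominators it is the quadratic condition on \<open>\<alpha>\<close>.\<close>

lemma logder_r: "real b * logder 0 \<le> logder r"
proof -
  define B c s where "B = sqrt (real b)" and "c = cos (\<kappa> * r)" and "s = sin (\<kappa> * r)"
  have B: "0 < B" "real b = B * B" using b2 by (simp_all add: B_def)
  have s: "0 < s" using sin_pos by (simp add: s_def)
  have l0: "logder 0 = \<kappa> * (\<alpha> - B * c) / (B * s)"
    by (simp add: logder_def ground_def ground'_def B_def c_def s_def)
  have lr: "logder r = \<kappa> * (\<alpha> * c - B) / (\<alpha> * s)"
    by (simp add: logder_def ground_def ground'_def B_def c_def s_def)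
  have "real b * logder 0 = (\<kappa> / s) * (B * (\<alpha> - B * c))"
    unfolding l0 B(2) using B(1) s by (simp add: field_simps)
  also have "\<dots> \<le> (\<kappa> / s) * ((\<alpha> * c - B) / \<alpha>)"
  proof (rule mult_left_mono)
    have "B * (\<alpha>\<^sup>2 + 1) \<le> (B * B + 1) * c * \<alpha>"
      using vertex_inequality by (simp add: B(2)[symmetric]) (simp add: B_def c_def)
    then have "B * (\<alpha> - B * c) * \<alpha> \<le> \<alpha> * c - B" by (simp add: algebra_simps power2_eq_square)
    then show "B * (\<alpha> - B * c) \<le> (\<alpha> * c - B) / \<alpha>" using pos_le_divide_eq[OF \<alpha>(1)] by simp
    show "0 \<le> \<kappa> / s" using \<kappa>_pos s by simp
  qed
  also have "\<dots> = logder r" unfolding lr using \<alpha> s by simp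
  finally show ?thesis .
qed

end

context homogeneous
begin

lemma integrable_mult_profile:
  fixes F :: "'e \<times> real \<Rightarrow> real" and c :: "real \<Rightarrow> real"
  assumes F: "integrable (graph_measure G) F" and c: "continuous_on {0..r} c"
  shows "integrable (graph_measure G) (\<lambda>p. F p * c (snd p))"
proof -
  obtain K where K: "\<And>x. x \<in> {0..r} \<Longrightarrow> \<bar>c x\<bar> \<le> K"
    using compact_imp_bounded[OF compact_continuous_image[OF c compact_Icc]]
    unfolding bounded_iff by fastforce
  show ?thesis
  proof (rule Bochner_Integration.integrable_bound)
    show "integrable (graph_measure G) (\<lambda>p. K * F p)" using F by simp
    show "(\<lambda>p. F p * c (snd p)) \<in> borel_measurable (graph_measure G)"
      unfolding graph_measurable_iff
    proof
      fix e assume e: "e \<in> edges G"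
      have "set_integrable lborel {0<..<elen G e} (\<lambda>x. F (e, x) * c x)"
        using graph_integral(1)[OF F e] c elen_eq[OF e] by (intro set_integrable_times_continuous) auto
      then show "(\<lambda>x. indicator {0<..<elen G e} x *\<^sub>R (F (e, x) * c (snd (e, x)))) \<in> borel_measurable lborel"
        unfolding set_integrable_def by auto
    qed
    show "AE p in graph_measure G. norm (F p * c (snd p)) \<le> norm (K * F p)"
    proof (rule AE_I2)
      fix p assume "p \<in> space (graph_measure G)"
      then have "snd p \<in> {0..r}"
        using elen_eq by (auto simp: space_graph_measure graph_region_def)
      then have "\<bar>c (snd p)\<bar> \<le> K" by (rule K)
      then have "\<bar>c (snd p)\<bar> * \<bar>F p\<bar> \<le> \<bar>K\<bar> * \<bar>F p\<bar>" by (intro mult_right_mono) auto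
      then show "norm (F p * c (snd p)) \<le> norm (K * F p)" by (simp add: abs_mult mult.commute)
    qed
  qed
qed

text \<open>The integrated Picone inequality.  The divergence theorem is applied to \<open>f\<^sup>2 * logder\<close>,
  whose derivative \<open>q\<close> differs from \<open>g\<^sup>2 - \<kappa>\<^sup>2 * f\<^sup>2\<close> by a square.\<close>

lemma poincare:
  assumes S: "supersolution b r \<kappa> \<alpha>" and reg: "regular f g h"
  shows "\<kappa>\<^sup>2 * L2_inner f f \<le> L2_inner g g"
proof -
  interpret supersolution b r \<kappa> \<alpha> by (rule S)
  note L = regular_L2[OF reg]
  define P where "P p = f p * f p * logder (snd p)" for p
  define q where "q p = (g p * f p + f p * g p) * logder (snd p) + f p * f p * (- \<kappa>\<^sup>2 - (logder (snd p))\<^sup>2)" for p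
  have iq: "integrable (graph_measure G) q"
    unfolding q_def[abs_def]
  proof (rule Bochner_Integration.integrable_add)
    show "integrable (graph_measure G) (\<lambda>p. (g p * f p + f p * g p) * logder (snd p))"
      by (rule integrable_mult_profile[OF Bochner_Integration.integrable_add[OF L2_prod_integrable[OF L(2,1)] L2_prod_integrable[OF L(1,2)]] logder_continuous])
    have "continuous_on {0..r} (\<lambda>x. - \<kappa>\<^sup>2 - (logder x)\<^sup>2)" by (intro continuous_intros logder_continuous)
    then show "integrable (graph_measure G) (\<lambda>p. f p * f p * (- \<kappa>\<^sup>2 - (logder (snd p))\<^sup>2))"
      by (rule integrable_mult_profile[OF L2_prod_integrable[OF L(1,1)]])
  qed
  have "(LINT p|graph_measure G. q p) = infsetsum (\<lambda>v. \<Sum>a\<in>ends_at G v. end_sign a * end_value G P a) (vertices G)"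
  proof (rule divergence_theorem[OF _ iq])
    fix e assume e: "e \<in> edges G"
    have acf: "ac_on 0 r (\<lambda>x. f (e, x)) (\<lambda>x. g (e, x))"
      using regular_ac_on(1)[OF reg e] by (simp only: elen_eq[OF e])
    show "ac_on 0 (elen G e) (\<lambda>x. P (e, x)) (\<lambda>x. q (e, x))"
      using ac_on_mult[OF ac_on_mult[OF acf acf] logder_ac_on] by (simp only: P_def q_def elen_eq[OF e] snd_conv)
  next
    obtain K where K: "\<And>x. x \<in> {0..r} \<Longrightarrow> \<bar>logder x\<bar> \<le> K"
      using compact_imp_bounded[OF compact_continuous_image[OF logder_continuous compact_Icc]]
      unfolding bounded_iff by fastforce
    have "(\<lambda>a. K * (end_value G f a)\<^sup>2) abs_summable_on (edges G \<times> UNIV)"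
      by (intro abs_summable_on_cmult_right trace_summable[OF L(1,2) regular_ac_on(1)[OF reg]])
    then show "end_value G P abs_summable_on (edges G \<times> UNIV)"
    proof (rule abs_summable_on_comparison_test')
      fix a :: "'e \<times> bool" assume "a \<in> edges G \<times> UNIV"
      then have "end_coord G a \<in> {0..r}" using r_pos elen_eq by (cases a) (auto simp: end_coord_def)
      then have "\<bar>logder (end_coord G a)\<bar> \<le> K" by (rule K)
      then have "\<bar>logder (end_coord G a)\<bar> * (end_value G f a)\<^sup>2 \<le> K * (end_value G f a)\<^sup>2"
        by (rule mult_right_mono) simp
      then show "norm (end_value G P a) \<le> K * (end_value G f a)\<^sup>2"
        by (simp add: P_def abs_mult power2_eq_square mult.commute)
    qed
  qed
  also have "\<dots> \<ge> 0"
  proof (rule infsetsum_nonneg)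
    fix v assume v: "v \<in> vertices G"
    show "0 \<le> (\<Sum>a\<in>ends_at G v. end_sign a * end_value G P a)"
    proof (cases "v = origin G")
      case True
      show ?thesis unfolding True sum_ends_origin
        using logder_0 by (intro sum_nonneg) (simp add: P_def end_coord_def mult_nonneg_nonpos)
    next
      case False
      obtain e where e: "e \<in> edges G" "head G e = v" using parent_unique[OF v False] .
      have eT: "(e, True) \<in> ends_at G v" using e by (simp add: ends_at_def endpoint_def)
      define t where "t = f (e, r)"
      have val: "f (e', 0) = t" if "e' \<in> children v" for e'
      proof -
        have "(e', False) \<in> ends_at G v" using that by (simp add: ends_at_def children_def endpoint_def)
        from regular_continuous[OF reg v this eT] show ?thesis
          by (simp add: end_coord_def elen_eq[OF e(1)] t_def)
      qed
      have "(\<Sum>a\<in>ends_at G v. end_sign a * end_value G P a)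
          = P (e, r) + (\<Sum>e'\<in>children v. - P (e', 0))"
        unfolding e(2)[symmetric] sum_ends[OF e(1)] by (simp add: end_coord_def elen_eq[OF e(1)])
      also have "(\<Sum>e'\<in>children v. - P (e', 0)) = (\<Sum>e'\<in>children v. - (t * t * logder 0))"
        by (intro sum.cong refl) (simp add: P_def val)
      also have "\<dots> = - (real b * (t * t * logder 0))" by (simp add: card_children[OF v False])
      also have "P (e, r) + - (real b * (t * t * logder 0)) = (t * t) * (logder r - real b * logder 0)"
        by (simp add: P_def t_def algebra_simps)
      also have "\<dots> \<ge> 0" using logder_r by simp
      finally show ?thesis .
    qed
  qed
  finally have pos: "0 \<le> (LINT p|graph_measure G. q p)" .
  have i: "integrable (graph_measure G) (\<lambda>p. \<kappa>\<^sup>2 * (f p * f p))"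
    using L2_prod_integrable[OF L(1,1)] by simp
  have "(LINT p|graph_measure G. q p) + \<kappa>\<^sup>2 * L2_inner f f = (LINT p|graph_measure G. q p + \<kappa>\<^sup>2 * (f p * f p))"
    unfolding L2_inner_def using iq i by simp
  also have "\<dots> \<le> (LINT p|graph_measure G. g p * g p)"
  proof (rule integral_mono)
    show "integrable (graph_measure G) (\<lambda>p. q p + \<kappa>\<^sup>2 * (f p * f p))" using iq i by (rule Bochner_Integration.integrable_add)
    show "integrable (graph_measure G) (\<lambda>p. g p * g p)" by (rule L2_prod_integrable[OF L(2,2)])
    fix p
    have "0 \<le> (g p - f p * logder (snd p))\<^sup>2" by simp
    also have "\<dots> = g p * g p - (q p + \<kappa>\<^sup>2 * (f p * f p))"
      by (simp add: q_def power2_eq_square algebra_simps)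
    finally show "q p + \<kappa>\<^sup>2 * (f p * f p) \<le> g p * g p" by simp
  qed
  finally show ?thesis using pos by (simp add: L2_inner_def)
qed

end

section \<open>The eigenvalue given by sine functions\<close>

text \<open>The amplitudes of the eigenfunction: they vanish on the edge at the root, are \<open>1\<close> and \<open>- 1\<close> on
  two edges of the next generation, and each edge passes its amplitude with opposite sign in equal
  parts to the edges that follow it.  The natural number is the generation of the tail of the
  edge.\<close>

primrec flow :: "('e \<Rightarrow> 'e) \<Rightarrow> real \<Rightarrow> 'e \<Rightarrow> 'e \<Rightarrow> nat \<Rightarrow> 'e \<Rightarrow> real" where
  "flow par b e1 e2 0 e = 0"
| "flow par b e1 e2 (Suc n) e =
    (if n = 0 then (if e = e1 then 1 else if e = e2 then - 1 else 0) else - flow par b e1 e2 n (par e) / b)"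

lemma smooth_has_weak_derivative:
  assumes ac: "ac_on 0 l \<phi> \<phi>'" and cont: "continuous_on {0..l} \<phi>'"
  shows "has_weak_derivative l (\<lambda>x. complex_of_real (\<phi> x)) (\<lambda>x. complex_of_real (\<phi>' x))"
  unfolding has_weak_derivative_def
proof (intro conjI allI impI)
  have loc: "locally_integrable l (\<lambda>x. complex_of_real (z x))" if z: "continuous_on {0..l} z" for z
    unfolding locally_integrable_def
  proof (intro allI impI)
    fix c d :: real assume "0 < c" "d < l"
    then have "continuous_on {c..d} z" by (intro continuous_on_subset[OF z]) auto
    then show "set_integrable lborel {c..d} (\<lambda>x. complex_of_real (z x))"
      by (intro borel_integrable_atLeastAtMost' continuous_on_of_real)
  qed
  show "locally_integrable l (\<lambda>x. complex_of_real (\<phi> x))" by (rule loc[OF ac_on_continuous[OF ac]])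
  show "locally_integrable l (\<lambda>x. complex_of_real (\<phi>' x))" by (rule loc[OF cont])
  fix t t' assume t: "test_function l t t'"
  have l: "0 \<le> l" by (rule ac_on_le[OF ac])
  have z: "t 0 = 0" "t l = 0" using t l unfolding test_function_def by auto
  have ct: "continuous_on {0..l} t" "continuous_on {0..l} t'" by (rule test_function_continuous[OF t])+
  have i1: "set_integrable lborel {0<..<l} (\<lambda>x. t' x * \<phi> x)"
    by (rule set_integrable_subset[OF borel_integrable_atLeastAtMost'[of 0 l]])
       (auto intro!: continuous_intros ct ac_on_continuous[OF ac])
  have i2: "set_integrable lborel {0<..<l} (\<lambda>x. t x * \<phi>' x)"
    by (rule set_integrable_subset[OF borel_integrable_atLeastAtMost'[of 0 l]])
       (auto intro!: continuous_intros ct cont)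
  have "(LINT x:{0<..<l}|lborel. t' x * \<phi> x + t x * \<phi>' x) = 0"
    using ac_on_mult_increment[OF test_function_ac_on[OF t l] ac] z by simp
  then have eq: "(LINT x:{0<..<l}|lborel. t' x * \<phi> x) = - (LINT x:{0<..<l}|lborel. t x * \<phi>' x)"
    using set_integral_add(2)[OF i1 i2] by simp
  have of_real: "(LINT x:{0<..<l}|lborel. s x *\<^sub>R complex_of_real (z x)) = complex_of_real (LINT x:{0<..<l}|lborel. s x * z x)" for s z :: "real \<Rightarrow> real"
  proof -
    have "(LINT x:{0<..<l}|lborel. s x *\<^sub>R complex_of_real (z x)) = (LINT x|lborel. complex_of_real (indicat_real {0<..<l} x *\<^sub>R (s x * z x)))"
      unfolding set_lebesgue_integral_def
      by (intro Bochner_Integration.integral_cong refl) (auto simp: scaleR_conv_of_real)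
    also have "\<dots> = complex_of_real (LINT x:{0<..<l}|lborel. s x * z x)"
      unfolding set_lebesgue_integral_def by (rule integral_complex_of_real)
    finally show ?thesis .
  qed
  show "(LINT x:{0<..<l}|lborel. t' x *\<^sub>R complex_of_real (\<phi> x)) = - (LINT x:{0<..<l}|lborel. t x *\<^sub>R complex_of_real (\<phi>' x))"
    unfolding of_real eq by simp
qed

context homogeneous
begin

definition parent :: "'e \<Rightarrow> 'e" where
  "parent e = (SOME e'. e' \<in> edges G \<and> head G e' = tail G e)"

lemma parent_eq: "e \<in> edges G \<Longrightarrow> e' \<in> children (head G e) \<Longrightarrow> parent e' = e"
  unfolding parent_def by (rule some_equality) (auto simp: children_def intro: head_inj)

definition level :: "nat \<Rightarrow> 'e set" where
  "level n = {e \<in> edges G. generation G (tail G e) = n}"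

lemma level_0: "level 0 = children (origin G)"
  using generation_eq_0 tail_head_vertices(1) generation_origin
  by (auto simp: level_def children_def)

lemma level_Suc: "level (Suc n) = (\<Union>e\<in>level n. children (head G e))"
proof (intro set_eqI iffI)
  fix e assume e: "e \<in> level (Suc n)"
  then obtain e' where "e' \<in> edges G" "head G e' = tail G e" "generation G (tail G e') = n"
    using parent_exists[of "tail G e" n] tail_head_vertices(1)[of e] by (auto simp: level_def)
  then show "e \<in> (\<Union>e\<in>level n. children (head G e))" using e by (auto simp: level_def children_def)
next
  fix e assume "e \<in> (\<Union>e\<in>level n. children (head G e))"
  then show "e \<in> level (Suc n)" by (auto simp: level_def children_def generation_head)
qed

lemma finite_level: "finite (level n)"
proof (induction n)
  case 0
  then show ?case unfolding level_0 by (rule finite_children[OF origin_vertex])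
next
  case (Suc n)
  show ?case unfolding level_Suc
    by (intro finite_UN_I Suc.IH finite_children tail_head_vertices(2)) (simp add: level_def)
qed

lemma sum_level_Suc:
  fixes F :: "'e \<Rightarrow> real"
  shows "(\<Sum>e\<in>level (Suc n). F e) = (\<Sum>e\<in>level n. \<Sum>e'\<in>children (head G e). F e')"
  unfolding level_Suc
proof (rule sum.UNION_disjoint)
  show "\<forall>e\<in>level n. finite (children (head G e))"
    by (intro ballI finite_children tail_head_vertices(2)) (simp add: level_def)
  show "\<forall>i\<in>level n. \<forall>j\<in>level n. i \<noteq> j \<longrightarrow> children (head G i) \<inter> children (head G j) = {}"
    using head_inj by (auto simp: level_def children_def)
qed (rule finite_level)

text \<open>The edges are the disjoint union of the finite sets \<open>level n\<close>.\<close>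

lemma abs_summable_by_level:
  fixes F :: "'e \<Rightarrow> real"
  assumes "\<And>e. e \<in> edges G \<Longrightarrow> 0 \<le> F e" and "summable (\<lambda>n. \<Sum>e\<in>level n. F e)"
  shows "F abs_summable_on edges G"
proof -
  have bij: "bij_betw snd (Sigma UNIV level) (edges G)"
  proof (rule bij_betwI')
    fix p q assume "p \<in> Sigma UNIV level" "q \<in> Sigma UNIV level"
    then show "(snd p = snd q) = (p = q)" by (auto simp: level_def)
  next
    fix p assume "p \<in> Sigma UNIV level"
    then show "snd p \<in> edges G" by (auto simp: level_def)
  next
    fix e assume "e \<in> edges G"
    then have "(generation G (tail G e), e) \<in> Sigma UNIV level" by (simp add: level_def)
    then show "\<exists>p\<in>Sigma UNIV level. e = snd p" by force
  qed
  have n: "0 \<le> (\<Sum>e\<in>level n. F e)" for n using assms(1) by (intro sum_nonneg) (auto simp: level_def)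
  have "(\<lambda>p. F (snd p)) abs_summable_on (Sigma UNIV level)"
  proof (subst abs_summable_on_Sigma_iff)
    have "infsetsum (\<lambda>y. norm (F (snd (n, y)))) (level n) = (\<Sum>e\<in>level n. F e)" for n
      unfolding infsetsum_finite[OF finite_level] snd_conv
      by (intro sum.cong refl) (use assms(1) in \<open>simp add: level_def\<close>)
    then show "(\<forall>n\<in>UNIV. (\<lambda>y. F (snd (n, y))) abs_summable_on level n) \<and>
      (\<lambda>n. infsetsum (\<lambda>y. norm (F (snd (n, y)))) (level n)) abs_summable_on UNIV"
      using assms(2) n by (simp add: finite_level abs_summable_on_nat_iff')
  qed (auto intro: countable_finite finite_level)
  then show ?thesis using abs_summable_on_reindex_bij_betw[OF bij] by blast
qed

text \<open>At every vertex the amplitudes cancel.  A vertex divides the sum of the squares by \<open>b\<close>, so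
  the sums over the generations decrease geometrically.\<close>

lemma flow_exists:
  obtains c e1 where "e1 \<in> edges G" "c e1 = (1::real)"
    "\<And>v. v \<in> vertices G \<Longrightarrow> (\<Sum>a\<in>ends_at G v. c (fst a)) = 0"
    "(\<lambda>e. (c e)\<^sup>2) abs_summable_on edges G"
proof -
  obtain e0 where e0: "children (origin G) = {e0}"
    using card_children_origin by (auto simp: card_1_singleton_iff)
  have e0E: "e0 \<in> edges G" using e0 by (auto simp: children_def)
  have "1 < card (children (head G e0))"
    using card_children[OF tail_head_vertices(2)[OF e0E] head_not_origin[OF e0E]] b2 by simp
  then obtain e1 e2 where e12: "e1 \<in> children (head G e0)" "e2 \<in> children (head G e0)" "e1 \<noteq> e2"
    by (metis card_le_Suc0_iff_eq finite_children[OF tail_head_vertices(2)[OF e0E]] One_nat_def not_less)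
  define c where "c e = flow parent (real b) e1 e2 (generation G (tail G e)) e" for e
  have c0: "c e = 0" if "e \<in> level 0" for e using that by (simp add: c_def level_def)
  have c1: "c e = (if e = e1 then 1 else if e = e2 then - 1 else 0)" if "e \<in> level 1" for e
    using that by (simp add: c_def level_def)
  have cS: "c e' = - c e / b" if "e \<in> level (Suc n)" "e' \<in> children (head G e)" for e e' n
  proof -
    have e: "e \<in> edges G" "generation G (tail G e) = Suc n" using that by (auto simp: level_def)
    have "generation G (tail G e') = Suc (Suc n)" using that(2) generation_head[OF e(1)] e(2) by (simp add: children_def)
    then show ?thesis using parent_eq[OF e(1) that(2)] e(2) by (simp add: c_def)
  qed
  have e1l: "e1 \<in> level 1" using e12(1) e0 level_Suc[of 0] by (auto simp: level_0)
  have "e1 \<in> edges G" using e1l by (simp add: level_def)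
  moreover have "c e1 = 1" using c1[OF e1l] by simp
  moreover have "(\<Sum>a\<in>ends_at G v. c (fst a)) = 0" if v: "v \<in> vertices G" for v
  proof (cases "v = origin G")
    case True
    show ?thesis unfolding True sum_ends_origin using c0 by (simp add: level_0)
  next
    case False
    obtain e where e: "e \<in> edges G" "head G e = v" using parent_unique[OF v False] .
    have eq: "(\<Sum>a\<in>ends_at G v. c (fst a)) = c e + (\<Sum>e'\<in>children v. c e')"
      using sum_ends[OF e(1), of "\<lambda>a. c (fst a)"] e(2) by simp
    have fin: "finite (children v)" by (rule finite_children[OF v])
    show ?thesis
    proof (cases "generation G (tail G e)")
      case 0
      then have "e \<in> level 0" using e by (simp add: level_def)
      then have "e = e0" "c e = 0" using e0 c0 by (auto simp: level_0)
      then have v: "v = head G e0" using e by simp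
      have "(\<Sum>e'\<in>children v. c e') = (\<Sum>e'\<in>children v. (if e' = e1 then 1 else 0) - (if e' = e2 then 1 else 0))"
      proof (intro sum.cong refl)
        fix e' assume "e' \<in> children v"
        then have "e' \<in> level 1" using v e0 level_Suc[of 0] by (auto simp: level_0)
        from c1[OF this] show "c e' = (if e' = e1 then 1 else 0) - (if e' = e2 then 1 else 0)" using e12(3) by simp
      qed
      also have "\<dots> = 0" using fin e12 v by (simp add: sum_subtractf)
      finally show ?thesis using eq \<open>c e = 0\<close> by simp
    next
      case (Suc n)
      then have "e \<in> level (Suc n)" using e by (simp add: level_def)
      then have "(\<Sum>e'\<in>children v. c e') = (\<Sum>e'\<in>children v. - c e / b)"
        using cS e(2) by (intro sum.cong refl) simp
      also have "\<dots> = - c e" using b2 by (simp add: card_children[OF v False])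
      finally show ?thesis using eq by simp
    qed
  qed
  moreover have "(\<lambda>e. (c e)\<^sup>2) abs_summable_on edges G"
  proof (rule abs_summable_by_level)
    show "summable (\<lambda>n. \<Sum>e\<in>level n. (c e)\<^sup>2)"
    proof (rule summable_ratio_test)
      show "(1/2 :: real) < 1" by simp
      \<comment> \<open>The step from generation \<open>0\<close> to \<open>1\<close> is exceptional: there the amplitudes become nonzero.\<close>
      fix n :: nat assume "1 \<le> n"
      then obtain m where n: "n = Suc m" by (cases n) auto
      have "(\<Sum>e\<in>level (Suc n). (c e)\<^sup>2) = (\<Sum>e\<in>level n. (1 / real b) * (c e)\<^sup>2)"
        unfolding sum_level_Suc
      proof (intro sum.cong refl)
        fix e assume e: "e \<in> level n"
        then have eE: "e \<in> edges G" by (simp add: level_def)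
        have "(\<Sum>e'\<in>children (head G e). (c e')\<^sup>2) = (\<Sum>e'\<in>children (head G e). (- c e / b)\<^sup>2)"
          using e cS n by (intro sum.cong refl) simp
        also have "\<dots> = real b * (- c e / b)\<^sup>2"
          by (simp add: card_children[OF tail_head_vertices(2)[OF eE] head_not_origin[OF eE]])
        also have "\<dots> = (1 / real b) * (c e)\<^sup>2" using b2 by (simp add: power2_eq_square)
        finally show "(\<Sum>e'\<in>children (head G e). (c e')\<^sup>2) = (1 / real b) * (c e)\<^sup>2" .
      qed
      also have "\<dots> = (1 / real b) * (\<Sum>e\<in>level n. (c e)\<^sup>2)" by (rule sum_distrib_left[symmetric])
      also have "\<dots> \<le> (1 / 2) * (\<Sum>e\<in>level n. (c e)\<^sup>2)"
        using b2 by (intro mult_right_mono sum_nonneg) (auto simp: field_simps)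
      finally show "norm (\<Sum>e\<in>level (Suc n). (c e)\<^sup>2) \<le> (1 / 2) * norm (\<Sum>e\<in>level n. (c e)\<^sup>2)"
        by (simp add: sum_nonneg)
    qed
  qed simp
  ultimately show ?thesis using that by blast
qed

lemma separated_L2:
  fixes c :: "'e \<Rightarrow> real" and \<phi> :: "real \<Rightarrow> real"
  assumes c: "(\<lambda>e. (c e)\<^sup>2) abs_summable_on edges G" and \<phi>: "continuous_on {0..r} \<phi>"
  shows "(\<lambda>p. complex_of_real (c (fst p) * \<phi> (snd p))) \<in> L2 G"
proof -
  have "(\<lambda>p. complex_of_real (c (fst p) * \<phi> (snd p))) \<in> borel_measurable (graph_measure G)"
    unfolding graph_measurable_iff
  proof
    fix e assume e: "e \<in> edges G"
    have "(\<lambda>x. indicator {0<..<r} x *\<^sub>R (c e * \<phi> x)) \<in> borel_measurable lborel"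
      by (rule continuous_edge_measurable) (intro continuous_intros \<phi>)
    then have "(\<lambda>x. complex_of_real (indicator {0<..<r} x *\<^sub>R (c e * \<phi> x))) \<in> borel_measurable lborel"
      by measurable
    then show "(\<lambda>x. indicator {0<..<elen G e} x *\<^sub>R complex_of_real (c (fst (e, x)) * \<phi> (snd (e, x)))) \<in> borel_measurable lborel"
      by (simp add: elen_eq[OF e] scaleR_conv_of_real)
  qed
  moreover have "integrable (graph_measure G) (\<lambda>p. (c (fst p))\<^sup>2 * (\<phi> (snd p))\<^sup>2)"
  proof (rule graph_integrableI)
    fix e assume e: "e \<in> edges G"
    have "set_integrable lborel {0<..<r} (\<lambda>x. (c e)\<^sup>2 * (\<phi> x)\<^sup>2)"
      by (rule set_integrable_subset[OF borel_integrable_atLeastAtMost'[of 0 r]]) (auto intro!: continuous_intros \<phi>)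
    then show "set_integrable lborel {0<..<elen G e} (\<lambda>x. (c (fst (e, x)))\<^sup>2 * (\<phi> (snd (e, x)))\<^sup>2)"
      by (simp only: elen_eq[OF e] fst_conv snd_conv)
  next
    have "(\<lambda>e. (c e)\<^sup>2 * (LINT x:{0<..<r}|lborel. (\<phi> x)\<^sup>2)) abs_summable_on edges G"
      by (intro abs_summable_on_cmult_left c)
    then show "(\<lambda>e. LINT x:{0<..<elen G e}|lborel. norm ((c (fst (e, x)))\<^sup>2 * (\<phi> (snd (e, x)))\<^sup>2)) abs_summable_on edges G"
      by (rule abs_summable_on_comparison_test) (simp add: elen_eq)
  qed
  moreover have "(norm (complex_of_real (c (fst p) * \<phi> (snd p))))\<^sup>2 = (c (fst p))\<^sup>2 * (\<phi> (snd p))\<^sup>2" for p :: "'e \<times> real"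
    unfolding norm_of_real power2_abs by (rule power_mult_distrib)
  ultimately show ?thesis by (simp only: L2_def mem_Collect_eq)
qed

lemma separated_weak_derivative:
  fixes c :: "'e \<Rightarrow> real"
  assumes D: "\<And>x. (\<phi> has_real_derivative \<phi>' x) (at x)" and cont: "continuous_on {0..r} \<phi>'"
  shows "has_edge_derivative G (\<lambda>p. complex_of_real (c (fst p) * \<phi> (snd p))) (\<lambda>p. complex_of_real (c (fst p) * \<phi>' (snd p)))"
  unfolding has_edge_derivative_def fst_conv snd_conv
proof
  fix e assume e: "e \<in> edges G"
  show "has_weak_derivative (elen G e) (\<lambda>x. complex_of_real (c e * \<phi> x)) (\<lambda>x. complex_of_real (c e * \<phi>' x))"
  proof (rule smooth_has_weak_derivative)
    show ct: "continuous_on {0..elen G e} (\<lambda>x. c e * \<phi>' x)" unfolding elen_eq[OF e] by (intro continuous_intros cont)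
    show "ac_on 0 (elen G e) (\<lambda>x. c e * \<phi> x) (\<lambda>x. c e * \<phi>' x)"
    proof (rule C1_imp_ac_on[OF _ _ ct])
      show "0 \<le> elen G e" using elen_pos[OF e] by simp
      fix x
      have "((\<lambda>x. c e * \<phi> x) has_real_derivative c e * \<phi>' x) (at x)" by (rule DERIV_cmult[OF D])
      then show "((\<lambda>x. c e * \<phi> x) has_vector_derivative c e * \<phi>' x) (at x within {0..elen G e})"
        by (simp add: has_real_derivative_iff_has_vector_derivative has_vector_derivative_at_within)
    qed
  qed
qed

text \<open>The Laplacian of \<open>f\<close> is an arbitrary choice among the functions that serve as weak second
  derivative; they all agree almost everywhere.\<close>

lemma laplacian_AE_unique:
  fixes f h :: "'e \<times> real \<Rightarrow> 'a::{banach, second_countable_topology}"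
  assumes fg: "has_edge_derivative G f g" and gh: "has_edge_derivative G g h" and L: "g \<in> L2 G" "h \<in> L2 G"
  shows "AE p in graph_measure G. laplacian G f p = h p"
proof -
  have "has_laplacian G f h" unfolding has_laplacian_def using assms by blast
  then have "has_laplacian G f (laplacian G f)" unfolding laplacian_def by (rule someI[of "has_laplacian G f" h])
  then obtain g' where g': "has_edge_derivative G f g'" "has_edge_derivative G g' (laplacian G f)"
    unfolding has_laplacian_def by blast
  show ?thesis
    unfolding AE_graph_iff
  proof
    fix e assume e: "e \<in> edges G"
    have W: "has_weak_derivative (elen G e) (\<lambda>x. f (e, x)) (\<lambda>x. g (e, x))" "has_weak_derivative (elen G e) (\<lambda>x. g (e, x)) (\<lambda>x. h (e, x))"
      "has_weak_derivative (elen G e) (\<lambda>x. f (e, x)) (\<lambda>x. g' (e, x))" "has_weak_derivative (elen G e) (\<lambda>x. g' (e, x)) (\<lambda>x. laplacian G f (e, x))"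
      using fg gh g' e by (simp_all add: has_edge_derivative_def)
    have "AE x in lborel. 0 < x \<and> x < elen G e \<longrightarrow> g' (e, x) = g (e, x)"
      by (rule weak_derivative_unique[OF W(3) W(1) elen_pos[OF e]]) simp
    then show "AE x in lborel. 0 < x \<and> x < elen G e \<longrightarrow> laplacian G f (e, x) = h (e, x)"
      by (rule weak_derivative_unique[OF W(4) W(2) elen_pos[OF e]])
  qed
qed

text \<open>Multiples of \<open>sin (\<pi> * x / r)\<close> on the edges vanish at all vertices.  At a vertex every edge
  end contributes \<open>- \<pi> / r\<close> times its amplitude to the sum of the outer derivatives, because the
  outward direction and the sign of the cosine change together.  Thus the Kirchhoff condition
  says that the amplitudes at a vertex add up to zero.\<close>

lemma sine_eigenvalue: "complex_of_real ((pi / r)\<^sup>2) \<in> spectrum G"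
  unfolding spectrum_def
proof (rule ComplI)
  obtain c e1 where c: "e1 \<in> edges G" "c e1 = (1::real)"
    "\<And>v. v \<in> vertices G \<Longrightarrow> (\<Sum>a\<in>ends_at G v. c (fst a)) = 0"
    "(\<lambda>e. (c e)\<^sup>2) abs_summable_on edges G"
    by (rule flow_exists) blast
  define k where "k = pi / r"
  have k: "0 < k" "k * r = pi" using r_pos by (simp_all add: k_def)
  define \<psi> where "\<psi> p = complex_of_real (c (fst p) * sin (k * snd p))" for p
  define \<psi>1 where "\<psi>1 p = complex_of_real (c (fst p) * (k * cos (k * snd p)))" for p
  define \<psi>2 where "\<psi>2 p = complex_of_real (c (fst p) * (- (k\<^sup>2) * sin (k * snd p)))" for p
  have L: "\<psi> \<in> L2 G" "\<psi>1 \<in> L2 G" "\<psi>2 \<in> L2 G"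
    unfolding \<psi>_def[abs_def] \<psi>1_def[abs_def] \<psi>2_def[abs_def]
    by (intro separated_L2 c continuous_intros)+
  have D1: "((\<lambda>x. sin (k * x)) has_real_derivative k * cos (k * x)) (at x)" for x
    by (rule derivative_eq_intros refl | simp)+
  have D2: "((\<lambda>x. k * cos (k * x)) has_real_derivative - (k\<^sup>2) * sin (k * x)) (at x)" for x
    by (rule derivative_eq_intros refl | simp add: power2_eq_square)+
  have W1: "has_edge_derivative G \<psi> \<psi>1"
    unfolding \<psi>_def[abs_def] \<psi>1_def[abs_def] by (intro separated_weak_derivative D1 continuous_intros)
  have W2: "has_edge_derivative G \<psi>1 \<psi>2"
    unfolding \<psi>1_def[abs_def] \<psi>2_def[abs_def] by (intro separated_weak_derivative D2 continuous_intros)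
  have zero: "\<psi> (fst a, end_coord G a) = 0" if "fst a \<in> edges G" for a
    using that k(2) by (cases a) (auto simp: \<psi>_def end_coord_def elen_eq)
  have cont: "continuous_on_graph G \<psi>"
    unfolding continuous_on_graph_def
  proof (intro conjI ballI)
    show "continuous_on {0..elen G e} (\<lambda>x. \<psi> (e, x))" for e
      unfolding \<psi>_def fst_conv snd_conv by (intro continuous_intros)
    show "\<psi> (fst a, end_coord G a) = \<psi> (fst a', end_coord G a')" if "a \<in> ends_at G v" "a' \<in> ends_at G v" for v a a'
      using that zero[of a] zero[of a'] by (simp add: ends_at_def)
  qed
  have H1: "\<psi> \<in> H1 G" unfolding H1_def using L cont W1 by blast
  have od: "outer_derivative G \<psi> a = complex_of_real (- k * c (fst a))" if a: "fst a \<in> edges G" for a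
  proof -
    obtain e d where ad: "a = (e, d)" by (cases a)
    have e: "e \<in> edges G" using a ad by simp
    have x: "end_coord G (e, d) \<in> {0..elen G e}" using elen_pos[OF e] by (simp add: end_coord_def)
    have "((\<lambda>x. \<psi> (e, x)) has_vector_derivative \<psi>1 (e, end_coord G (e, d))) (at (end_coord G (e, d)) within {0..elen G e})"
      unfolding \<psi>_def \<psi>1_def fst_conv snd_conv
    proof (rule has_vector_derivative_of_real)
      have "((\<lambda>x. c e * sin (k * x)) has_real_derivative c e * (k * cos (k * end_coord G (e, d)))) (at (end_coord G (e, d)))"
        by (rule DERIV_cmult[OF D1])
      then show "((\<lambda>x. c e * sin (k * x)) has_real_derivative c e * (k * cos (k * end_coord G (e, d)))) (at (end_coord G (e, d)) within {0..elen G e})"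
        by (rule has_field_derivative_at_within)
    qed
    then have "vector_derivative (\<lambda>x. \<psi> (e, x)) (at (end_coord G (e, d)) within {0..elen G e}) = \<psi>1 (e, end_coord G (e, d))"
      using x elen_pos[OF e] by (intro vector_derivative_within_closed_interval)
    then show ?thesis
      using k(2) by (simp add: outer_derivative_def ad \<psi>1_def end_coord_def elen_eq[OF e])
  qed
  have kirchhoff: "(\<Sum>a\<in>ends_at G v. outer_derivative G \<psi> a) = 0" if v: "v \<in> vertices G" for v
  proof -
    have "(\<Sum>a\<in>ends_at G v. outer_derivative G \<psi> a) = (\<Sum>a\<in>ends_at G v. complex_of_real (- k * c (fst a)))"
      by (intro sum.cong refl od) (simp add: ends_at_def)
    also have "\<dots> = complex_of_real (- k * (\<Sum>a\<in>ends_at G v. c (fst a)))"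
      by (simp only: sum_distrib_left of_real_sum)
    finally show ?thesis using c(3)[OF v] by simp
  qed
  have dom: "\<psi> \<in> laplacian_domain G"
    unfolding laplacian_domain_def has_laplacian_def using H1 L W1 W2 kirchhoff by blast
  have eig: "AE p in graph_measure G. - laplacian G \<psi> p - complex_of_real ((pi / r)\<^sup>2) * \<psi> p = 0"
    using laplacian_AE_unique[OF W1 W2 L(2,3)]
    by eventually_elim (simp add: \<psi>_def \<psi>2_def k_def[symmetric])
  assume "complex_of_real ((pi / r)\<^sup>2) \<in> resolvent_set G"
  then have "\<exists>C. \<forall>f\<in>laplacian_domain G. L2_norm G f \<le> C * L2_norm G (\<lambda>p. - laplacian G f p - complex_of_real ((pi / r)\<^sup>2) * f p)"
    unfolding resolvent_set_def by blast
  then obtain C where "L2_norm G \<psi> \<le> C * L2_norm G (\<lambda>p. - laplacian G \<psi> p - complex_of_real ((pi / r)\<^sup>2) * \<psi> p)"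
    using dom by blast
  moreover have "L2_norm G (\<lambda>p. - laplacian G \<psi> p - complex_of_real ((pi / r)\<^sup>2) * \<psi> p) = 0"
  proof -
    have "(LINT p|graph_measure G. (norm (- laplacian G \<psi> p - complex_of_real ((pi / r)\<^sup>2) * \<psi> p))\<^sup>2) = 0"
      by (rule integral_eq_zero_AE) (use eig in \<open>eventually_elim, simp\<close>)
    then show ?thesis by (simp add: L2_norm_def)
  qed
  ultimately have "(LINT p|graph_measure G. (norm (\<psi> p))\<^sup>2) \<le> 0" by (simp add: L2_norm_def)
  moreover have "0 \<le> (LINT p|graph_measure G. (norm (\<psi> p))\<^sup>2)" by (rule integral_nonneg_AE) simp
  ultimately have "(LINT p|graph_measure G. (norm (\<psi> p))\<^sup>2) = 0" by linarith
  moreover have "integrable (graph_measure G) (\<lambda>p. (norm (\<psi> p))\<^sup>2)" using L(1) by (simp add: L2_def)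
  ultimately have "AE p in graph_measure G. (norm (\<psi> p))\<^sup>2 = 0"
    by (subst (asm) integral_nonneg_eq_0_iff_AE) auto
  then have "AE x in lborel. 0 < x \<and> x < elen G e1 \<longrightarrow> (norm (\<psi> (e1, x)))\<^sup>2 = 0"
    unfolding AE_graph_iff using c(1) by blast
  then have "AE x in lborel. x \<notin> {0<..<r}"
  proof eventually_elim
    case (elim x)
    show ?case
    proof
      assume xr: "x \<in> {0<..<r}"
      then have x: "0 < x" "x < r" by auto
      then have "k * x < k * r" using k(1) by simp
      then have "k * x < pi" by (simp only: k(2))
      then have "0 < sin (k * x)" using x k(1) by (intro sin_gt_zero) auto
      moreover have "\<psi> (e1, x) = 0" using elim x elen_eq[OF c(1)] by simp
      ultimately show False using c(2) by (simp add: \<psi>_def)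
    qed
  qed
  then have "{0<..<r} \<in> null_sets lborel" by (intro AE_iff_null_sets[THEN iffD2]) auto
  then show False using r_pos by (simp add: null_sets_def)
qed

end

section \<open>Decay of solutions\<close>

context homogeneous
begin

text \<open>With the symmetry assumption, the difference quotient of \<open>L2_inner (A s) (u s)\<close> is the inner product of
  \<open>A s + A t\<close> with the difference quotient of \<open>u\<close>, so that continuity of \<open>A\<close> suffices.  This
  is used with \<open>A = u\<close> and, by the Green formula, with \<open>A\<close> the Laplacian of \<open>u\<close>.\<close>

lemma has_derivative_symmetric_form:
  fixes u A :: "real \<Rightarrow> 'e \<times> real \<Rightarrow> real"
  assumes t: "0 < t" and uL: "\<And>s. 0 < s \<Longrightarrow> u s \<in> L2 G" and AL: "\<And>s. 0 < s \<Longrightarrow> A s \<in> L2 G" and u'L: "u' \<in> L2 G"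
    and cont: "((\<lambda>s. L2_norm G (\<lambda>p. A s p - A t p)) \<longlongrightarrow> 0) (at t)"
    and D: "L2_has_derivative G u u' t"
    and sym: "\<And>s. 0 < s \<Longrightarrow> L2_inner (A s) (u t) = L2_inner (A t) (u s)"
  shows "((\<lambda>s. L2_inner (A s) (u s)) has_real_derivative 2 * L2_inner (A t) u') (at t)"
proof -
  define S where "S s = (\<lambda>p. 1 * A s p + 1 * A t p)" for s
  define Q where "Q s = (\<lambda>p. (1 / (s - t)) * u s p + (- 1 / (s - t)) * u t p)" for s
  have ev: "\<forall>\<^sub>F s in at t. 0 < s"
    using order_tendstoD(1)[OF tendsto_ident_at t] .
  have "((\<lambda>s. L2_inner (S s) (Q s)) \<longlongrightarrow> L2_inner (\<lambda>p. 2 * A t p + 0 * A t p) u') (at t)"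
  proof (rule tendsto_L2_inner)
    show "\<forall>\<^sub>F s in at t. S s \<in> L2 G"
      using ev by eventually_elim (unfold S_def, intro L2_lincomb AL t)
    show "\<forall>\<^sub>F s in at t. Q s \<in> L2 G"
      using ev by eventually_elim (unfold Q_def, intro L2_lincomb uL t)
    show "(\<lambda>p. 2 * A t p + 0 * A t p) \<in> L2 G" by (intro L2_lincomb AL t)
    show "u' \<in> L2 G" by (rule u'L)
    have "(\<lambda>p. S s p - (2 * A t p + 0 * A t p)) = (\<lambda>p. A s p - A t p)" for s
      by (auto simp: S_def)
    then show "((\<lambda>s. L2_norm G (\<lambda>p. S s p - (2 * A t p + 0 * A t p))) \<longlongrightarrow> 0) (at t)"
      using cont by (simp only:)
    have "(\<lambda>p. Q s p - u' p) = (\<lambda>p. (u s p - u t p) / (s - t) - u' p)" for s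
      by (auto simp: Q_def diff_divide_distrib)
    then show "((\<lambda>s. L2_norm G (\<lambda>p. Q s p - u' p)) \<longlongrightarrow> 0) (at t)"
      using D unfolding L2_has_derivative_def by (simp only:)
  qed
  also have "L2_inner (\<lambda>p. 2 * A t p + 0 * A t p) u' = 2 * L2_inner (A t) u'"
    using L2_inner_lincomb_left[OF AL[OF t] AL[OF t] u'L, of 2 0] by simp
  finally have lim: "((\<lambda>s. L2_inner (S s) (Q s)) \<longlongrightarrow> 2 * L2_inner (A t) u') (at t)" .
  have "\<forall>\<^sub>F s in at t. L2_inner (S s) (Q s) = (L2_inner (A s) (u s) - L2_inner (A t) (u t)) / (s - t)"
    using ev
  proof eventually_elim
    case (elim s)
    have r: "L2_inner B (Q s) = (1 / (s - t)) * L2_inner B (u s) + (- 1 / (s - t)) * L2_inner B (u t)" if B: "B \<in> L2 G" for B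
      unfolding L2_inner_commute[of B] Q_def by (rule L2_inner_lincomb_left[OF uL[OF elim] uL[OF t] B])
    have QL: "Q s \<in> L2 G" unfolding Q_def by (intro L2_lincomb uL elim t)
    have "L2_inner (S s) (Q s) = 1 * L2_inner (A s) (Q s) + 1 * L2_inner (A t) (Q s)"
      unfolding S_def by (rule L2_inner_lincomb_left[OF AL[OF elim] AL[OF t] QL])
    also have "\<dots> = (1 / (s - t)) * (L2_inner (A s) (u s) - L2_inner (A s) (u t) + L2_inner (A t) (u s) - L2_inner (A t) (u t))"
      unfolding r[OF AL[OF elim]] r[OF AL[OF t]] by (simp add: algebra_simps diff_divide_distrib)
    finally show ?case using sym[OF elim] by simp
  qed
  then have "((\<lambda>s. (L2_inner (A s) (u s) - L2_inner (A t) (u t)) / (s - t)) \<longlongrightarrow> 2 * L2_inner (A t) u') (at t)"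
    using lim by (rule Lim_transform_eventually[rotated])
  then show ?thesis by (simp only: has_field_derivative_iff)
qed

lemma edge_integral_le:
  fixes F :: "'e \<times> real \<Rightarrow> real"
  assumes F: "integrable (graph_measure G) F" and nonneg: "\<And>p. 0 \<le> F p" and e: "e \<in> edges G"
  shows "(LINT x:{0<..<elen G e}|lborel. F (e, x)) \<le> (LINT p|graph_measure G. F p)"
proof -
  let ?I = "\<lambda>e. LINT x:{0<..<elen G e}|lborel. F (e, x)"
  have n: "0 \<le> ?I e" for e
    unfolding set_lebesgue_integral_def using nonneg by (intro integral_nonneg_AE AE_I2) simp
  have "infsetsum ?I {e} \<le> infsetsum ?I (edges G)"
    using e n by (intro infsetsum_mono_neutral_left graph_integral(2)[OF F]) auto
  then show ?thesis using graph_integral(3)[OF F] by simp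
qed

lemma nonincreasing_from_1:
  fixes F F' :: "real \<Rightarrow> real"
  assumes "\<And>t. 0 < t \<Longrightarrow> (F has_real_derivative F' t) (at t)" "\<And>t. 0 < t \<Longrightarrow> F' t \<le> 0" "1 \<le> t"
  shows "F t \<le> F 1"
proof (rule DERIV_nonpos_imp_nonincreasing[OF assms(3)])
  fix x :: real assume "1 \<le> x" "x \<le> t"
  then have "0 < x" by simp
  then show "\<exists>y. DERIV F x :> y \<and> y \<le> 0" using assms(1,2) by blast
qed

text \<open>Here \<open>u' - h\<close> is the reaction term, which lies between \<open>0\<close> and \<open>a * u\<close>.\<close>

lemma uniform_decay:
  fixes u u' h :: "real \<Rightarrow> 'e \<times> real \<Rightarrow> real"
  assumes S: "supersolution b r \<kappa> \<alpha>" and a: "0 \<le> a" "a < \<kappa>\<^sup>2"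
    and reg: "\<And>t. 0 < t \<Longrightarrow> regular (u t) (g t) (h t)"
    and cu: "\<And>t. 0 < t \<Longrightarrow> ((\<lambda>s. L2_norm G (\<lambda>p. u s p - u t p)) \<longlongrightarrow> 0) (at t)"
    and ch: "\<And>t. 0 < t \<Longrightarrow> ((\<lambda>s. L2_norm G (\<lambda>p. h s p - h t p)) \<longlongrightarrow> 0) (at t)"
    and u'L: "\<And>t. 0 < t \<Longrightarrow> u' t \<in> L2 G"
    and D: "\<And>t. 0 < t \<Longrightarrow> L2_has_derivative G u (u' t) t"
    and reaction: "\<And>t. 0 < t \<Longrightarrow> AE p in graph_measure G.
        0 \<le> u t p \<and> 0 \<le> u' t p - h t p \<and> u' t p - h t p \<le> a * u t p"
  shows "uniform_limit (points G) u (\<lambda>_. 0) at_top"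
proof -
  have L: "u t \<in> L2 G" "g t \<in> L2 G" "h t \<in> L2 G" if "0 < t" for t
    using regular_L2[OF reg[OF that]] by simp_all
  define \<Phi> where "\<Phi> t = L2_inner (u t) (u t)" for t
  define E where "E t = L2_inner (g t) (g t)" for t
  have green': "L2_inner (h s) (u t) = - L2_inner (g s) (g t)" if "0 < s" "0 < t" for s t
    by (rule green[OF reg[OF that(1)] reg[OF that(2)]])
  have D\<Phi>: "(\<Phi> has_real_derivative 2 * L2_inner (u t) (u' t)) (at t)" if t: "0 < t" for t
    unfolding \<Phi>_def[abs_def]
    by (rule has_derivative_symmetric_form[OF t L(1) L(1) u'L[OF t] cu[OF t] D[OF t]]) (auto simp: L2_inner_commute)
  have Eh: "E t = - L2_inner (h t) (u t)" if "0 < t" for t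
    using green'[OF that that] by (simp add: E_def)
  have DE: "(E has_real_derivative - (2 * L2_inner (h t) (u' t))) (at t)" if t: "0 < t" for t
  proof -
    have sym: "L2_inner (h s) (u t) = L2_inner (h t) (u s)" if "0 < s" for s
      using green'[OF that t] green'[OF t that] L2_inner_commute[of "g s" "g t"] by simp
    have "((\<lambda>s. - L2_inner (h s) (u s)) has_real_derivative - (2 * L2_inner (h t) (u' t))) (at t)"
      by (rule DERIV_minus[OF has_derivative_symmetric_form[OF t L(1) L(3) u'L[OF t] ch[OF t] D[OF t] sym]])
    then show ?thesis
      by (rule has_field_derivative_transform_within_open[of _ _ _ "{0<..}"]) (use t Eh in auto)
  qed
  define \<delta> where "\<delta> = \<kappa>\<^sup>2 - a"
  have \<delta>: "0 < \<delta>" using a by (simp add: \<delta>_def)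
  have \<Phi>0: "0 \<le> \<Phi> t" for t unfolding \<Phi>_def by (rule L2_inner_nonneg)
  have E0: "0 \<le> E t" for t unfolding E_def by (rule L2_inner_nonneg)
  have ineq\<Phi>: "2 * L2_inner (u t) (u' t) \<le> - 2 * \<delta> * \<Phi> t" if t: "0 < t" for t
  proof -
    have "L2_inner (u t) (u' t) \<le> L2_inner (\<lambda>p. 1 * h t p + a * u t p) (u t)"
      unfolding L2_inner_def
    proof (rule integral_mono_AE)
      show "integrable (graph_measure G) (\<lambda>p. u t p * u' t p)" by (intro L2_prod_integrable L u'L t)
      show "integrable (graph_measure G) (\<lambda>p. (1 * h t p + a * u t p) * u t p)"
        by (intro L2_prod_integrable L2_lincomb L t)
      show "AE p in graph_measure G. u t p * u' t p \<le> (1 * h t p + a * u t p) * u t p"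
        using reaction[OF t]
      proof eventually_elim
        case (elim p)
        then have "u t p * (u' t p - h t p) \<le> u t p * (a * u t p)" by (intro mult_left_mono) auto
        then show ?case by (simp add: algebra_simps)
      qed
    qed
    also have "\<dots> = - E t + a * \<Phi> t"
      using L2_inner_lincomb_left[OF L(3)[OF t] L(1)[OF t] L(1)[OF t], of 1 a] Eh[OF t] by (simp add: \<Phi>_def)
    also have "\<dots> \<le> - \<delta> * \<Phi> t"
      using poincare[OF S reg[OF t]] by (simp add: \<delta>_def \<Phi>_def E_def algebra_simps)
    finally show ?thesis by simp
  qed
  have ineqE: "- (2 * L2_inner (h t) (u' t)) \<le> a\<^sup>2 / 2 * \<Phi> t" if t: "0 < t" for t
  proof -
    have "- 2 * L2_inner (h t) (u' t) = (LINT p|graph_measure G. - 2 * (h t p * u' t p))"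
      unfolding L2_inner_def using L2_prod_integrable[OF L(3)[OF t] u'L[OF t]] by simp
    also have "\<dots> \<le> (LINT p|graph_measure G. a\<^sup>2 / 2 * (u t p * u t p))"
    proof (rule integral_mono_AE)
      show "integrable (graph_measure G) (\<lambda>p. - 2 * (h t p * u' t p))"
        using L2_prod_integrable[OF L(3)[OF t] u'L[OF t]] by simp
      show "integrable (graph_measure G) (\<lambda>p. a\<^sup>2 / 2 * (u t p * u t p))"
        using L2_prod_integrable[OF L(1)[OF t] L(1)[OF t]] by simp
      show "AE p in graph_measure G. - 2 * (h t p * u' t p) \<le> a\<^sup>2 / 2 * (u t p * u t p)"
        using reaction[OF t]
      proof eventually_elim
        case (elim p)
        \<comment> \<open>The inequality completes the square of \<open>2 * h + w\<close>.\<close>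
        define w where "w = u' t p - h t p"
        have "w\<^sup>2 \<le> (a * u t p)\<^sup>2" using elim by (intro power_mono) (auto simp: w_def)
        moreover have "0 \<le> (2 * h t p + w)\<^sup>2" by simp
        moreover have "(2 * h t p + w)\<^sup>2 = 4 * (h t p * u' t p) + w\<^sup>2"
          by (simp add: w_def power2_eq_square algebra_simps)
        moreover have "(a * u t p)\<^sup>2 = a\<^sup>2 * (u t p * u t p)" by (simp add: power2_eq_square)
        ultimately show ?case by linarith
      qed
    qed
    also have "\<dots> = a\<^sup>2 / 2 * \<Phi> t"
      unfolding \<Phi>_def L2_inner_def using L2_prod_integrable[OF L(1)[OF t] L(1)[OF t]] by simp
    finally show ?thesis by simp
  qed
  define C where "C = \<Phi> 1 * exp (2 * \<delta>)"
  have decay: "\<Phi> t \<le> C * exp (- (2 * \<delta>) * t)" if t: "1 \<le> t" for t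
  proof -
    have "\<Phi> t * exp (2 * \<delta> * t) \<le> \<Phi> 1 * exp (2 * \<delta> * 1)"
    proof (rule nonincreasing_from_1[OF _ _ t])
      fix s :: real assume s: "0 < s"
      have "((\<lambda>s. exp (2 * \<delta> * s)) has_real_derivative 2 * \<delta> * exp (2 * \<delta> * s)) (at s)"
        using DERIV_fun_exp[OF DERIV_cmult_Id[of "2 * \<delta>" s]] by (simp only: mult.commute[of "exp (2 * \<delta> * s)"])
      from DERIV_mult[OF D\<Phi>[OF s] this]
      show "((\<lambda>s. \<Phi> s * exp (2 * \<delta> * s)) has_real_derivative
         2 * L2_inner (u s) (u' s) * exp (2 * \<delta> * s) + 2 * \<delta> * exp (2 * \<delta> * s) * \<Phi> s) (at s)" .
      have "2 * L2_inner (u s) (u' s) * exp (2 * \<delta> * s) \<le> - 2 * \<delta> * \<Phi> s * exp (2 * \<delta> * s)"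
        by (rule mult_right_mono[OF ineq\<Phi>[OF s]]) simp
      moreover have "2 * \<delta> * exp (2 * \<delta> * s) * \<Phi> s = - (- 2 * \<delta> * \<Phi> s * exp (2 * \<delta> * s))"
        by (simp only: minus_mult_minus mult_minus_left minus_minus mult.assoc mult.commute[of "exp (2 * (\<delta> * s))"])
      ultimately show "2 * L2_inner (u s) (u' s) * exp (2 * \<delta> * s) + 2 * \<delta> * exp (2 * \<delta> * s) * \<Phi> s \<le> 0"
        by linarith
    qed
    then have "\<Phi> t * exp (2 * \<delta> * t) * exp (- (2 * \<delta>) * t) \<le> C * exp (- (2 * \<delta>) * t)"
      unfolding C_def by (intro mult_right_mono) simp_all
    moreover have "\<Phi> t * exp (2 * \<delta> * t) * exp (- (2 * \<delta>) * t) = \<Phi> t"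
    proof -
      have "exp (2 * \<delta> * t) * exp (- (2 * \<delta>) * t) = exp (2 * \<delta> * t + - (2 * \<delta>) * t)" by (rule exp_add[symmetric])
      also have "\<dots> = 1" by simp
      finally show ?thesis by (simp only: mult.assoc mult_1_right)
    qed
    ultimately show ?thesis by linarith
  qed
  \<comment> \<open>This multiple of the decay of \<open>\<Phi>\<close> compensates the possible growth of \<open>E\<close>.\<close>
  define K where "K = a\<^sup>2 / (4 * \<delta>)"
  have K: "2 * \<delta> * K = a\<^sup>2 / 2" "0 \<le> K" using \<delta> by (simp_all add: K_def)
  define Q where "Q = E 1 + K * \<Phi> 1"
  have energy: "E t \<le> Q" if t: "1 \<le> t" for t
  proof -
    have "E t + K * \<Phi> t \<le> E 1 + K * \<Phi> 1"
    proof (rule nonincreasing_from_1[OF _ _ t])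
      fix s :: real assume s: "0 < s"
      show "((\<lambda>s. E s + K * \<Phi> s) has_real_derivative - (2 * L2_inner (h s) (u' s)) + K * (2 * L2_inner (u s) (u' s))) (at s)"
        by (rule DERIV_add[OF DE[OF s] DERIV_cmult[OF D\<Phi>[OF s]]])
      have "K * (2 * L2_inner (u s) (u' s)) \<le> K * (- 2 * \<delta> * \<Phi> s)" by (rule mult_left_mono[OF ineq\<Phi>[OF s] K(2)])
      also have "\<dots> = - (2 * \<delta> * K) * \<Phi> s" by simp
      also have "\<dots> = - (a\<^sup>2 / 2 * \<Phi> s)" unfolding K(1) by simp
      finally show "- (2 * L2_inner (h s) (u' s)) + K * (2 * L2_inner (u s) (u' s)) \<le> 0" using ineqE[OF s] by linarith
    qed
    moreover have "0 \<le> K * \<Phi> t" using K(2) \<Phi>0 by simp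
    ultimately show ?thesis by (simp add: Q_def)
  qed
  have Q0: "0 \<le> Q" using E0[of 1] energy[of 1] by simp
  have \<Phi>lim: "(\<Phi> \<longlongrightarrow> 0) at_top"
  proof (rule tendsto_sandwich[of "\<lambda>_. 0" _ _ "\<lambda>t. C * exp (- (2 * \<delta>) * t)"])
    show "\<forall>\<^sub>F t in at_top. \<Phi> t \<le> C * exp (- (2 * \<delta>) * t)"
      using eventually_ge_at_top[of 1] by eventually_elim (rule decay)
    have "filterlim (\<lambda>t. (2 * \<delta>) * t) at_top at_top"
      using \<delta> by (intro filterlim_tendsto_pos_mult_at_top[OF tendsto_const] filterlim_ident) auto
    then have "filterlim (\<lambda>t. - ((2 * \<delta>) * t)) at_bot at_top"
      by (simp add: filterlim_uminus_at_bot)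
    then have "((\<lambda>t. exp (- ((2 * \<delta>) * t))) \<longlongrightarrow> 0) at_top"
      by (rule filterlim_compose[OF exp_at_bot])
    then have "((\<lambda>t. C * exp (- ((2 * \<delta>) * t))) \<longlongrightarrow> C * 0) at_top" by (intro tendsto_mult_left)
    then show "((\<lambda>t. C * exp (- (2 * \<delta>) * t)) \<longlongrightarrow> 0) at_top" by simp
  qed (auto simp: \<Phi>0)
  show ?thesis
  proof (rule uniform_limitI)
    fix \<epsilon> :: real assume \<epsilon>: "0 < \<epsilon>"
    \<comment> \<open>The denominator contains \<open>Q + 1\<close> because \<open>Q\<close> may be zero.\<close>
    define c where "c = \<epsilon>\<^sup>2 / (2 * (Q + 1))"
    have c: "0 < c" using \<epsilon> Q0 by (simp add: c_def)
    have cQ: "c * Q \<le> \<epsilon>\<^sup>2 / 2"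
    proof -
      have "c * Q \<le> c * (Q + 1)" using c by simp
      also have "\<dots> = \<epsilon>\<^sup>2 / 2" using Q0 by (simp add: c_def field_simps)
      finally show ?thesis .
    qed
    have rc: "0 < 1 / r + 1 / c" using r_pos c by (intro add_pos_pos) auto
    have "((\<lambda>t. (1 / r + 1 / c) * \<Phi> t) \<longlongrightarrow> (1 / r + 1 / c) * 0) at_top" by (intro tendsto_mult_left \<Phi>lim)
    then have "\<forall>\<^sub>F t in at_top. (1 / r + 1 / c) * \<Phi> t < \<epsilon>\<^sup>2 / 2"
      using \<epsilon> by (intro order_tendstoD(2)) auto
    then show "\<forall>\<^sub>F t in at_top. \<forall>p\<in>points G. dist (u t p) 0 < \<epsilon>"
      using eventually_ge_at_top[of 1]
    proof eventually_elim
      case (elim t)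
      then have t: "0 < t" by simp
      show ?case
      proof
        fix p assume "p \<in> points G"
        then obtain e x where p: "p = (e, x)" and e: "e \<in> edges G" and x: "x \<in> {0..r}"
          using elen_eq by (auto simp: points_def)
        have "(u t (e, x))\<^sup>2 \<le> (1 / r + 1 / c) * (LINT y:{0<..<elen G e}|lborel. (u t (e, y))\<^sup>2)
            + c * (LINT y:{0<..<elen G e}|lborel. (g t (e, y))\<^sup>2)"
          by (rule trace_bound[OF L(1)[OF t] L(2)[OF t] e c x regular_ac_on(1)[OF reg[OF t] e]])
        also have "\<dots> \<le> (1 / r + 1 / c) * \<Phi> t + c * E t"
        proof (intro add_mono mult_left_mono)
          show "(LINT y:{0<..<elen G e}|lborel. (u t (e, y))\<^sup>2) \<le> \<Phi> t"
            using edge_integral_le[OF L2_real(2)[OF L(1)[OF t]] _ e] by (simp add: \<Phi>_def L2_inner_def power2_eq_square)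
          show "(LINT y:{0<..<elen G e}|lborel. (g t (e, y))\<^sup>2) \<le> E t"
            using edge_integral_le[OF L2_real(2)[OF L(2)[OF t]] _ e] by (simp add: E_def L2_inner_def power2_eq_square)
        qed (use rc c in simp_all)
        also have "\<dots> \<le> (1 / r + 1 / c) * \<Phi> t + c * Q"
          using mult_left_mono[OF energy[OF elim(2)], of c] c by linarith
        also have "\<dots> < \<epsilon>\<^sup>2" using elim(1) cQ by linarith
        finally have "\<bar>u t (e, x)\<bar>\<^sup>2 < \<epsilon>\<^sup>2" by (simp only: power2_abs)
        then have "\<bar>u t (e, x)\<bar> < \<epsilon>" by (rule power2_less_imp_less) (use \<epsilon> in simp)
        then show "dist (u t p) 0 < \<epsilon>" by (simp add: p)
      qed
    qed
  qed
qed

end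

text \<open>The supremum is meaningful because the quotients are bounded by the maximum of
  \<open>\<bar>f'\<bar>\<close>.\<close>

lemma f_le_slope_times:
  fixes f f' :: "real \<Rightarrow> real"
  assumes D: "\<forall>x\<in>{0..1}. (f has_real_derivative f' x) (at x within {0..1})"
    and cont: "continuous_on {0..1} f'" and f0: "f 0 = 0"
    and sup: "(SUP x\<in>{0<..1}. f x / x) = f' 0" and x: "x \<in> {0..1}"
  shows "f x \<le> f' 0 * x"
proof (cases "x = 0")
  case False
  obtain B where B: "\<And>y. y \<in> {0..1} \<Longrightarrow> norm (f' y) \<le> B"
    using compact_imp_bounded[OF compact_continuous_image[OF cont compact_Icc]]
    unfolding bounded_iff by fastforce
  have "f y / y \<le> B" if y: "y \<in> {0<..1}" for y
  proof -
    have "norm (f y - f 0) \<le> B * norm (y - 0)"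
      using y D by (intro field_differentiable_bound[of "{0..1}" f f'] B) auto
    then have "f y \<le> B * y" using y f0 by simp
    then show ?thesis using y by (simp add: pos_divide_le_eq)
  qed
  then have "bdd_above ((\<lambda>x. f x / x) ` {0<..1})" by (intro bdd_aboveI2)
  then have "f x / x \<le> (SUP x\<in>{0<..1}. f x / x)" using x False by (intro cSUP_upper) auto
  then show ?thesis unfolding sup using x False by (simp add: pos_divide_le_eq)
qed (simp add: f0)

theorem theorem2p2:
  fixes T :: "('v, 'e) metric_graph"
    and b :: nat and r :: real
    and u0 :: "'e \<times> real \<Rightarrow> real"
    and f f' :: "real \<Rightarrow> real"
    and E0 lam \<alpha> :: real
    and u :: "real \<Rightarrow> 'e \<times> real \<Rightarrow> real"
  assumes "b \<ge> 2" and "r > 0" and "homogeneous_tree b r T"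
    and "u0 \<in> L2 T" and "AE p in graph_measure T. 0 \<le> u0 p \<and> u0 p \<le> 1"
    and "\<forall>x\<in>{0..1}. (f has_real_derivative f' x) (at x within {0..1})"
    and "continuous_on {0..1} f'"
    and "\<forall>n. \<forall>x\<in>{0<..<1}. (deriv ^^ n) f field_differentiable (at x)"
    and "f 0 = 0" and "f 1 = 0" and "\<forall>x\<in>{0<..<1}. f x > 0"
    and "(SUP x\<in>{0<..1}. f x / x) = f' 0"
    and "is_min_spectrum T E0" and "f' 0 < E0"
    and "\<not> (AE p in graph_measure T. u0 p = 0)"
    and "f' 0 < lam" and "lam < E0" and "0 < \<alpha>" and "\<alpha> < 1"
    and "\<alpha>\<^sup>2 - 2 * ((real b + 1) / (2 * sqrt (real b))) * cos (sqrt lam * r) * \<alpha> + 1 \<le> 0"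
    and "AE p in graph_measure T. u0 p \<le> profile b r lam \<alpha> (rho T p)"
    and "is_solution T f u0 u"
  shows "uniform_limit (points T) u (\<lambda>_. 0) at_top"
proof -
  interpret homogeneous T b r using assms(1-3) by unfold_locales
  have f_le: "f x \<le> f' 0 * x" if "x \<in> {0..1}" for x
    by (rule f_le_slope_times[OF assms(6,7,9,12) that])
  have f_ge: "0 \<le> f x" if "x \<in> {0..1}" for x
  proof (cases "x = 0 \<or> x = 1")
    case True
    then show ?thesis using assms(9,10) by auto
  next
    case False
    then have "x \<in> {0<..<1}" using that by auto
    then show ?thesis using assms(11) by (auto intro: less_imp_le)
  qed
  have "0 < f (1/2)" using assms(11) by simp
  then have f'0: "0 < f' 0" using f_le[of "1/2"] by simp
  define \<kappa> where "\<kappa> = sqrt lam"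
  have lam: "0 < lam" using f'0 assms(16) by simp
  then have \<kappa>: "0 < \<kappa>" "\<kappa>\<^sup>2 = lam" by (simp_all add: \<kappa>_def)
  have "E0 \<le> (pi / r)\<^sup>2" using sine_eigenvalue assms(13) unfolding is_min_spectrum_def by blast
  then have "\<kappa>\<^sup>2 < (pi / r)\<^sup>2" using \<kappa>(2) assms(17) by simp
  then have "\<kappa> < pi / r" by (rule power2_less_imp_less) (use r0 in simp)
  then have kr: "\<kappa> * r < pi" using pos_less_divide_eq[OF r0] by simp
  have cos: "0 < cos (\<kappa> * r)"
  proof (rule ccontr)
    assume "\<not> 0 < cos (\<kappa> * r)"
    then have "cos (\<kappa> * r) \<le> 0" by simp
    then have "2 * ((real b + 1) / (2 * sqrt (real b))) * cos (\<kappa> * r) * \<alpha> \<le> 0"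
      using assms(18) by (intro mult_nonpos_nonneg mult_nonneg_nonpos) auto
    moreover have "0 \<le> \<alpha>\<^sup>2" by simp
    ultimately show False using assms(20) unfolding \<kappa>_def by linarith
  qed
  have small: "\<kappa> * r < pi / 2"
  proof (rule ccontr)
    assume "\<not> \<kappa> * r < pi / 2"
    then have "cos (\<kappa> * r) \<le> cos (pi / 2)" using kr by (intro cos_monotone_0_pi_le) auto
    then show False using cos by simp
  qed
  have S: "supersolution b r \<kappa> \<alpha>"
    using assms(1,2,18,19,20) \<kappa> small unfolding \<kappa>_def by unfold_locales
  note sol = assms(22)[unfolded is_solution_def]
  have uc: "L2_continuous_on T {0..} u" using sol by (elim conjE)
  have ub: "\<forall>t\<ge>0. AE p in graph_measure T. 0 \<le> u t p \<and> u t p \<le> 1" using sol by (elim conjE)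
  have ud: "\<forall>t>0. u t \<in> laplacian_domain T" using sol by (elim conjE)
  have lc: "L2_continuous_on T {0<..} (\<lambda>t. laplacian T (u t))" using sol by (elim conjE)
  obtain u' where u'c: "L2_continuous_on T {0<..} u'"
    and u'd: "\<forall>t>0. L2_has_derivative T u (u' t) t"
    and u'e: "\<forall>t>0. AE p in graph_measure T. u' t p = laplacian T (u t) p + f (u t p)"
    using sol by (elim conjE exE)
  have "\<forall>t. \<exists>g. 0 < t \<longrightarrow> regular (u t) g (laplacian T (u t))"
    using laplacian_regular ud by meson
  then obtain g where g: "\<And>t. 0 < t \<Longrightarrow> regular (u t) (g t) (laplacian T (u t))" by metis
  show ?thesis
  proof (rule uniform_decay[OF S _ _ g, where a = "f' 0" and u' = u'])
    show "0 \<le> f' 0" "f' 0 < \<kappa>\<^sup>2" using f'0 \<kappa>(2) assms(16) by simp_all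
    fix t :: real assume t: "0 < t"
    show "((\<lambda>s. L2_norm T (\<lambda>p. u s p - u t p)) \<longlongrightarrow> 0) (at t)"
    proof -
      have "((\<lambda>s. L2_norm T (\<lambda>p. u s p - u t p)) \<longlongrightarrow> 0) (at t within {0..})"
        using uc t unfolding L2_continuous_on_def by simp
      moreover have "at t within {0..} = at t" using t by (intro at_within_interior) simp
      ultimately show ?thesis by simp
    qed
    show "((\<lambda>s. L2_norm T (\<lambda>p. laplacian T (u s) p - laplacian T (u t) p)) \<longlongrightarrow> 0) (at t)"
    proof -
      have "((\<lambda>s. L2_norm T (\<lambda>p. laplacian T (u s) p - laplacian T (u t) p)) \<longlongrightarrow> 0) (at t within {0<..})"
        using lc t unfolding L2_continuous_on_def by simp
      moreover have "at t within {0<..} = at t" using t by (intro at_within_open) auto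
      ultimately show ?thesis by simp
    qed
    show "u' t \<in> L2 T" using u'c t unfolding L2_continuous_on_def by simp
    show "L2_has_derivative T u (u' t) t" using u'd t by simp
    have 1: "AE p in graph_measure T. 0 \<le> u t p \<and> u t p \<le> 1" using ub t by simp
    have 2: "AE p in graph_measure T. u' t p = laplacian T (u t) p + f (u t p)" using u'e t by simp
    show "AE p in graph_measure T. 0 \<le> u t p \<and> 0 \<le> u' t p - laplacian T (u t) p \<and>
        u' t p - laplacian T (u t) p \<le> f' 0 * u t p"
      using 1 2
    proof eventually_elim
      case (elim p)
      then show ?case using f_le[of "u t p"] f_ge[of "u t p"] by simp
    qed
  qed
qed

end
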